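(* Let $\Phi:(\mathbb{C}^2,0)\to(\mathbb{C}^3,0)$ be a holomorphic germ singular only at the origin, with associated immersion $f:S^3\looparrowright S^5$. Then $$\pi_3(\tau)(\Omega_{\mathbb{C}}(\Phi))=\pi_3(j)(\Omega(f))\quad\text{in }\pi_3(SO(6)).$$
   Context: $\Phi$ is singular only at the origin if $\{z:\mathrm{rank}(d\Phi_z)<2\}\subset\{0\}$ in a small representative. For sufficiently small $\epsilon>0$, $\mathfrak{S}^3=\Phi^{-1}(S^5_\epsilon)$ bounds a smooth ball around $0\in\mathbb{C}^2$ and is isotopic in $\mathbb{C}^2\setminus\{0\}$ to a small standard sphere, hence identified with $S^3$; $f=\Phi|_{\mathfrak{S}^3}:S^3\looparrowright S^5$ is the associated immersion. $\tau:U(3)\to SO(6)$ is the map replacing every entry $a+bi$ by the real block $\begin{pmatrix} a & -b \\ b & a \end{pmatrix}$; $j:SO(5)\hookrightarrow SO(6)$ is the inclusion. Complex Smale invariant: $\Omega_{\mathbb{C}}(\Phi)=[d\Phi|_{S^3}]\in\pi_3(V_2(\mathbb{C}^3))\cong\pi_3(U(3))$, where $d\Phi$ is the complex Jacobian, $S^3$ is a small sphere around $0$, $V_2(\mathbb{C}^3)$ is the Stiefel manifold of linearly independent 2-frames of $\mathbb{C}^3$, and the isomorphism is induced by the projection $U(3)\to V_2(\mathbb{C}^3)$. Smale invariant: for an immersion $f:S^3\looparrowright\mathbb{R}^5$, where $S^3\subset\mathbb{R}^4\subset\mathbb{R}^5$ is the unit sphere of $\mathbb{R}^4=\mathbb{C}^2$,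 choose a tubular neighbourhood $U$ of $S^3$ in $\mathbb{R}^5$ and an orientation preserving immersion $F:U\looparrowright\mathbb{R}^5$ extending $f$. Then $\Omega(f)=[dF|_{S^3}]\in\pi_3(GL^+(5,\mathbb{R}))=\pi_3(SO(5))$. For immersions into $S^5$ one removes a point of $S^5$ outside the image and identifies the complement with $\mathbb{R}^5$. *)

theory Defs
  imports "HOL-Analysis.Analysis"
begin

section \<open>Smooth maps\<close>

primrec Ck_on :: "nat \<Rightarrow> 'a::euclidean_space set \<Rightarrow> ('a \<Rightarrow> 'b::real_normed_vector) \<Rightarrow> bool" where
  "Ck_on 0 U f \<longleftrightarrow> continuous_on U f"
| "Ck_on (Suc k) U f \<longleftrightarrow>
     (\<forall>x\<in>U. f differentiable (at x)) \<and>
     (\<forall>v. Ck_on k U (\<lambda>x. frechet_derivative f (at x) v))"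

text \<open>\<^const>\<open>Ck_on\<close> is only meaningful on open sets.\<close>

definition smooth_on_open :: "'a::euclidean_space set \<Rightarrow> ('a \<Rightarrow> 'b::real_normed_vector) \<Rightarrow> bool" where
  "smooth_on_open U f \<longleftrightarrow> open U \<and> (\<forall>k. Ck_on k U f)"

definition smooth_on :: "'a::euclidean_space set \<Rightarrow> ('a \<Rightarrow> 'b::real_normed_vector) \<Rightarrow> bool" where
  "smooth_on S f \<longleftrightarrow> (\<exists>W g. S \<subseteq> W \<and> smooth_on_open W g \<and> (\<forall>x\<in>S. g x = f x))"

abbreviation S3 :: "(complex^2) set" where
  "S3 \<equiv> sphere 0 1"

text \<open>The derivative of the extension \<open>g\<close> in directions tangent to the sphere depends only on \<open>f\<close>.\<close>

definition S3_immersion :: "(complex^2 \<Rightarrow> 'b::real_normed_vector) \<Rightarrow> bool" where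
  "S3_immersion f \<longleftrightarrow>
     (\<exists>W g. S3 \<subseteq> W \<and> smooth_on_open W g \<and> (\<forall>x\<in>S3. g x = f x) \<and>
        (\<forall>x\<in>S3. \<forall>v. v \<bullet> x = 0 \<and> v \<noteq> 0 \<longrightarrow> frechet_derivative g (at x) v \<noteq> 0))"

text \<open>Since \<^term>\<open>S3\<close> is compact, an injective immersion is an embedding.\<close>

definition S3_embedding :: "(complex^2 \<Rightarrow> 'b::real_normed_vector) \<Rightarrow> bool" where
  "S3_embedding f \<longleftrightarrow> S3_immersion f \<and> inj_on f S3"


section \<open>Third homotopy groups\<close>

text \<open>
  Elements of \<open>\<pi>\<^sub>3(X,x\<^sub>0)\<close> are pointed homotopy classes of pointed maps on \<^term>\<open>S3\<close>. Maps are total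
  functions in HOL; homotopies, and hence the classes, constrain their values on \<^term>\<open>S3\<close> only.
  The group structure is not needed below.
\<close>

definition S3_base :: "complex^2" where
  "S3_base = axis 1 1"

definition pi3_class :: "'a::topological_space set \<Rightarrow> 'a \<Rightarrow> (complex^2 \<Rightarrow> 'a) \<Rightarrow> (complex^2 \<Rightarrow> 'a) set" where
  "pi3_class X x0 f = {g. homotopic_with_canon (\<lambda>h. h S3_base = x0) S3 X f g}"

definition pi3 :: "'a::topological_space set \<Rightarrow> 'a \<Rightarrow> (complex^2 \<Rightarrow> 'a) set set" where
  "pi3 X x0 = {pi3_class X x0 f | f. continuous_on S3 f \<and> f ` S3 \<subseteq> X \<and> f S3_base = x0}"

definition pi3_map :: "'b::topological_space set \<Rightarrow> 'b \<Rightarrow> ('a::topological_space \<Rightarrow> 'b) \<Rightarrow>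
    (complex^2 \<Rightarrow> 'a) set \<Rightarrow> (complex^2 \<Rightarrow> 'b) set" where
  "pi3_map Y y0 \<phi> c = (\<Union>f\<in>c. pi3_class Y y0 (\<phi> \<circ> f))"

text \<open>
  The class \<open>[h]\<close> of a map \<open>h\<close> that need not preserve base points is the element of \<open>\<pi>\<^sub>3(X,x\<^sub>0)\<close> whose
  representatives are freely homotopic to \<open>h\<close>. This is well defined when \<open>X\<close> is path connected and
  \<open>\<pi>\<^sub>1(X)\<close> acts trivially, as for the connected Lie groups and the Stiefel manifold below.
\<close>

definition is_class_of :: "'a::topological_space set \<Rightarrow> (complex^2 \<Rightarrow> 'a) set \<Rightarrow> (complex^2 \<Rightarrow> 'a) \<Rightarrow> bool" where
  "is_class_of X c h \<longleftrightarrow> (\<exists>f\<in>c. homotopic_with_canon (\<lambda>_. True) S3 X f h)"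


section \<open>Matrix groups and the maps between them\<close>

definition U3 :: "(complex^3^3) set" where
  "U3 = {A. A ** (\<chi> i j. cnj (A $ j $ i)) = mat 1}"

definition V2C3 :: "(complex^2^3) set" where
  "V2C3 = {A. \<forall>c. c $ 1 *s column 1 A + c $ 2 *s column 2 A = 0 \<longrightarrow> c = (0 :: complex^2)}"

definition frame_of :: "complex^3^3 \<Rightarrow> complex^2^3" where
  "frame_of A = (\<chi> i j. if j = 1 then A $ i $ 1 else A $ i $ 2)"

definition GLpos5 :: "(real^5^5) set" where
  "GLpos5 = {A. det A > 0}"

definition SO5 :: "(real^5^5) set" where
  "SO5 = {A. rotation_matrix A}"

definition SO6 :: "(real^6^6) set" where
  "SO6 = {A. rotation_matrix A}"

text \<open>
  The identifications \<open>\<complex>\<^sup>2 = \<real>\<^sup>4 \<subset> \<real>\<^sup>5\<close> and \<open>\<complex>\<^sup>3 = \<real>\<^sup>6\<close> list real and imaginary parts alternately.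
\<close>

definition to_R5 :: "complex^2 \<Rightarrow> real^5" where
  "to_R5 z = vector [Re (z $ 1), Im (z $ 1), Re (z $ 2), Im (z $ 2), 0]"

definition to_R6 :: "complex^3 \<Rightarrow> real^6" where
  "to_R6 z = vector [Re (z $ 1), Im (z $ 1), Re (z $ 2), Im (z $ 2), Re (z $ 3), Im (z $ 3)]"

text \<open>
  The real index \<open>i\<close> lies in the block of the complex index \<open>cblock i\<close>. In the finite type \<open>6\<close> the
  numeral \<open>6\<close> denotes the same index as \<open>0\<close>.
\<close>

definition cblock :: "6 \<Rightarrow> 3" where
  "cblock i = (if i \<in> {1, 2} then 1 else if i \<in> {3, 4} then 2 else 3)"

definition second_in_block :: "6 \<Rightarrow> bool" where
  "second_in_block i \<longleftrightarrow> i \<in> {2, 4, 6}"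

definition tau :: "complex^3^3 \<Rightarrow> real^6^6" where
  "tau A = (\<chi> i k. let a = A $ cblock i $ cblock k in
     if second_in_block i = second_in_block k then Re a
     else if second_in_block i then Im a else - Im a)"

definition index5 :: "6 \<Rightarrow> 5" where
  "index5 i = (if i = 1 then 1 else if i = 2 then 2 else if i = 3 then 3 else if i = 4 then 4 else 5)"

definition j_incl :: "real^5^5 \<Rightarrow> real^6^6" where
  "j_incl A = (\<chi> i k. if i = 6 \<or> k = 6 then (if i = k then 1 else 0)
     else A $ index5 i $ index5 k)"


section \<open>Holomorphic germs and the complex Smale invariant\<close>

definition holomorphic_germ :: "(complex^'n \<Rightarrow> complex^'m) \<Rightarrow> bool" where
  "holomorphic_germ \<Phi> \<longleftrightarrow> (\<exists>U. open U \<and> 0 \<in> U \<and>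
     (\<forall>z\<in>U. \<exists>D. (\<Phi> has_derivative D) (at z) \<and> (\<forall>c v. D (c *s v) = c *s D v)))"

definition complex_jacobian :: "(complex^'n \<Rightarrow> complex^'m) \<Rightarrow> complex^'n \<Rightarrow> complex^'n^'m" where
  "complex_jacobian \<Phi> z = (\<chi> i j. frechet_derivative \<Phi> (at z) (axis j 1) $ i)"

definition singular_only_at_origin :: "(complex^2 \<Rightarrow> complex^3) \<Rightarrow> bool" where
  "singular_only_at_origin \<Phi> \<longleftrightarrow>
     (\<exists>U. open U \<and> 0 \<in> U \<and> {z\<in>U. rank (complex_jacobian \<Phi> z) < 2} \<subseteq> {0})"

definition Omega_C :: "(complex^2 \<Rightarrow> complex^3) \<Rightarrow> (complex^2 \<Rightarrow> complex^3^3) set" where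
  "Omega_C \<Phi> = (THE \<omega>. \<omega> \<in> pi3 U3 (mat 1) \<and>
     (\<forall>\<^sub>F r in at_right 0.
        is_class_of V2C3 (pi3_map V2C3 (frame_of (mat 1)) frame_of \<omega>)
          (\<lambda>x. complex_jacobian \<Phi> (r *\<^sub>R x))))"


section \<open>The Smale invariant\<close>

text \<open>
  \<open>is_smale_invariant_R5 f \<omega>\<close> says that \<open>\<omega>\<close> is the Smale invariant of \<open>f\<close> computed from some admissible extension
  \<open>F\<close> of \<open>f\<close>; a statement about the Smale invariant quantifies universally over \<open>\<omega>\<close>, that is,
  over all choices. Only the germ of \<open>F\<close> along the sphere enters, and every open neighbourhood of the sphere
  contains a tubular one.
\<close>

definition is_smale_invariant_R5 :: "(complex^2 \<Rightarrow> real^5) \<Rightarrow> (complex^2 \<Rightarrow> real^5^5) set \<Rightarrow> bool" where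
  "is_smale_invariant_R5 f \<omega> \<longleftrightarrow> \<omega> \<in> pi3 SO5 (mat 1) \<and>
     (\<exists>U F. to_R5 ` S3 \<subseteq> U \<and> smooth_on_open U F \<and>
        (\<forall>y\<in>U. det (jacobian F (at y)) > 0) \<and>
        (\<forall>x\<in>S3. F (to_R5 x) = f x) \<and>
        is_class_of GLpos5 (pi3_map GLpos5 (mat 1) (\<lambda>A. A) \<omega>) (\<lambda>x. jacobian F (at (to_R5 x))))"

text \<open>
  \<open>k\<close> is the inverse of an orientation preserving diffeomorphism from the sphere of radius \<open>\<epsilon>\<close> minus
  \<open>q\<close> onto \<open>\<real>\<^sup>5\<close>, where the sphere is oriented as the boundary of the ball (outward normal first).
\<close>

definition punctured_S5_param :: "real \<Rightarrow> complex^3 \<Rightarrow> (real^5 \<Rightarrow> complex^3) \<Rightarrow> bool" where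
  "punctured_S5_param \<epsilon> q k \<longleftrightarrow>
     bij_betw k UNIV (sphere 0 \<epsilon> - {q}) \<and> smooth_on UNIV k \<and>
     smooth_on (sphere 0 \<epsilon> - {q}) (inv k) \<and>
     (\<forall>y. let d = (\<lambda>i. to_R6 (frechet_derivative k (at y) (axis i 1)))
          in det (vector [to_R6 (k y), d 1, d 2, d 3, d 4, d 5] :: real^6^6) > 0)"

definition is_smale_invariant_S5 :: "real \<Rightarrow> (complex^2 \<Rightarrow> complex^3) \<Rightarrow> (complex^2 \<Rightarrow> real^5^5) set \<Rightarrow> bool" where
  "is_smale_invariant_S5 \<epsilon> f \<omega> \<longleftrightarrow> f ` S3 \<subseteq> sphere 0 \<epsilon> \<and>
     (\<exists>q k. q \<in> sphere 0 \<epsilon> - f ` S3 \<and> punctured_S5_param \<epsilon> q k \<and> is_smale_invariant_R5 (inv k \<circ> f) \<omega>)"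


section \<open>The associated immersion\<close>

definition link_at_origin :: "(complex^2 \<Rightarrow> complex^3) \<Rightarrow> real \<Rightarrow> real \<Rightarrow> (complex^2) set" where
  "link_at_origin \<Phi> \<delta> \<epsilon> = {z \<in> ball 0 \<delta>. \<Phi> z \<in> sphere 0 \<epsilon>}"

text \<open>
  \<open>\<phi>\<close> identifies \<^term>\<open>S3\<close> with \<open>M\<close> by a smooth isotopy in \<open>\<complex>\<^sup>2 - {0}\<close> starting at a round sphere
  around the origin. All these round spheres are isotopic to each other, so the radius need not be
  bounded.
\<close>

definition identifies_S3 :: "(complex^2) set \<Rightarrow> (complex^2 \<Rightarrow> complex^2) \<Rightarrow> bool" where
  "identifies_S3 M \<phi> \<longleftrightarrow> \<phi> ` S3 = M \<and>
     (\<exists>r>0. \<exists>H :: real \<times> (complex^2) \<Rightarrow> complex^2.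
        smooth_on ({0..1} \<times> S3) H \<and>
        (\<forall>t\<in>{0..1}. S3_embedding (\<lambda>x. H (t, x)) \<and> (\<forall>x\<in>S3. H (t, x) \<noteq> 0)) \<and>
        (\<forall>x\<in>S3. H (0, x) = r *\<^sub>R x \<and> H (1, x) = \<phi> x))"

text \<open>\<open>f\<close> is the restriction of \<open>\<Phi>\<close> to its link, transported to \<^term>\<open>S3\<close>; \<open>\<delta>\<close> is the radius of the
  ball on which the germ is represented.\<close>

definition associated_immersion ::
    "(complex^2 \<Rightarrow> complex^3) \<Rightarrow> real \<Rightarrow> real \<Rightarrow> (complex^2 \<Rightarrow> complex^3) \<Rightarrow> bool" where
  "associated_immersion \<Phi> \<delta> \<epsilon> f \<longleftrightarrow>
     (\<exists>\<phi>. identifies_S3 (link_at_origin \<Phi> \<delta> \<epsilon>) \<phi> \<and> f = \<Phi> \<circ> \<phi>)"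

end

(*
  Idea. Write a real 6-frame of C^3 as a triple (L, p, q), where L embeds C^2 = R^4 into C^3. Stabilising the
  Smale invariant by the outward normal N of S^5 gives the frame (dk dF|_{C^2}, dk dF(e_5), -N)
  along S^3, where k parametrises S^5 minus a point. Rotating in the plane spanned by the radial direction x of C^2 and
  the last basis vector moves N to the place of x; there it can be replaced by dPhi(nu), with nu the
  outward normal of the link, because |Phi|^2 strictly increases along nu. The first entry is
  then dPhi composed with an isomorphism D_1 of C^2, and following the isotopy back to a round sphere
  deforms D_1 to the identity. What remains is dPhi, completed by two vectors; such completions
  are all homotopic because pi_3(SO(2)) = 0, and one of them is tau of the complex invariant.

  That |Phi|^2 increases outwards has two parts. On the link |Phi|^2 has no critical points, as the
  tangent space contains a complex line and the Levi form of |Phi|^2 is positive. And |Phi|^2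
  cannot increase inwards, by the maximum principle on the bounded component of the complement of the link.
*)
theory Submission
  imports Defs "HOL-Complex_Analysis.Complex_Analysis"
begin

unbundle no fps_syntax

section \<open>Pointed and free homotopies\<close>

text \<open>All deformations are free homotopies of maps into \<open>GL6\<close>. They are made
  pointed and orthogonal only at the end, by translating with the inverse of the base point value
  and retracting by Gram-Schmidt; this also cancels constant factors such as the frame of dk at the
  origin of R^5. The link is only known to be an isotopic image of a round sphere. This does not
  make \<epsilon>^2 a regular value of |\<Phi>|^2, and first derivatives cannot exclude a critical
  point; hence the second order argument. Nor is it given which side of the link is the inner one.
  The isotopy carries the outward normal along, and what survives it is that y - p, normalised,
  stays essential as a map on the sphere when p is pushed to the inner side. The isotopy may leave
  the ball on which \<Phi> is regular, so \<Phi> is not composed with its intermediate stages: they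
  act through the isomorphisms D_t of C^2 while d\<Phi> stays at the link, and the Jacobian itself
  is moved only after a radial contraction into the ball.\<close>

lemma homotopic_canonI:
  fixes h :: "real \<Rightarrow> 'a::topological_space \<Rightarrow> 'b::topological_space"
  assumes cont: "continuous_on ({0..1} \<times> S) (\<lambda>z. h (fst z) (snd z))"
    and X: "\<And>t x. t \<in> {0..1} \<Longrightarrow> x \<in> S \<Longrightarrow> h t x \<in> X"
    and "\<And>x. x \<in> S \<Longrightarrow> h 0 x = f x" "\<And>x. x \<in> S \<Longrightarrow> h 1 x = g x"
    and P: "\<And>t. t \<in> {0..1} \<Longrightarrow> P (h t)"
    and cong: "\<And>h k. (\<And>x. x \<in> S \<Longrightarrow> h x = k x) \<Longrightarrow> P h = P k"
  shows "homotopic_with_canon P S X f g"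
proof (subst homotopic_with)
  show "\<exists>h. continuous_map (prod_topology (top_of_set {0..1::real}) (top_of_set S)) (top_of_set X) h \<and>
      (\<forall>x\<in>topspace (top_of_set S). h (0, x) = f x) \<and>
      (\<forall>x\<in>topspace (top_of_set S). h (1, x) = g x) \<and> (\<forall>t\<in>{0..1}. P (\<lambda>x. h (t, x)))"
    by (intro exI[of _ "\<lambda>z. h (fst z) (snd z)"]) (use assms(1-5) in \<open>auto simp: image_subset_iff\<close>)
qed (rule cong, simp)

abbreviation freely_homotopic ::
    "'a::topological_space set \<Rightarrow> 'b::topological_space set \<Rightarrow> ('a \<Rightarrow> 'b) \<Rightarrow> ('a \<Rightarrow> 'b) \<Rightarrow> bool" where
  "freely_homotopic \<equiv> homotopic_with_canon (\<lambda>_. True)"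

lemmas homotopic_freeI = homotopic_canonI[where P = "\<lambda>_. True", simplified]

lemma homotopic_canonE:
  assumes "homotopic_with_canon P S X f g"
  obtains h where "continuous_on ({0..1::real} \<times> S) (\<lambda>z. h (fst z) (snd z))"
    "\<And>t x. t \<in> {0..1} \<Longrightarrow> x \<in> S \<Longrightarrow> h t x \<in> X"
    "\<And>x. h 0 x = f x" "\<And>x. h 1 x = g x" "\<And>t. t \<in> {0..1} \<Longrightarrow> P (h t)"
proof -
  from assms obtain h where "continuous_map (prod_topology (top_of_set {0..1}) (top_of_set S)) (top_of_set X) h"
      "\<forall>x. h (0::real, x) = f x" "\<forall>x. h (1, x) = g x" "\<forall>t\<in>{0..1}. P (\<lambda>x. h (t, x))"
    unfolding homotopic_with_def by blast
  then show ?thesis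
    by (intro that[of "\<lambda>t x. h (t, x)"]) (auto simp: image_subset_iff)
qed

lemma homotopic_canon_freely:
  "homotopic_with_canon P S X f g \<Longrightarrow> freely_homotopic S X f g"
  by (rule homotopic_with_mono) auto

lemma S3_base_in: "S3_base \<in> S3"
  by (simp add: S3_base_def)

lemma homotopic_pointedI:
  fixes h :: "real \<Rightarrow> complex^2 \<Rightarrow> 'b::topological_space"
  assumes "continuous_on ({0..1} \<times> S3) (\<lambda>z. h (fst z) (snd z))"
    and "\<And>t x. t \<in> {0..1} \<Longrightarrow> x \<in> S3 \<Longrightarrow> h t x \<in> X"
    and "\<And>x. x \<in> S3 \<Longrightarrow> h 0 x = f x" "\<And>x. x \<in> S3 \<Longrightarrow> h 1 x = g x"
    and "\<And>t. t \<in> {0..1} \<Longrightarrow> h t S3_base = x0"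
  shows "homotopic_with_canon (\<lambda>h. h S3_base = x0) S3 X f g"
  by (rule homotopic_canonI[where h = h]) (use assms S3_base_in in auto)

lemma connected_S3: "connected S3"
  by (rule connected_sphere) simp

lemma connected_01_S3: "connected ({0..1::real} \<times> S3)"
  by (intro connected_Times connected_S3) auto

lemma pos_on_connected:
  fixes f :: "'a::topological_space \<Rightarrow> real"
  assumes "connected S" "continuous_on S f" "\<And>x. x \<in> S \<Longrightarrow> f x \<noteq> 0" "a \<in> S" "f a > 0" "b \<in> S"
  shows "f b > 0"
proof (rule ccontr)
  assume "\<not> f b > 0"
  then have "f b \<le> 0" by simp
  moreover have "connected (f ` S)"
    using assms connected_continuous_image by blast
  ultimately have "0 \<in> f ` S"
    using assms connectedD_interval[of "f ` S" "f b" "f a" 0] by auto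
  then show False using assms(3) by auto
qed

lemma pi3_class_eqI:
  assumes "homotopic_with_canon (\<lambda>h. h S3_base = x0) S3 X f g"
  shows "pi3_class X x0 f = pi3_class X x0 g"
  unfolding pi3_class_def
  using homotopic_with_trans[OF assms] homotopic_with_trans[OF homotopic_with_symD[OF assms]] by blast

text \<open>Homotopic representatives have homotopic images, so the union defining
  \<open>pi3_map\<close> runs over copies of one and the same class.\<close>

lemma pi3_map_class:
  assumes f: "continuous_on S3 f" "f ` S3 \<subseteq> X" "f S3_base = x0"
    and \<phi>: "continuous_on X \<phi>" "\<phi> ` X \<subseteq> Y" "\<phi> x0 = y0"
  shows "pi3_map Y y0 \<phi> (pi3_class X x0 f) = pi3_class Y y0 (\<phi> \<circ> f)"
proof -
  have "pi3_class Y y0 (\<phi> \<circ> g) = pi3_class Y y0 (\<phi> \<circ> f)" if "g \<in> pi3_class X x0 f" for g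
  proof (rule pi3_class_eqI, rule homotopic_with_symD, rule homotopic_with_compose_continuous_left)
    show "homotopic_with_canon (\<lambda>h. (\<phi> \<circ> h) S3_base = y0) S3 X f g"
      using that \<phi>(3) unfolding pi3_class_def by (auto elim!: homotopic_with_mono)
  qed (use \<phi> in auto)
  moreover have "f \<in> pi3_class X x0 f"
    using f by (auto simp: pi3_class_def)
  ultimately show ?thesis
    unfolding pi3_map_def by blast
qed

section \<open>Continuous matrix operations and the retraction of invertible matrices to orthogonal
  ones\<close>

lemma continuous_on_det [continuous_intros]:
  fixes f :: "'a::topological_space \<Rightarrow> ('b::{real_normed_field})^'n^'n"
  assumes "continuous_on S f"
  shows "continuous_on S (\<lambda>x. det (f x))"
  unfolding det_def by (intro continuous_intros assms)

lemma continuous_on_matrix_mult [continuous_intros]: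
  fixes f :: "'a::topological_space \<Rightarrow> ('b::{real_normed_field})^'n^'m"
  assumes "continuous_on S f" "continuous_on S g"
  shows "continuous_on S (\<lambda>x. f x ** g x)"
  unfolding matrix_matrix_mult_def by (intro continuous_intros assms)

lemma continuous_on_matrix_vector_mult' [continuous_intros]:
  fixes f :: "'a::topological_space \<Rightarrow> ('b::{real_normed_field})^'n^'m"
  assumes "continuous_on S f" "continuous_on S g"
  shows "continuous_on S (\<lambda>x. f x *v g x)"
  unfolding matrix_vector_mult_def by (intro continuous_intros assms)

lemma matrix_inv_both:
  fixes A :: "'a::field^'n^'n"
  assumes "det A \<noteq> 0"
  shows "matrix_inv A ** A = mat 1" "A ** matrix_inv A = mat 1"
proof -
  from assms have "\<exists>B. A ** B = mat 1 \<and> B ** A = mat 1"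
    unfolding invertible_det_nz[symmetric] invertible_def .
  from someI_ex[OF this] show "matrix_inv A ** A = mat 1" "A ** matrix_inv A = mat 1"
    by (auto simp: matrix_inv_def)
qed

text \<open>By Cramer's rule the entries of the inverse are quotients of determinants.\<close>

lemma continuous_on_matrix_inv [continuous_intros]:
  fixes f :: "'a::topological_space \<Rightarrow> ('b::{real_normed_field})^'n^'n"
  assumes f: "continuous_on S f" and nz: "\<And>x. x \<in> S \<Longrightarrow> det (f x) \<noteq> 0"
  shows "continuous_on S (\<lambda>x. matrix_inv (f x))"
proof -
  have *: "matrix_inv A = (\<chi> k j. det (\<chi> i l. if l = k then axis j 1 $ i else A $ i $ l) / det A)"
    if "det A \<noteq> 0" for A :: "'b^'n^'n"
  proof -
    have "A ** matrix_inv A = mat 1"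
      using that by (rule matrix_inv_both)
    then have "A *v (matrix_inv A *v axis j 1) = axis j 1" for j
      by (simp add: matrix_vector_mul_assoc)
    then have "matrix_inv A *v axis j 1 = (\<chi> k. det (\<chi> i l. if l = k then axis j 1 $ i else A $ i $ l) / det A)" for j
      by (simp only: cramer[OF that])
    then have "column j (matrix_inv A) = (\<chi> k. det (\<chi> i l. if l = k then axis j 1 $ i else A $ i $ l) / det A)" for j
      by (simp add: matrix_vector_mult_def column_def axis_def if_distrib cong: if_cong)
    then show ?thesis
      by (simp add: vec_eq_iff column_def)
  qed
  have "continuous_on S (\<lambda>x. \<chi> k j. det (\<chi> i l. if l = k then axis j 1 $ i else f x $ i $ l) / det (f x))"
  proof (intro continuous_on_vec_lambda continuous_on_divide continuous_on_det f nz)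
    show "continuous_on S (\<lambda>x. if l = k then axis j 1 $ i else f x $ i $ l)" for l k j i
      by (cases "l = k") (auto intro!: continuous_intros f)
  qed (simp add: nz)
  then show ?thesis
    by (rule continuous_on_eq) (use * nz in auto)
qed

text \<open>Subtracting from row \<open>i\<close> its projections to the rows in \<open>S\<close>
  keeps the determinant, and normalising the result scales it by a positive factor; so the sign of
  the determinant survives. For an orthogonal matrix there is nothing to subtract and nothing to
  scale.\<close>

lemma gram_schmidt_step:
  fixes R :: "real^'n^'n \<Rightarrow> real^'n^'n" and S :: "'n set"
  assumes i: "i \<notin> S"
    and R: "continuous_on {A. det A \<noteq> 0} R" "\<And>A. det A \<noteq> 0 \<Longrightarrow> det (R A) * det A > 0"
      "\<And>A j. det A \<noteq> 0 \<Longrightarrow> j \<in> S \<Longrightarrow> norm (R A $ j) = 1"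
      "\<And>A j k. det A \<noteq> 0 \<Longrightarrow> j \<in> S \<Longrightarrow> k \<in> S \<Longrightarrow> j \<noteq> k \<Longrightarrow> R A $ j \<bullet> R A $ k = 0"
      "\<And>A. orthogonal_matrix A \<Longrightarrow> R A = A"
  shows "\<exists>R' :: real^'n^'n \<Rightarrow> real^'n^'n. continuous_on {A. det A \<noteq> 0} R' \<and> (\<forall>A. det A \<noteq> 0 \<longrightarrow> det (R' A) * det A > 0) \<and>
      (\<forall>A. \<forall>j\<in>insert i S. det A \<noteq> 0 \<longrightarrow> norm (R' A $ j) = 1) \<and>
      (\<forall>A. \<forall>j\<in>insert i S. \<forall>k\<in>insert i S. det A \<noteq> 0 \<longrightarrow> j \<noteq> k \<longrightarrow> R' A $ j \<bullet> R' A $ k = 0) \<and>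
      (\<forall>A. orthogonal_matrix A \<longrightarrow> R' A = A)"
proof -
  define w where "w = (\<lambda>A. R A $ i - (\<Sum>j\<in>S. (R A $ i \<bullet> R A $ j) *\<^sub>R (R A $ j)))"
  define R' :: "real^'n^'n \<Rightarrow> real^'n^'n" where
    "R' = (\<lambda>A. \<chi> k. if k = i then inverse (norm (w A)) *\<^sub>R w A else R A $ k)"
  have dw: "det (\<chi> k. if k = i then w A else R A $ k) = det (R A)" for A
  proof -
    have "(\<Sum>j\<in>S. (R A $ i \<bullet> R A $ j) *\<^sub>R (R A $ j)) \<in> vec.span {row j (R A) |j. j \<noteq> i}"
    proof (rule vec.span_sum)
      fix j assume "j \<in> S"
      with i have "j \<noteq> i" by auto
      then have "R A $ j \<in> {row j (R A) |j. j \<noteq> i}"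
        by (intro CollectI exI[of _ j]) (simp add: row_def)
      then show "(R A $ i \<bullet> R A $ j) *\<^sub>R (R A $ j) \<in> vec.span {row j (R A) |j. j \<noteq> i}"
        unfolding scalar_mult_eq_scaleR[symmetric] by (rule vec.span_scale[OF vec.span_base])
    qed
    then have "- (\<Sum>j\<in>S. (R A $ i \<bullet> R A $ j) *\<^sub>R (R A $ j)) \<in> vec.span {row j (R A) |j. j \<noteq> i}"
      by (rule vec.span_neg)
    from det_row_span[OF this] show ?thesis
      by (simp add: w_def row_def cong: if_cong)
  qed
  have wnz: "w A \<noteq> 0" if "det A \<noteq> 0" for A
  proof
    assume "w A = 0"
    then have "det (\<chi> k. if k = i then w A else R A $ k) = 0"
      by (intro det_zero_row(1)[of i]) (auto simp: row_def vec_eq_iff)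
    with dw R(2)[OF that] show False by auto
  qed
  have wo: "w A \<bullet> R A $ j = 0" if "det A \<noteq> 0" "j \<in> S" for A j
  proof -
    have "(\<Sum>k\<in>S. (R A $ i \<bullet> R A $ k) * (R A $ k \<bullet> R A $ j)) = (\<Sum>k\<in>S. if k = j then R A $ i \<bullet> R A $ j else 0)"
    proof (rule sum.cong)
      fix k assume "k \<in> S"
      then show "(R A $ i \<bullet> R A $ k) * (R A $ k \<bullet> R A $ j) = (if k = j then R A $ i \<bullet> R A $ j else 0)"
        using R(3)[OF that] R(4)[OF that(1) \<open>k \<in> S\<close> that(2)] by (cases "k = j") (simp_all add: norm_eq_1)
    qed simp
    also have "\<dots> = R A $ i \<bullet> R A $ j" using that(2) by simp
    finally show ?thesis
      by (simp add: w_def inner_diff_left inner_sum_left)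
  qed
  have cw: "continuous_on {A. det A \<noteq> 0} w"
    unfolding w_def by (intro continuous_intros R(1))
  have "continuous_on {A. det A \<noteq> 0} (\<lambda>A. if k = i then inverse (norm (w A)) *\<^sub>R w A else R A $ k)" for k
    using wnz by (cases "k = i") (auto intro!: continuous_intros R(1) cw)
  then have 1: "continuous_on {A. det A \<noteq> 0} R'"
    unfolding R'_def by (intro continuous_on_vec_lambda)
  have 2: "det (R' A) * det A > 0" if "det A \<noteq> 0" for A
  proof -
    have "det (R' A) = inverse (norm (w A)) * det (R A)"
      using det_row_mul[of i "inverse (norm (w A))" "\<lambda>_. w A" "\<lambda>k. R A $ k"] dw[of A]
      by (simp add: R'_def scalar_mult_eq_scaleR cong: if_cong)
    then show ?thesis using R(2)[OF that] wnz[OF that]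
      by (simp add: mult.assoc)
  qed
  have 3: "norm (R' A $ j) = 1" if "det A \<noteq> 0" "j \<in> insert i S" for A j
    using that R(3)[OF that(1)] wnz[OF that(1)] by (auto simp: R'_def)
  have 4: "R' A $ j \<bullet> R' A $ k = 0" if "det A \<noteq> 0" "j \<in> insert i S" "k \<in> insert i S" "j \<noteq> k" for A j k
    using that R(4)[OF that(1)] wo[OF that(1)] by (auto simp: R'_def inner_commute)
  have 5: "R' A = A" if A: "orthogonal_matrix A" for A
  proof -
    have o: "norm (A $ k) = 1" "\<And>j. j \<noteq> k \<Longrightarrow> A $ k \<bullet> A $ j = 0" for k
      using A unfolding orthogonal_matrix_orthonormal_rows orthogonal_def by (auto simp: row_def)
    then have "w A = A $ i"
      using i unfolding w_def R(5)[OF A] by (simp, intro sum.neutral ballI) (metis scaleR_zero_left)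
    then have "R' A $ k = A $ k" for k
      using o by (simp add: R'_def R(5)[OF A])
    then show ?thesis
      by (simp add: vec_eq_iff)
  qed
  show ?thesis
    by (rule exI[of _ R']) (use 1 2 3 4 5 in blast)
qed

text \<open>Gram-Schmidt as a continuous map, by induction on the set of rows treated so far. The
  last property says that it is a retraction, so the ends of a homotopy in the orthogonal group are
  not moved.\<close>

lemma gram_schmidt_retraction:
  obtains R :: "real^'n^'n \<Rightarrow> real^'n^'n" where
    "continuous_on {A. det A \<noteq> 0} R" "\<And>A. det A \<noteq> 0 \<Longrightarrow> det (R A) * det A > 0"
    "\<And>A. det A \<noteq> 0 \<Longrightarrow> orthogonal_matrix (R A)" "\<And>A. orthogonal_matrix A \<Longrightarrow> R A = A"
proof -
  have "finite (UNIV :: 'n set)" by simp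
  then have "\<exists>R :: real^'n^'n \<Rightarrow> real^'n^'n. continuous_on {A. det A \<noteq> 0} R \<and>
     (\<forall>A. det A \<noteq> 0 \<longrightarrow> det (R A) * det A > 0) \<and>
     (\<forall>A. \<forall>j\<in>UNIV. det A \<noteq> 0 \<longrightarrow> norm (R A $ j) = 1) \<and>
     (\<forall>A. \<forall>j\<in>UNIV. \<forall>k\<in>UNIV. det A \<noteq> 0 \<longrightarrow> j \<noteq> k \<longrightarrow> R A $ j \<bullet> R A $ k = 0) \<and>
     (\<forall>A. orthogonal_matrix A \<longrightarrow> R A = A)"
  proof (induction rule: finite_induct)
    case empty
    show ?case by (rule exI[of _ id]) (auto simp: zero_less_mult_iff)
  next
    case (insert i S)
    from insert.IH obtain R :: "real^'n^'n \<Rightarrow> real^'n^'n" where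
      "continuous_on {A. det A \<noteq> 0} R" "\<forall>A. det A \<noteq> 0 \<longrightarrow> det (R A) * det A > 0"
      "\<forall>A. \<forall>j\<in>S. det A \<noteq> 0 \<longrightarrow> norm (R A $ j) = 1"
      "\<forall>A. \<forall>j\<in>S. \<forall>k\<in>S. det A \<noteq> 0 \<longrightarrow> j \<noteq> k \<longrightarrow> R A $ j \<bullet> R A $ k = 0"
      "\<forall>A. orthogonal_matrix A \<longrightarrow> R A = A"
      by (elim exE conjE)
    note R = this(1) this(2-)[rule_format]
    show ?case
      by (rule gram_schmidt_step[OF insert.hyps(2) R])
  qed
  then obtain R :: "real^'n^'n \<Rightarrow> real^'n^'n" where
      "continuous_on {A. det A \<noteq> 0} R" "\<forall>A. det A \<noteq> 0 \<longrightarrow> det (R A) * det A > 0"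
      "\<forall>A. \<forall>j\<in>UNIV. det A \<noteq> 0 \<longrightarrow> norm (R A $ j) = 1"
      "\<forall>A. \<forall>j\<in>UNIV. \<forall>k\<in>UNIV. det A \<noteq> 0 \<longrightarrow> j \<noteq> k \<longrightarrow> R A $ j \<bullet> R A $ k = 0"
      "\<forall>A. orthogonal_matrix A \<longrightarrow> R A = A"
      by (elim exE conjE)
  note R = this(1) this(2-)[rule_format]
  show ?thesis
    by (rule that[OF R(1,2) _ R(5)]) (use R(3,4) in \<open>auto simp: orthogonal_matrix_orthonormal_rows row_def orthogonal_def\<close>)
qed

abbreviation GL6 :: "(real^6^6) set" where
  "GL6 \<equiv> {A. det A \<noteq> 0}"

text \<open>Multiplying a homotopy from the left by the inverse of its value at the base point makes
  it pointed and cancels \<open>C\<close> and \<open>C'\<close>. Its determinant is then 1 at the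
  base point, hence positive throughout by connectedness, and Gram-Schmidt brings it into
  \<open>SO6\<close>.\<close>

lemma rotation_group_pointed_homotopy:
  assumes fg: "f S3_base = mat 1" "g S3_base = mat 1" "f ` S3 \<subseteq> SO6" "g ` S3 \<subseteq> SO6"
    and C: "det C \<noteq> 0" "det C' \<noteq> 0"
    and hom: "freely_homotopic S3 GL6 (\<lambda>x. C ** f x) (\<lambda>x. C' ** g x)"
  shows "pi3_class SO6 (mat 1) f = pi3_class SO6 (mat 1) g"
proof (rule pi3_class_eqI)
  obtain R :: "real^6^6 \<Rightarrow> real^6^6" where R: "continuous_on {A. det A \<noteq> 0} R" "\<And>A. det A \<noteq> 0 \<Longrightarrow> det (R A) * det A > 0"
    "\<And>A. det A \<noteq> 0 \<Longrightarrow> orthogonal_matrix (R A)" "\<And>A. orthogonal_matrix A \<Longrightarrow> R A = A"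
    by (rule gram_schmidt_retraction) blast
  obtain h where h: "continuous_on ({0..1::real} \<times> S3) (\<lambda>z. h (fst z) (snd z))"
    "\<And>t x. t \<in> {0..1} \<Longrightarrow> x \<in> S3 \<Longrightarrow> h t x \<in> GL6"
    "\<And>x. h 0 x = C ** f x" "\<And>x. h 1 x = C' ** g x"
    by (rule homotopic_canonE[OF hom], rule that, assumption+)
  define k where "k = (\<lambda>t x. matrix_inv (h t S3_base) ** h t x)"
  have cb: "continuous_on ({0..1} \<times> S3) (\<lambda>z. h (fst z) S3_base)"
    by (rule continuous_on_compose2[OF h(1), of _ "\<lambda>z. (fst z, S3_base)", simplified])
       (use S3_base_in in \<open>auto intro!: continuous_intros\<close>)
  have ck: "continuous_on ({0..1} \<times> S3) (\<lambda>z. k (fst z) (snd z))"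
    unfolding k_def by (intro continuous_intros h(1) cb) (use h(2) S3_base_in in force)
  have hb: "matrix_inv (h t S3_base) ** h t S3_base = mat 1" if "t \<in> {0..1}" for t
    using h(2)[OF that S3_base_in] by (simp add: matrix_inv_both)
  have kb: "k t S3_base = mat 1" if "t \<in> {0..1}" for t
    using hb[OF that] by (simp add: k_def)
  have knz: "det (k t x) \<noteq> 0" if "t \<in> {0..1}" "x \<in> S3" for t x
  proof -
    have "det (matrix_inv (h t S3_base)) \<noteq> 0"
      using arg_cong[OF hb[OF that(1)], of det] by (auto simp: det_mul)
    then show ?thesis using h(2)[OF that] by (simp add: k_def det_mul)
  qed
  have kpos: "det (k t x) > 0" if "t \<in> {0..1}" "x \<in> S3" for t x
  proof -
    have "det (k (fst (t,x)) (snd (t,x))) > 0"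
    proof (rule pos_on_connected[OF connected_01_S3])
      show "continuous_on ({0..1} \<times> S3) (\<lambda>z. det (k (fst z) (snd z)))"
        by (intro continuous_intros ck)
      show "det (k (fst (0, S3_base)) (snd (0, S3_base))) > 0"
        by (simp add: kb)
    qed (use that knz S3_base_in in auto)
    then show ?thesis by simp
  qed
  have end0: "k 0 x = f x" for x
  proof -
    have "matrix_inv C ** C = mat 1"
      using C by (simp add: matrix_inv_both)
    then show ?thesis using fg by (simp add: k_def h matrix_mul_assoc)
  qed
  have end1: "k 1 x = g x" for x
  proof -
    have "matrix_inv C' ** C' = mat 1"
      using C by (simp add: matrix_inv_both)
    then show ?thesis using fg by (simp add: k_def h matrix_mul_assoc)
  qed
  show "homotopic_with_canon (\<lambda>h. h S3_base = mat 1) S3 SO6 f g"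
  proof (rule homotopic_pointedI[where h = "\<lambda>t x. R (k t x)"])
    show "continuous_on ({0..1} \<times> S3) (\<lambda>z. R (k (fst z) (snd z)))"
      by (rule continuous_on_compose2[OF R(1) ck]) (use knz in auto)
    show "R (k t x) \<in> SO6" if "t \<in> {0..1}" "x \<in> S3" for t x
    proof -
      have "orthogonal_matrix (R (k t x))" "det (R (k t x)) > 0"
        using R(2,3)[OF knz[OF that]] kpos[OF that] by (auto simp: zero_less_mult_iff)
      then show ?thesis
        using det_orthogonal_matrix[of "R (k t x)"] by (auto simp: SO6_def rotation_matrix_def)
    qed
    show "R (k 0 x) = f x" if "x \<in> S3" for x
      using that fg R(4)[of "f x"] by (auto simp: end0 SO6_def rotation_matrix_def image_subset_iff)
    show "R (k 1 x) = g x" if "x \<in> S3" for x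
      using that fg R(4)[of "g x"] by (auto simp: end1 SO6_def rotation_matrix_def image_subset_iff)
    show "R (k t S3_base) = mat 1" if "t \<in> {0..1}" for t
      using that by (simp add: kb R(4) orthogonal_matrix_id)
  qed
qed

section \<open>Complex two-frames and the unitary group\<close>

definition herm :: "complex^'n \<Rightarrow> complex^'n \<Rightarrow> complex" where
  "herm x y = (\<Sum>i\<in>UNIV. x $ i * cnj (y $ i))"

lemma herm_add_left: "herm (x + y) z = herm x z + herm y z"
  and herm_diff_left: "herm (x - y) z = herm x z - herm y z"
  and herm_scale_left: "herm (c *s x) z = c * herm x z"
  and herm_scale_right: "herm x (c *s z) = cnj c * herm x z"
  and herm_zero [simp]: "herm 0 z = 0" "herm z 0 = 0"
  and herm_cnj: "cnj (herm x z) = herm z x"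
  unfolding herm_def
  by (simp_all add: algebra_simps sum.distrib sum_subtractf sum_distrib_left)

lemma herm_scaleR_left: "herm (r *\<^sub>R x) z = of_real r * herm x z"
  and herm_scaleR_right: "herm x (r *\<^sub>R z) = of_real r * herm x z"
  by (simp_all add: herm_def scaleR_sum_right flip: scaleR_conv_of_real)

lemma scaleR_cvec: "r *\<^sub>R x = complex_of_real r *s x" for x :: "complex^'n"
  by (simp add: vec_eq_iff scaleR_conv_of_real[of r "_ :: complex"])

lemma inner_eq_Re_herm: "x \<bullet> y = Re (herm x y)"
  by (simp add: herm_def inner_vec_def inner_complex_def)

lemma herm_self: "herm x x = of_real ((norm x)\<^sup>2)"
proof -
  have "herm x x = (\<Sum>i\<in>UNIV. of_real ((cmod (x $ i))\<^sup>2))"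
    unfolding herm_def by (simp only: complex_norm_square)
  also have "\<dots> = of_real ((norm x)\<^sup>2)"
    by (simp add: norm_vec_def L2_set_def sum_nonneg)
  finally show ?thesis .
qed

lemma norm_cscale: "norm (c *s x) = cmod c * norm x" for x :: "complex^'n"
  by (simp add: norm_vec_def norm_mult L2_set_right_distrib)

lemma continuous_on_herm [continuous_intros]:
  "continuous_on S f \<Longrightarrow> continuous_on S g \<Longrightarrow> continuous_on S (\<lambda>x. herm (f x) (g x))"
  unfolding herm_def by (intro continuous_intros)

lemma continuous_on_vec_scale [continuous_intros]:
  fixes f :: "'a::topological_space \<Rightarrow> complex" and g :: "'a \<Rightarrow> complex^'n"
  shows "continuous_on S f \<Longrightarrow> continuous_on S g \<Longrightarrow> continuous_on S (\<lambda>x. f x *s g x)"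
  unfolding vector_scalar_mult_def by (intro continuous_intros)

lemma continuous_on_column [continuous_intros]:
  fixes f :: "'a::topological_space \<Rightarrow> ('b::topological_space)^'n^'m"
  shows "continuous_on S f \<Longrightarrow> continuous_on S (\<lambda>x. column k (f x))"
  unfolding column_def by (intro continuous_intros)

lemma mult_vec_2: "A *v c = c $ 1 *s column 1 A + c $ 2 *s column 2 A" for A :: "complex^2^'m"
  by (simp add: vec_eq_iff matrix_vector_mult_def column_def sum_2 mult.commute)

lemma V2C3_iff: "A \<in> V2C3 \<longleftrightarrow> (\<forall>c. A *v c = 0 \<longrightarrow> c = 0)"
  by (simp add: V2C3_def mult_vec_2)

text \<open>The conjugate of the cross product of the two columns spans their Hermitian complement.\<close>

definition row_minor :: "complex^2^3 \<Rightarrow> 3 \<Rightarrow> 3 \<Rightarrow> complex" where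
  "row_minor A i j = A $ i $ 1 * A $ j $ 2 - A $ j $ 1 * A $ i $ 2"

definition conormal :: "complex^2^3 \<Rightarrow> complex^3" where
  "conormal A = vector [cnj (row_minor A 2 3), cnj (row_minor A 3 1), cnj (row_minor A 1 2)]"

lemma conormal_nth:
  "conormal A $ 1 = cnj (row_minor A 2 3)"
  "conormal A $ 2 = cnj (row_minor A 3 1)"
  "conormal A $ 3 = cnj (row_minor A 1 2)"
  by (simp_all add: conormal_def)

lemma continuous_on_conormal [continuous_intros]:
  assumes "continuous_on S f"
  shows "continuous_on S (\<lambda>x. conormal (f x))"
proof -
  have "continuous_on S (\<lambda>x. conormal (f x) $ 1)" "continuous_on S (\<lambda>x. conormal (f x) $ 2)"
    "continuous_on S (\<lambda>x. conormal (f x) $ 3)"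
    unfolding conormal_nth row_minor_def by (intro continuous_intros assms)+
  then have "continuous_on S (\<lambda>x. conormal (f x) $ i)" for i
    using exhaust_3[of i] by (elim disjE) simp_all
  from continuous_on_vec_lambda[of S "\<lambda>i x. conormal (f x) $ i", OF this] show ?thesis by simp
qed

lemma herm_conormal: "herm (A *v c) (conormal A) = 0"
  by (simp add: herm_def sum_3 conormal_nth row_minor_def matrix_vector_mult_def sum_2 algebra_simps)

lemma herm_conormal_column: "herm (column j A) (conormal A) = 0"
  using herm_conormal[of A "axis j 1"] by (simp add: matrix_vector_mult_def column_def axis_def if_distrib cong: if_cong)

text \<open>If all minors vanish, then every row (a, b) of \<open>A\<close> gives a kernel vector
  (b, -a). Injectivity makes all entries zero, which contradicts injectivity.\<close>

lemma conormal_nonzero: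
  assumes "A \<in> V2C3"
  shows "conormal A \<noteq> 0"
proof
  assume "conormal A = 0"
  then have m: "row_minor A 2 3 = 0" "row_minor A 3 1 = 0" "row_minor A 1 2 = 0"
    unfolding vec_eq_iff forall_3 conormal_nth by simp_all
  have "row_minor A i j = 0" for i j
    using exhaust_3[of i] exhaust_3[of j] m by (auto simp: row_minor_def algebra_simps)
  then have "A *v vector [A $ i $ 2, - A $ i $ 1] = 0" for i
    by (simp add: vec_eq_iff matrix_vector_mult_def sum_2 row_minor_def algebra_simps)
  with assms have "vector [A $ i $ 2, - A $ i $ 1] = (0::complex^2)" for i
    unfolding V2C3_iff by blast
  then have "A $ i $ 1 = 0" "A $ i $ 2 = 0" for i
    by (auto simp: vec_eq_iff forall_2)
  then have "A *v vector [1, 0] = 0"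
    by (simp add: vec_eq_iff matrix_vector_mult_def sum_2)
  with assms have "vector [1, 0] = (0::complex^2)"
    unfolding V2C3_iff by blast
  then show False
    by (simp add: vec_eq_iff forall_2)
qed

text \<open>Pairing a vector with a conormal is the determinant of the two columns and that vector.
  The numerator is thus the determinant of the columns and the conormal of \<open>A\<close> with
  column \<open>j\<close> replaced by \<open>w\<close>, the denominator the one without
  replacement.\<close>

definition frame_coord :: "complex^2^3 \<Rightarrow> complex^3 \<Rightarrow> complex^2" where
  "frame_coord A w = (\<chi> j. herm (conormal A) (conormal (\<chi> i k. if k = j then w $ i else A $ i $ k))
     / herm (conormal A) (conormal A))"

text \<open>Cramer's rule for the basis consisting of the two columns and the conormal.\<close>

lemma frame_decomposition:
  assumes "A \<in> V2C3"
  shows "w = A *v frame_coord A w + (herm w (conormal A) / herm (conormal A) (conormal A)) *s conormal A"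
proof -
  define n where "n = conormal A"
  define B where "B j = (\<chi> i k. if k = j then w $ i else A $ i $ k)" for j
  define d where "d = herm n n"
  define c1 c2 l where "c1 = herm n (conormal (B 1))" and "c2 = herm n (conormal (B 2))" and "l = herm w n"
  have d: "d \<noteq> 0"
    using conormal_nonzero[OF assms] by (simp add: herm_self n_def d_def)
  have dd: "d = n $ 1 * row_minor A 2 3 + n $ 2 * row_minor A 3 1 + n $ 3 * row_minor A 1 2"
    by (simp add: d_def herm_def sum_3 n_def conormal_nth)
  have ll: "l = w $ 1 * row_minor A 2 3 + w $ 2 * row_minor A 3 1 + w $ 3 * row_minor A 1 2"
    by (simp add: l_def herm_def sum_3 n_def conormal_nth)
  have cc: "c1 = n $ 1 * row_minor (B 1) 2 3 + n $ 2 * row_minor (B 1) 3 1 + n $ 3 * row_minor (B 1) 1 2"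
     "c2 = n $ 1 * row_minor (B 2) 2 3 + n $ 2 * row_minor (B 2) 3 1 + n $ 3 * row_minor (B 2) 1 2"
    by (simp_all add: c1_def c2_def herm_def sum_3 conormal_nth)
  have "d * w $ i = c1 * A $ i $ 1 + c2 * A $ i $ 2 + l * n $ i" for i
    using exhaust_3[of i] unfolding cc dd ll row_minor_def B_def
    by (elim disjE) (simp_all add: algebra_simps)
  then have "w $ i = c1 / d * A $ i $ 1 + c2 / d * A $ i $ 2 + l / d * n $ i" for i
    using d by (simp add: field_simps)
  moreover have "frame_coord A w $ 1 = c1 / d" "frame_coord A w $ 2 = c2 / d"
    by (simp_all add: frame_coord_def c1_def c2_def d_def n_def B_def)
  ultimately show ?thesis
    by (simp add: vec_eq_iff mult_vec_2 column_def n_def l_def d_def)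
qed

section \<open>Unitary matrices in terms of their columns\<close>

lemma U3_iff: "A \<in> U3 \<longleftrightarrow> (\<forall>i j. herm (column i A) (column j A) = (if i = j then 1 else 0))"
proof -
  have "A \<in> U3 \<longleftrightarrow> (\<chi> i j. cnj (A $ j $ i)) ** A = mat 1"
    unfolding U3_def mem_Collect_eq by (rule matrix_left_right_inverse)
  also have "\<dots> \<longleftrightarrow> (\<forall>i j. herm (column j A) (column i A) = (if i = j then 1 else 0))"
    by (simp add: vec_eq_iff matrix_matrix_mult_def herm_def column_def mat_def mult.commute)
  finally show ?thesis by (metis (full_types))
qed

definition adj :: "complex^3^3 \<Rightarrow> complex^3^3" where
  "adj A = (\<chi> i j. cnj (A $ j $ i))"

lemma adj_mult: "A \<in> U3 \<Longrightarrow> A ** adj A = mat 1" "A \<in> U3 \<Longrightarrow> adj A ** A = mat 1"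
  using matrix_left_right_inverse[of A "adj A"] by (simp_all add: U3_def adj_def)

lemma adj_adj [simp]: "adj (adj A) = A"
  by (simp add: adj_def vec_eq_iff)

lemma adj_U3: "A \<in> U3 \<Longrightarrow> adj A \<in> U3"
  using adj_mult(2)[of A] adj_adj[of A] by (simp add: U3_def adj_def)

lemma adj_times: "adj (A ** B) = adj B ** adj A"
  by (simp add: adj_def vec_eq_iff matrix_matrix_mult_def mult.commute)

lemma U3_mult: "A \<in> U3 \<Longrightarrow> B \<in> U3 \<Longrightarrow> A ** B \<in> U3"
proof -
  assume AB: "A \<in> U3" "B \<in> U3"
  have "A ** B ** (adj B ** adj A) = A ** (B ** adj B) ** adj A"
    by (simp only: matrix_mul_assoc)
  then have "A ** B ** adj (A ** B) = mat 1"
    using AB by (simp add: adj_mult adj_times)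
  then show ?thesis by (simp add: U3_def adj_def)
qed

lemma continuous_on_adj [continuous_intros]:
  "continuous_on S f \<Longrightarrow> continuous_on S (\<lambda>x. adj (f x))"
  unfolding adj_def by (intro continuous_intros)

text \<open>Translation by the inverse of the base point value, which for a unitary matrix is its
  adjoint.\<close>

lemma U3_pointed_homotopy:
  assumes fg: "f S3_base = mat 1" "g S3_base = mat 1"
    and hom: "freely_homotopic S3 U3 f g"
  shows "homotopic_with_canon (\<lambda>h. h S3_base = mat 1) S3 U3 f g"
proof -
  obtain h where h: "continuous_on ({0..1::real} \<times> S3) (\<lambda>z. h (fst z) (snd z))"
    "\<And>t x. t \<in> {0..1} \<Longrightarrow> x \<in> S3 \<Longrightarrow> h t x \<in> U3"
    "\<And>x. h 0 x = f x" "\<And>x. h 1 x = g x"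
    by (rule homotopic_canonE[OF hom], rule that, assumption+)
  have cb: "continuous_on ({0..1} \<times> S3) (\<lambda>z. h (fst z) S3_base)"
    by (rule continuous_on_compose2[OF h(1), of _ "\<lambda>z. (fst z, S3_base)", simplified])
       (use S3_base_in in \<open>auto intro!: continuous_intros\<close>)
  have one: "adj (mat 1) = mat 1"
    by (simp add: adj_def vec_eq_iff mat_def)
  show ?thesis
  proof (rule homotopic_pointedI[where h = "\<lambda>t x. adj (h t S3_base) ** h t x"])
    show "continuous_on ({0..1} \<times> S3) (\<lambda>z. adj (h (fst z) S3_base) ** h (fst z) (snd z))"
      by (intro continuous_intros h(1) cb)
  qed (use h S3_base_in fg in \<open>auto intro!: U3_mult adj_U3 simp: adj_mult one\<close>)
qed

definition from_columns :: "complex^3 \<Rightarrow> complex^3 \<Rightarrow> complex^3 \<Rightarrow> complex^3^3" where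
  "from_columns u v w = (\<chi> i j. if j = 1 then u $ i else if j = 2 then v $ i else w $ i)"

lemma column_from_columns [simp]:
  "column 1 (from_columns u v w) = u" "column 2 (from_columns u v w) = v" "column 3 (from_columns u v w) = w"
  by (simp_all add: from_columns_def column_def vec_eq_iff)

lemma continuous_on_from_columns [continuous_intros]:
  assumes "continuous_on S u" "continuous_on S v" "continuous_on S w"
  shows "continuous_on S (\<lambda>x. from_columns (u x) (v x) (w x))"
proof -
  have "continuous_on S (\<lambda>x. if j = 1 then u x $ i else if j = 2 then v x $ i else w x $ i)" for i and j :: 3
    using exhaust_3[of j] by (elim disjE) (auto intro!: continuous_intros assms)
  then show ?thesis
    unfolding from_columns_def by (intro continuous_on_vec_lambda)
qed

lemma from_columns_columns: "from_columns (column 1 A) (column 2 A) (column 3 A) = A"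
  by (auto simp: from_columns_def column_def vec_eq_iff forall_3)

lemma from_columns_U3:
  assumes "norm u = 1" "norm v = 1" "norm w = 1" "herm u v = 0" "herm u w = 0" "herm v w = 0"
  shows "from_columns u v w \<in> U3"
proof -
  have "herm v u = 0" "herm w u = 0" "herm w v = 0"
    using assms(4-6) herm_cnj by (metis complex_cnj_zero)+
  then show ?thesis
    using assms by (simp add: U3_iff forall_3 herm_self)
qed

lemma U3_columns:
  assumes "A \<in> U3"
  shows "norm (column i A) = 1" "i \<noteq> j \<Longrightarrow> herm (column i A) (column j A) = 0"
proof -
  have "herm (column i A) (column i A) = 1"
    using assms U3_iff by metis
  then have "complex_of_real ((norm (column i A))\<^sup>2) = of_real 1"
    by (simp add: herm_self)
  then have "(norm (column i A))\<^sup>2 = 1"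
    by (simp only: of_real_eq_iff)
  then show "norm (column i A) = 1"
    by (simp add: power2_eq_1_iff) (smt (verit) norm_ge_zero)
  show "i \<noteq> j \<Longrightarrow> herm (column i A) (column j A) = 0"
    using assms U3_iff by metis
qed

lemma column_frame_of [simp]: "column 1 (frame_of A) = column 1 A" "column 2 (frame_of A) = column 2 A"
  by (simp_all add: frame_of_def column_def)

lemma continuous_on_frame_of [continuous_intros]:
  "continuous_on S f \<Longrightarrow> continuous_on S (\<lambda>x. frame_of (f x))"
proof -
  assume f: "continuous_on S f"
  have "continuous_on S (\<lambda>x. if j = 1 then f x $ i $ 1 else f x $ i $ 2)" for i and j :: 2
    by (cases "j = 1") (auto intro!: continuous_intros f)
  then show ?thesis
    unfolding frame_of_def by (intro continuous_on_vec_lambda)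
qed

lemma frame_of_mult_vec: "frame_of A *v c = A *v vector [c $ 1, c $ 2, 0]"
  by (simp add: vec_eq_iff frame_of_def matrix_vector_mult_def sum_2 sum_3)

section \<open>Passing between two-frames and unitary matrices\<close>

lemma frame_of_V2C3:
  assumes "det A \<noteq> 0"
  shows "frame_of A \<in> V2C3"
  unfolding V2C3_iff
proof (intro allI impI)
  fix c assume "frame_of A *v c = 0"
  then have "A *v vector [c $ 1, c $ 2, 0] = 0"
    by (simp add: frame_of_mult_vec)
  moreover have "\<exists>B. B ** A = mat 1"
    using matrix_inv_both[OF assms] by blast
  ultimately have "vector [c $ 1, c $ 2, 0] = (0 :: complex^3)"
    unfolding matrix_left_invertible_ker by blast
  then show "c = 0"
    by (simp add: vec_eq_iff forall_2 forall_3)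
qed

lemma U3_det: "A \<in> U3 \<Longrightarrow> det A \<noteq> 0"
  using adj_mult(1)[of A] det_mul[of A "adj A"] by auto

text \<open>An inverse of \<open>frame_of\<close> up to homotopy, as far as maps on
  \<open>S3\<close> are concerned. The fibre of \<open>frame_of\<close> over an orthonormal frame is
  a circle of possible third columns, and the unit conormal singles out one of them
  continuously.\<close>

definition orthonormal_frame :: "complex^2^3 \<Rightarrow> complex^3^3" where
  "orthonormal_frame A = (let a = column 1 A; b = column 2 A;
      b' = b - (herm b a / herm a a) *s a
    in from_columns (inverse (norm a) *\<^sub>R a) (inverse (norm b') *\<^sub>R b') (inverse (norm (conormal A)) *\<^sub>R conormal A))"

lemma V2C3_columns:
  assumes "A \<in> V2C3"
  shows "column 1 A \<noteq> 0" "column 2 A - c *s column 1 A \<noteq> 0"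
proof -
  have *: "x = 0 \<and> y = 0" if "x *s column 1 A + y *s column 2 A = 0" for x y
  proof -
    have "vector [x, y] = (0::complex^2)"
      using assms that by (simp add: V2C3_def)
    then show ?thesis by (simp add: vec_eq_iff forall_2)
  qed
  show "column 1 A \<noteq> 0" using *[of 1 0] by auto
  show "column 2 A - c *s column 1 A \<noteq> 0"
    using *[of "- c" 1] by (auto simp: algebra_simps)
qed

lemma orthonormal_frame_U3:
  assumes "A \<in> V2C3"
  shows "orthonormal_frame A \<in> U3"
proof -
  define a b n where "a = column 1 A" and "b = column 2 A" and "n = conormal A"
  define b' where "b' = b - (herm b a / herm a a) *s a"
  have nz: "a \<noteq> 0" "b' \<noteq> 0" "n \<noteq> 0"
    using V2C3_columns[OF assms] conormal_nonzero[OF assms] by (auto simp: a_def b_def b'_def n_def)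
  have "herm b' a = 0"
    using nz by (simp add: b'_def herm_diff_left herm_scale_left herm_self)
  then have ab: "herm a b' = 0"
    using herm_cnj by (metis complex_cnj_zero)
  have "herm a n = 0" "herm b' n = 0"
    by (simp_all add: b'_def herm_diff_left herm_scale_left a_def b_def n_def herm_conormal_column)
  with nz ab show ?thesis
    unfolding orthonormal_frame_def Let_def
    by (fold a_def b_def n_def, fold b'_def, intro from_columns_U3) (simp_all add: herm_scaleR_left herm_scaleR_right)
qed

lemma continuous_on_orthonormal_frame [continuous_intros]:
  assumes f: "continuous_on S f" and V: "\<And>x. x \<in> S \<Longrightarrow> f x \<in> V2C3"
  shows "continuous_on S (\<lambda>x. orthonormal_frame (f x))"
  unfolding orthonormal_frame_def Let_def
proof (intro continuous_intros f ballI)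
  fix x assume "x \<in> S"
  note V = V[OF this]
  show "norm (column 1 (f x)) \<noteq> 0" "herm (column 1 (f x)) (column 1 (f x)) \<noteq> 0"
    "norm (column 2 (f x) - (herm (column 2 (f x)) (column 1 (f x)) / herm (column 1 (f x)) (column 1 (f x))) *s column 1 (f x)) \<noteq> 0"
    "norm (conormal (f x)) \<noteq> 0"
    using V2C3_columns[OF V] conormal_nonzero[OF V] by (auto simp: herm_self)
qed (use V2C3_columns[OF V] in \<open>simp add: herm_self\<close>)

text \<open>Gram-Schmidt multiplies the frame by an upper triangular matrix with positive diagonal.
  These matrices form a convex set containing the identity, so the straight segment consists of
  frames.\<close>

lemma frame_orthonormal_homotopic:
  assumes f: "continuous_on S f" and V: "f ` S \<subseteq> V2C3"
  shows "freely_homotopic S V2C3 f (frame_of \<circ> (orthonormal_frame \<circ> f))"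
proof (rule homotopic_freeI[where h = "\<lambda>t x. (1 - t) *\<^sub>R f x + t *\<^sub>R frame_of (orthonormal_frame (f x))"])
  have V: "f x \<in> V2C3" if "x \<in> S" for x using that V by auto
  have "continuous_on S (\<lambda>x. frame_of (orthonormal_frame (f x)))"
    by (intro continuous_intros f V)
  then show "continuous_on ({0..1} \<times> S) (\<lambda>z. (1 - fst z) *\<^sub>R f (snd z) + fst z *\<^sub>R frame_of (orthonormal_frame (f (snd z))))"
    by (intro continuous_intros continuous_on_compose2[OF f continuous_on_snd]
      continuous_on_compose2[where f = snd and g = "\<lambda>x. frame_of (orthonormal_frame (f x))"]) (use V in auto)
  fix t :: real and x assume t: "0 \<le> t \<and> t \<le> 1" and "x \<in> S"
  then have A: "f x \<in> V2C3" using V by auto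
  define a b where "a = column 1 (f x)" and "b = column 2 (f x)"
  define k where "k = herm b a / herm a a"
  define s1 s2 where "s1 = inverse (norm a)" and "s2 = inverse (norm (b - k *s a))"
  have nz: "a \<noteq> 0" "b - k *s a \<noteq> 0" using V2C3_columns[OF A] by (auto simp: a_def b_def)
  then have s: "s1 > 0" "s2 > 0" by (auto simp: s1_def s2_def)
  have c1: "column 1 ((1 - t) *\<^sub>R f x + t *\<^sub>R frame_of (orthonormal_frame (f x))) = (1 - t) *\<^sub>R a + t *\<^sub>R (s1 *\<^sub>R a)"
  proof -
    have "column 1 (frame_of (orthonormal_frame (f x))) = s1 *\<^sub>R a"
      unfolding column_frame_of by (simp add: orthonormal_frame_def Let_def a_def s1_def)
    then show ?thesis by (simp add: vec_eq_iff column_def a_def)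
  qed
  have c2: "column 2 ((1 - t) *\<^sub>R f x + t *\<^sub>R frame_of (orthonormal_frame (f x))) = (1 - t) *\<^sub>R b + t *\<^sub>R (s2 *\<^sub>R (b - k *s a))"
  proof -
    have "column 2 (frame_of (orthonormal_frame (f x))) = s2 *\<^sub>R (b - k *s a)"
      unfolding column_frame_of by (simp add: orthonormal_frame_def Let_def a_def b_def k_def s2_def)
    then show ?thesis by (simp add: vec_eq_iff column_def b_def)
  qed
  have pos: "1 - t + t * s1 > 0" "1 - t + t * s2 > 0"
    using t s by (cases "t = 0"; simp add: add_nonneg_pos)+
  show "(1 - t) *\<^sub>R f x + t *\<^sub>R frame_of (orthonormal_frame (f x)) \<in> V2C3"
    unfolding V2C3_def mem_Collect_eq c1 c2
  proof (intro allI impI)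
    fix c :: "complex^2"
    assume "c $ 1 *s ((1 - t) *\<^sub>R a + t *\<^sub>R s1 *\<^sub>R a) + c $ 2 *s ((1 - t) *\<^sub>R b + t *\<^sub>R s2 *\<^sub>R (b - k *s a)) = 0"
    then have "(c $ 1 * of_real (1 - t + t * s1) - c $ 2 * of_real (t * s2) * k) *s a + (c $ 2 * of_real (1 - t + t * s2)) *s b = 0"
      unfolding scaleR_cvec by (simp add: vec_eq_iff algebra_simps)
    moreover have "x = 0 \<and> y = 0" if "x *s a + y *s b = 0" for x y
    proof -
      have "vector [x, y] = (0::complex^2)"
        using A that by (simp add: V2C3_def a_def b_def)
      then show ?thesis by (simp add: vec_eq_iff forall_2)
    qed
    ultimately have "c $ 1 * of_real (1 - t + t * s1) - c $ 2 * of_real (t * s2) * k = 0" "c $ 2 * of_real (1 - t + t * s2) = 0"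
      by blast+
    moreover have "complex_of_real (1 - t + t * s1) \<noteq> 0" "complex_of_real (1 - t + t * s2) \<noteq> 0"
      using pos by (simp_all only: of_real_eq_0_iff)
    ultimately show "c = 0"
      by (auto simp: vec_eq_iff forall_2)
  qed
qed (use V in auto)

text \<open>Nonvanishing functions on a simply connected space have continuous logarithms. In this
  form the vanishing of pi_3 of the circle is used, for the fibre of \<open>frame_of\<close> and for
  completions of six-frames.\<close>

lemma continuous_log_S3:
  fixes f :: "complex^2 \<Rightarrow> complex"
  assumes "continuous_on S3 f" "\<And>x. x \<in> S3 \<Longrightarrow> f x \<noteq> 0"
  obtains g where "continuous_on S3 g" "\<And>x. x \<in> S3 \<Longrightarrow> f x = exp (g x)"
proof (rule continuous_logarithm_on_simply_connected[OF assms(1)])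
  show "simply_connected S3"
    by (rule simply_connected_sphere) simp
  show "locally path_connected S3"
    by (rule locally_path_connected_sphere)
qed (use assms in auto)

text \<open>The third column of a unitary matrix is the unit conormal \<open>e\<close> times a
  circle valued function \<open>l\<close>. Its logarithm is imaginary, so contracting the logarithm
  to 0 deforms \<open>l\<close> to 1 inside the circle.\<close>

lemma U3_homotopic_orthonormal_frame:
  assumes f: "continuous_on S3 f" and U: "f ` S3 \<subseteq> U3"
  shows "freely_homotopic S3 U3 f (orthonormal_frame \<circ> (frame_of \<circ> f))"
proof -
  have U: "f x \<in> U3" if "x \<in> S3" for x using that U by auto
  have V: "frame_of (f x) \<in> V2C3" if "x \<in> S3" for x
    by (intro frame_of_V2C3 U3_det U that)
  define e where "e = (\<lambda>x. inverse (norm (conormal (frame_of (f x)))) *\<^sub>R conormal (frame_of (f x)))"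
  have ce: "continuous_on S3 e"
    unfolding e_def by (intro continuous_intros f) (use conormal_nonzero V in auto)
  have e: "norm (e x) = 1" "herm (column 1 (f x)) (e x) = 0" "herm (column 2 (f x)) (e x) = 0" if "x \<in> S3" for x
    using conormal_nonzero[OF V[OF that]] herm_conormal_column[of 1 "frame_of (f x)"] herm_conormal_column[of 2 "frame_of (f x)"]
    by (simp_all add: e_def herm_scaleR_right)
  define l where "l = (\<lambda>x. herm (column 3 (f x)) (e x))"
  have le: "column 3 (f x) = l x *s e x" if x: "x \<in> S3" for x
  proof -
    let ?n = "conormal (frame_of (f x))" and ?u = "column 3 (f x)"
    define c where "c = frame_coord (frame_of (f x)) ?u"
    define m where "m = herm ?u ?n / herm ?n ?n"
    have u: "?u = c $ 1 *s column 1 (f x) + c $ 2 *s column 2 (f x) + m *s ?n"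
      using frame_decomposition[OF V[OF x], of ?u] by (simp add: mult_vec_2 c_def m_def)
    have n: "herm ?n (column 1 (f x)) = 0" "herm ?n (column 2 (f x)) = 0"
      using herm_conormal_column[of _ "frame_of (f x)"] herm_cnj by (metis column_frame_of complex_cnj_zero)+
    have o: "herm (column 1 (f x)) (column 1 (f x)) = 1" "herm (column 2 (f x)) (column 2 (f x)) = 1"
       "herm (column 1 (f x)) (column 2 (f x)) = 0" "herm (column 2 (f x)) (column 1 (f x)) = 0"
       "herm ?u (column 1 (f x)) = 0" "herm ?u (column 2 (f x)) = 0"
      using U[OF x] unfolding U3_iff by auto
    have "c $ 1 = 0"
      using o(5) unfolding u by (simp add: herm_add_left herm_scale_left n o)
    moreover have "c $ 2 = 0"
      using o(6) unfolding u by (simp add: herm_add_left herm_scale_left n o)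
    ultimately have "?u = m *s ?n" using u by simp
    then have "?u = (m * of_real (norm ?n)) *s e x"
      using conormal_nonzero[OF V[OF x]] unfolding e_def scaleR_cvec by (simp add: vec_eq_iff)
    moreover then have "l x = m * of_real (norm ?n)"
      using e(1)[OF x] by (simp add: l_def herm_scale_left herm_self)
    ultimately show ?thesis by simp
  qed
  have l1: "cmod (l x) = 1" if "x \<in> S3" for x
    using U3_columns(1)[OF U[OF that], of 3] e(1)[OF that] unfolding le[OF that] by (simp add: norm_cscale)
  have cl: "continuous_on S3 l"
    unfolding l_def by (intro continuous_intros f ce)
  obtain g where g: "continuous_on S3 g" "\<And>x. x \<in> S3 \<Longrightarrow> l x = exp (g x)"
    by (rule continuous_log_S3[OF cl]) (use l1 in force)+
  have Re_g: "Re (g x) = 0" if "x \<in> S3" for x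
    using l1[OF that] by (simp add: g(2)[OF that])
  have U1: "from_columns (column 1 (f x)) (column 2 (f x)) (z *s e x) \<in> U3" if "x \<in> S3" "cmod z = 1" for x z
    by (rule from_columns_U3)
       (use U3_columns[OF U[OF that(1)]] e[OF that(1)] that(2) in \<open>auto simp: herm_scale_right norm_cscale\<close>)
  have cf: "continuous_on ({0..1::real} \<times> S3) (\<lambda>z. f (snd z))" "continuous_on ({0..1::real} \<times> S3) (\<lambda>z. g (snd z))"
    "continuous_on ({0..1::real} \<times> S3) (\<lambda>z. e (snd z))"
    by (rule continuous_on_compose2[OF f continuous_on_snd] continuous_on_compose2[OF g(1) continuous_on_snd]
         continuous_on_compose2[OF ce continuous_on_snd]; auto)+
  show ?thesis
  proof (rule homotopic_freeI[where h = "\<lambda>t x. from_columns (column 1 (f x)) (column 2 (f x)) (exp ((1 - of_real t) * g x) *s e x)"])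
    show "continuous_on ({0..1} \<times> S3) (\<lambda>z. from_columns (column 1 (f (snd z))) (column 2 (f (snd z))) (exp ((1 - of_real (fst z)) * g (snd z)) *s e (snd z)))"
      by (intro continuous_intros cf)
    show "from_columns (column 1 (f x)) (column 2 (f x)) (exp ((1 - of_real t) * g x) *s e x) \<in> U3" if "x \<in> S3" for t x
      by (rule U1[OF that]) (simp add: Re_g[OF that])
    show "from_columns (column 1 (f x)) (column 2 (f x)) (exp ((1 - of_real 0) * g x) *s e x) = f x" if "x \<in> S3" for x
      using le[OF that] g(2)[OF that] from_columns_columns[of "f x"] by simp
    show "from_columns (column 1 (f x)) (column 2 (f x)) (exp ((1 - of_real 1) * g x) *s e x) = (orthonormal_frame \<circ> (frame_of \<circ> f)) x" if "x \<in> S3" for x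
      using U3_columns[OF U[OF that]]
      by (simp add: orthonormal_frame_def e_def)
  qed
qed

text \<open>The injective half of the isomorphism from pi_3 of U(3) to pi_3 of the Stiefel manifold,
  for free homotopies.\<close>

lemma U3_homotopic_if_frames_homotopic:
  assumes f: "continuous_on S3 f" "f ` S3 \<subseteq> U3" and g: "continuous_on S3 g" "g ` S3 \<subseteq> U3"
    and hom: "freely_homotopic S3 V2C3 (frame_of \<circ> f) (frame_of \<circ> g)"
  shows "freely_homotopic S3 U3 f g"
proof -
  have "freely_homotopic S3 U3 (orthonormal_frame \<circ> (frame_of \<circ> f)) (orthonormal_frame \<circ> (frame_of \<circ> g))"
    by (rule homotopic_with_compose_continuous_left[OF hom])
       (use orthonormal_frame_U3 in \<open>auto intro!: continuous_intros\<close>)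
  then show ?thesis
    using U3_homotopic_orthonormal_frame[OF f] U3_homotopic_orthonormal_frame[OF g]
    by (meson homotopic_with_trans homotopic_with_symD)
qed

text \<open>On the complex line through \<open>B\<close> and the identity the determinant is
  holomorphic and not identically zero, so its zeros are countable. The plane minus a countable set
  is path connected.\<close>

lemma GL3_path_connected:
  fixes B :: "complex^3^3"
  assumes "det B \<noteq> 0"
  obtains P :: "real \<Rightarrow> complex^3^3" where "continuous_on {0..1} P" "P 0 = B" "P 1 = mat 1" "\<And>t. t \<in> {0..1} \<Longrightarrow> det (P t) \<noteq> 0"
proof -
  define M where "M z = (\<chi> i j. B $ i $ j + z * (mat 1 $ i $ j - B $ i $ j))" for z :: complex
  have M01: "M 0 = B" "M 1 = mat 1" by (simp_all add: M_def vec_eq_iff)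
  have hol: "(\<lambda>z. det (M z)) holomorphic_on UNIV"
    unfolding det_def M_def by (auto intro!: holomorphic_intros)
  have "countable {z. det (M z) = 0}"
  proof (cases "(\<lambda>z. det (M z)) constant_on UNIV")
    case True
    then have "det (M z) = det (M 0)" for z unfolding constant_on_def by auto
    then show ?thesis using assms M01 by simp
  next
    case False
    then show ?thesis
      using holomorphic_countable_zeros[OF hol _ convex_connected[OF convex_UNIV]] by simp
  qed
  then have "path_connected (- {z. det (M z) = 0})"
    by (intro path_connected_complement_countable) auto
  moreover have "0 \<in> - {z. det (M z) = 0}" "1 \<in> - {z. det (M z) = 0}"
    using assms by (simp_all add: M01)
  ultimately obtain p where p: "path p" "path_image p \<subseteq> - {z. det (M z) = 0}" "pathstart p = 0" "pathfinish p = 1"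
    unfolding path_connected_def by blast
  show ?thesis
  proof (rule that[of "\<lambda>t. M (p t)"])
    show "continuous_on {0..1} (\<lambda>t. M (p t))"
      using p(1) unfolding M_def path_def by (intro continuous_intros)
    show "det (M (p t)) \<noteq> 0" if "t \<in> {0..1}" for t
      using p(2) that unfolding path_image_def by blast
  qed (use p M01 in \<open>auto simp: pathstart_def pathfinish_def\<close>)
qed

text \<open>Allows a unitary frame to be normalised to \<open>mat 1\<close> at the base point within
  the free homotopy class of its two-frame.\<close>

lemma frame_of_left_mult_homotopic:
  assumes g: "continuous_on S3 g" "\<And>x. x \<in> S3 \<Longrightarrow> det (g x) \<noteq> 0" and B: "det B \<noteq> 0"
  shows "freely_homotopic S3 V2C3 (\<lambda>x. frame_of (B ** g x)) (\<lambda>x. frame_of (g x))"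
proof -
  obtain P :: "real \<Rightarrow> complex^3^3" where P: "continuous_on {0..1} P" "P 0 = B" "P 1 = mat 1" "\<And>t. t \<in> {0..1} \<Longrightarrow> det (P t) \<noteq> 0"
    by (rule GL3_path_connected[OF B], rule that, assumption+)
  show ?thesis
  proof (rule homotopic_freeI[where h = "\<lambda>t x. frame_of (P t ** g x)"])
    show "continuous_on ({0..1} \<times> S3) (\<lambda>z. frame_of (P (fst z) ** g (snd z)))"
      by (intro continuous_intros continuous_on_compose2[OF P(1) continuous_on_fst] continuous_on_compose2[OF g(1) continuous_on_snd]) auto
  qed (use P g in \<open>auto intro!: frame_of_V2C3 simp: det_mul\<close>)
qed

text \<open>A pointed class lies inside one free homotopy class, so any representative can be tested
  in place of all.\<close>

lemma is_class_of_frame: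
  assumes f: "continuous_on S3 f" "f ` S3 \<subseteq> U3" "f S3_base = mat 1"
  shows "is_class_of V2C3 (pi3_map V2C3 (frame_of (mat 1)) frame_of (pi3_class U3 (mat 1) f)) h
    \<longleftrightarrow> freely_homotopic S3 V2C3 (frame_of \<circ> f) h"
proof -
  have sub: "frame_of ` U3 \<subseteq> V2C3" using frame_of_V2C3 U3_det by auto
  have "pi3_map V2C3 (frame_of (mat 1)) frame_of (pi3_class U3 (mat 1) f) = pi3_class V2C3 (frame_of (mat 1)) (frame_of \<circ> f)"
    by (rule pi3_map_class[OF f]) (use sub in \<open>auto intro!: continuous_intros\<close>)
  moreover have "frame_of \<circ> f \<in> pi3_class V2C3 (frame_of (mat 1)) (frame_of \<circ> f)"
    unfolding pi3_class_def mem_Collect_eq homotopic_with_refl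
    using f sub by (auto intro!: continuous_on_frame_of simp: o_def image_subset_iff)
  moreover have "freely_homotopic S3 V2C3 (frame_of \<circ> f) h"
    if "k \<in> pi3_class V2C3 (frame_of (mat 1)) (frame_of \<circ> f)" "freely_homotopic S3 V2C3 k h" for k
    using that homotopic_with_trans[OF homotopic_canon_freely that(2)] unfolding pi3_class_def by blast
  ultimately show ?thesis
    unfolding is_class_of_def by metis
qed

text \<open>Gives the definite description in \<open>Omega_C\<close> its meaning. Existence:
  orthonormalise the Jacobian on one small sphere and translate to \<open>mat 1\<close> at the base
  point. Uniqueness: two candidates have two-frames homotopic to the Jacobian at a common radius,
  and \<open>frame_of\<close> is injective on classes.\<close>

lemma Omega_C_representative:
  assumes "\<rho> > 0"
    and J: "\<And>r. 0 < r \<Longrightarrow> r < \<rho> \<Longrightarrow> continuous_on S3 (\<lambda>x. complex_jacobian \<Phi> (r *\<^sub>R x))"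
      "\<And>r x. 0 < r \<Longrightarrow> r < \<rho> \<Longrightarrow> x \<in> S3 \<Longrightarrow> complex_jacobian \<Phi> (r *\<^sub>R x) \<in> V2C3"
    and hom: "\<And>r s. 0 < r \<Longrightarrow> r < \<rho> \<Longrightarrow> 0 < s \<Longrightarrow> s < \<rho> \<Longrightarrow>
      freely_homotopic S3 V2C3 (\<lambda>x. complex_jacobian \<Phi> (r *\<^sub>R x)) (\<lambda>x. complex_jacobian \<Phi> (s *\<^sub>R x))"
  obtains f where "continuous_on S3 f" "f ` S3 \<subseteq> U3" "f S3_base = mat 1" "Omega_C \<Phi> = pi3_class U3 (mat 1) f"
    "\<And>r. 0 < r \<Longrightarrow> r < \<rho> \<Longrightarrow> freely_homotopic S3 V2C3 (frame_of \<circ> f) (\<lambda>x. complex_jacobian \<Phi> (r *\<^sub>R x))"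
proof -
  define r0 where "r0 = \<rho> / 2"
  have r0: "0 < r0" "r0 < \<rho>" using assms(1) by (auto simp: r0_def)
  define j where "j = (\<lambda>x. complex_jacobian \<Phi> (r0 *\<^sub>R x))"
  define g where "g = orthonormal_frame \<circ> j"
  have j: "continuous_on S3 j" "j ` S3 \<subseteq> V2C3" using J[OF r0] by (auto simp: j_def)
  have cg: "continuous_on S3 g"
    unfolding g_def o_def by (intro continuous_intros j) (use j in auto)
  have gU: "g x \<in> U3" if "x \<in> S3" for x
    using j(2) that by (auto simp: g_def intro!: orthonormal_frame_U3)
  define f where "f = (\<lambda>x. adj (g S3_base) ** g x)"
  have f: "continuous_on S3 f" "f ` S3 \<subseteq> U3" "f S3_base = mat 1"
    unfolding f_def using gU S3_base_in by (auto intro!: continuous_intros cg U3_mult adj_U3 simp: adj_mult)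
  have "freely_homotopic S3 V2C3 (frame_of \<circ> f) (frame_of \<circ> g)"
    unfolding f_def o_def
    by (rule frame_of_left_mult_homotopic[OF cg]) (use U3_det gU adj_U3 S3_base_in in auto)
  moreover have "freely_homotopic S3 V2C3 (frame_of \<circ> g) j"
    unfolding g_def by (rule homotopic_with_symD[OF frame_orthonormal_homotopic[OF j]])
  ultimately have fj: "freely_homotopic S3 V2C3 (frame_of \<circ> f) j"
    by (rule homotopic_with_trans)
  have fr: "freely_homotopic S3 V2C3 (frame_of \<circ> f) (\<lambda>x. complex_jacobian \<Phi> (r *\<^sub>R x))"
    if "0 < r" "r < \<rho>" for r
    using homotopic_with_trans[OF fj[unfolded j_def] hom[OF r0 that]] .
  have small: "\<forall>\<^sub>F r in at_right 0. 0 < r \<and> r < \<rho>"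
    using assms(1) by (auto simp: eventually_at_right_field)
  have "Omega_C \<Phi> = pi3_class U3 (mat 1) f"
    unfolding Omega_C_def
  proof (rule the_equality, intro conjI)
    show "pi3_class U3 (mat 1) f \<in> pi3 U3 (mat 1)"
      using f by (auto simp: pi3_def)
    show "\<forall>\<^sub>F r in at_right 0. is_class_of V2C3
        (pi3_map V2C3 (frame_of (mat 1)) frame_of (pi3_class U3 (mat 1) f)) (\<lambda>x. complex_jacobian \<Phi> (r *\<^sub>R x))"
      by (rule eventually_mono[OF small]) (auto simp: is_class_of_frame[OF f] fr)
    fix \<omega> assume \<omega>: "\<omega> \<in> pi3 U3 (mat 1) \<and> (\<forall>\<^sub>F r in at_right 0. is_class_of V2C3
        (pi3_map V2C3 (frame_of (mat 1)) frame_of \<omega>) (\<lambda>x. complex_jacobian \<Phi> (r *\<^sub>R x)))"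
    then obtain f' where f': "continuous_on S3 f'" "f' ` S3 \<subseteq> U3" "f' S3_base = mat 1" and \<omega>': "\<omega> = pi3_class U3 (mat 1) f'"
      by (auto simp: pi3_def)
    have "\<forall>\<^sub>F r in at_right (0::real). (0 < r \<and> r < \<rho>) \<and> freely_homotopic S3 V2C3 (frame_of \<circ> f') (\<lambda>x. complex_jacobian \<Phi> (r *\<^sub>R x))"
      using eventually_conj[OF small] \<omega> unfolding \<omega>' is_class_of_frame[OF f'] by blast
    then obtain r where r: "0 < r" "r < \<rho>" and
      *: "freely_homotopic S3 V2C3 (frame_of \<circ> f') (\<lambda>x. complex_jacobian \<Phi> (r *\<^sub>R x))"
      using eventually_happens'[OF trivial_limit_at_right_real] by blast
    have "freely_homotopic S3 V2C3 (frame_of \<circ> f') (frame_of \<circ> f)"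
      by (rule homotopic_with_trans[OF * homotopic_with_symD[OF fr[OF r]]])
    from U3_pointed_homotopy[OF f'(3) f(3) U3_homotopic_if_frames_homotopic[OF f'(1,2) f(1,2) this]]
    show "\<omega> = pi3_class U3 (mat 1) f"
      unfolding \<omega>' by (rule pi3_class_eqI)
  qed
  from that[OF f this fr] show ?thesis .
qed

section \<open>Real six-frames\<close>

lemma exhaust_5: "x = 1 \<or> x = 2 \<or> x = 3 \<or> x = 4 \<or> x = 5" for x :: 5
proof (induct x)
  case (of_int z)
  then have "0 \<le> z" "z < 5" by simp_all
  then have "z = 0 \<or> z = 1 \<or> z = 2 \<or> z = 3 \<or> z = 4" by arith
  then show ?case by auto
qed

lemma exhaust_6: "x = 1 \<or> x = 2 \<or> x = 3 \<or> x = 4 \<or> x = 5 \<or> x = 6" for x :: 6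
proof (induct x)
  case (of_int z)
  then have "0 \<le> z" "z < 6" by simp_all
  then have "z = 0 \<or> z = 1 \<or> z = 2 \<or> z = 3 \<or> z = 4 \<or> z = 5" by arith
  then show ?case by auto
qed

lemma UNIV_5: "UNIV = {1, 2, 3, 4, 5 :: 5}"
  using exhaust_5 by blast

lemma UNIV_6: "UNIV = {1, 2, 3, 4, 5, 6 :: 6}"
  using exhaust_6 by blast

lemma sum_5: "sum f (UNIV :: 5 set) = f 1 + f 2 + f 3 + f 4 + f 5"
  unfolding UNIV_5 by (simp add: ac_simps)

lemma sum_6: "sum f (UNIV :: 6 set) = f 1 + f 2 + f 3 + f 4 + f 5 + f 6"
  unfolding UNIV_6 by (simp add: ac_simps)

lemma prod_6: "prod f (UNIV :: 6 set) = f 1 * f 2 * f 3 * f 4 * f 5 * f 6"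
  unfolding UNIV_6 by (simp add: ac_simps)

lemma forall_5: "(\<forall>i::5. P i) \<longleftrightarrow> P 1 \<and> P 2 \<and> P 3 \<and> P 4 \<and> P 5"
  by (metis exhaust_5)

lemma forall_6: "(\<forall>i::6. P i) \<longleftrightarrow> P 1 \<and> P 2 \<and> P 3 \<and> P 4 \<and> P 5 \<and> P 6"
  by (metis exhaust_6)

lemma vector_5:
  "(vector [a, b, c, d, e] :: 'a::zero^5) $ 1 = a" "(vector [a, b, c, d, e] :: 'a::zero^5) $ 2 = b"
  "(vector [a, b, c, d, e] :: 'a::zero^5) $ 3 = c" "(vector [a, b, c, d, e] :: 'a::zero^5) $ 4 = d"
  "(vector [a, b, c, d, e] :: 'a::zero^5) $ 5 = e"
  unfolding vector_def by simp_all

lemma vector_6: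
  "(vector [a, b, c, d, e, g] :: 'a::zero^6) $ 1 = a" "(vector [a, b, c, d, e, g] :: 'a::zero^6) $ 2 = b"
  "(vector [a, b, c, d, e, g] :: 'a::zero^6) $ 3 = c" "(vector [a, b, c, d, e, g] :: 'a::zero^6) $ 4 = d"
  "(vector [a, b, c, d, e, g] :: 'a::zero^6) $ 5 = e" "(vector [a, b, c, d, e, g] :: 'a::zero^6) $ 6 = g"
  unfolding vector_def by simp_all

lemmas to_R6_nth = vector_6[of "Re (z $ 1)" "Im (z $ 1)" "Re (z $ 2)" "Im (z $ 2)" "Re (z $ 3)" "Im (z $ 3)" for z :: "complex^3", folded to_R6_def]
lemmas to_R5_nth = vector_5[of "Re (z $ 1)" "Im (z $ 1)" "Re (z $ 2)" "Im (z $ 2)" 0 for z :: "complex^2", folded to_R5_def]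

lemma linear_to_R6: "linear to_R6"
  by (rule linearI) (simp_all add: vec_eq_iff forall_6 to_R6_nth)

lemma linear_to_R5: "linear to_R5"
  by (rule linearI) (simp_all add: vec_eq_iff forall_5 to_R5_nth)

lemma to_R6_eq_0: "to_R6 z = 0 \<longleftrightarrow> z = 0"
  by (auto simp add: vec_eq_iff forall_6 forall_3 to_R6_nth complex_eq_iff)

text \<open>\<open>L\<close> is a function and not a complex matrix because during most of the
  deformation it is only real linear.\<close>

definition frame6 :: "(complex^2 \<Rightarrow> complex^3) \<Rightarrow> complex^3 \<Rightarrow> complex^3 \<Rightarrow> real^6^6" where
  "frame6 L p q = (\<chi> i k. to_R6 (if k = 1 then L (axis 1 1) else if k = 2 then L (axis 1 \<i>)
     else if k = 3 then L (axis 2 1) else if k = 4 then L (axis 2 \<i>) else if k = 5 then p else q) $ i)"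

lemma frame6_mult:
  assumes "linear L"
  shows "frame6 L p q *v u = to_R6 (L (vector [Complex (u $ 1) (u $ 2), Complex (u $ 3) (u $ 4)]) + u $ 5 *\<^sub>R p + u $ 6 *\<^sub>R q)"
proof -
  interpret L: linear L by fact
  interpret R: linear to_R6 by (rule linear_to_R6)
  have *: "(vector [Complex (u $ 1) (u $ 2), Complex (u $ 3) (u $ 4)] :: complex^2)
     = u $ 1 *\<^sub>R axis 1 1 + u $ 2 *\<^sub>R axis 1 \<i> + u $ 3 *\<^sub>R axis 2 1 + u $ 4 *\<^sub>R axis 2 \<i>"
    by (simp add: vec_eq_iff forall_2 axis_def complex_eq_iff)
  show ?thesis
    unfolding * L.add L.scale R.add R.scale
    by (simp add: vec_eq_iff matrix_vector_mult_def sum_6 frame6_def mult.commute)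
qed

lemma frame6_nonsingular:
  assumes "linear L"
  shows "det (frame6 L p q) \<noteq> 0 \<longleftrightarrow> (\<forall>v a b. L v + a *\<^sub>R p + b *\<^sub>R q = 0 \<longrightarrow> v = 0 \<and> a = 0 \<and> b = 0)"
proof -
  have "det (frame6 L p q) \<noteq> 0 \<longleftrightarrow> (\<forall>u. frame6 L p q *v u = 0 \<longrightarrow> u = 0)"
    by (metis invertible_det_nz invertible_left_inverse matrix_left_invertible_ker)
  also have "\<dots> \<longleftrightarrow> (\<forall>v a b. L v + a *\<^sub>R p + b *\<^sub>R q = 0 \<longrightarrow> v = 0 \<and> a = 0 \<and> b = 0)"
  proof (intro iffI allI impI)
    fix v a b assume *: "\<forall>u. frame6 L p q *v u = 0 \<longrightarrow> u = 0" "L v + a *\<^sub>R p + b *\<^sub>R q = 0"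
    define u :: "real^6" where "u = vector [Re (v $ 1), Im (v $ 1), Re (v $ 2), Im (v $ 2), a, b]"
    have "vector [Complex (u $ 1) (u $ 2), Complex (u $ 3) (u $ 4)] = v"
      by (simp add: vec_eq_iff forall_2 u_def vector_6)
    then have "frame6 L p q *v u = 0"
      using *(2) by (simp add: frame6_mult[OF assms] u_def vector_6 to_R6_eq_0)
    with *(1) have "u = 0" by blast
    then show "v = 0 \<and> a = 0 \<and> b = 0"
      by (auto simp: u_def vec_eq_iff forall_6 forall_2 vector_6 complex_eq_iff)
  next
    fix u assume *: "\<forall>v a b. L v + a *\<^sub>R p + b *\<^sub>R q = 0 \<longrightarrow> v = 0 \<and> a = 0 \<and> b = 0" "frame6 L p q *v u = 0"
    then have "vector [Complex (u $ 1) (u $ 2), Complex (u $ 3) (u $ 4)] = (0::complex^2)" "u $ 5 = 0" "u $ 6 = 0"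
      by (auto simp: frame6_mult[OF assms] to_R6_eq_0)
    then show "u = 0"
      by (auto simp: vec_eq_iff forall_6 forall_2 complex_eq_iff)
  qed
  finally show ?thesis .
qed

lemma continuous_on_to_R6 [continuous_intros]:
  "continuous_on S f \<Longrightarrow> continuous_on S (\<lambda>x. to_R6 (f x))"
  by (rule bounded_linear.continuous_on[OF linear_conv_bounded_linear[THEN iffD1, OF linear_to_R6]])

lemma continuous_on_frame6 [continuous_intros]:
  assumes L: "\<And>v. continuous_on S (\<lambda>x. L x v)" and "continuous_on S p" "continuous_on S q"
  shows "continuous_on S (\<lambda>x. frame6 (L x) (p x) (q x))"
proof -
  have "continuous_on S (\<lambda>x. to_R6 (if k = 1 then L x (axis 1 1) else if k = 2 then L x (axis 1 \<i>)
     else if k = 3 then L x (axis 2 1) else if k = 4 then L x (axis 2 \<i>) else if k = 5 then p x else q x) $ i)" for i and k :: 6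
    using exhaust_6[of k] by (elim disjE) (auto intro!: continuous_intros assms)
  then show ?thesis
    unfolding frame6_def by (intro continuous_on_vec_lambda)
qed

lemma frame6_homotopic:
  fixes L :: "real \<Rightarrow> complex^2 \<Rightarrow> complex^2 \<Rightarrow> complex^3"
  assumes lin: "\<And>t x. t \<in> {0..1} \<Longrightarrow> x \<in> S3 \<Longrightarrow> linear (L t x)"
    and cont: "\<And>v. continuous_on ({0..1} \<times> S3) (\<lambda>z. L (fst z) (snd z) v)"
      "continuous_on ({0..1} \<times> S3) (\<lambda>z. p (fst z) (snd z))" "continuous_on ({0..1} \<times> S3) (\<lambda>z. q (fst z) (snd z))"
    and ns: "\<And>t x v a b. t \<in> {0..1} \<Longrightarrow> x \<in> S3 \<Longrightarrow> L t x v + a *\<^sub>R p t x + b *\<^sub>R q t x = 0 \<Longrightarrow> v = 0 \<and> a = 0 \<and> b = 0"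
    and ends: "\<And>x. x \<in> S3 \<Longrightarrow> f x = frame6 (L 0 x) (p 0 x) (q 0 x)" "\<And>x. x \<in> S3 \<Longrightarrow> g x = frame6 (L 1 x) (p 1 x) (q 1 x)"
  shows "freely_homotopic S3 GL6 f g"
proof (rule homotopic_freeI[where h = "\<lambda>t x. frame6 (L t x) (p t x) (q t x)"])
  show "continuous_on ({0..1} \<times> S3) (\<lambda>z. frame6 (L (fst z) (snd z)) (p (fst z) (snd z)) (q (fst z) (snd z)))"
    by (intro continuous_intros cont)
  show "frame6 (L t x) (p t x) (q t x) \<in> GL6" if "0 \<le> t \<and> t \<le> 1" "x \<in> S3" for t x
    using frame6_nonsingular[OF lin] ns that by auto
qed (use ends in auto)

lemma linear_cmatrix: "linear ((*v) A)" for A :: "complex^'n^'m"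
  by (rule linearI) (simp_all add: vec_eq_iff matrix_vector_mult_def scaleR_sum_right distrib_left sum.distrib)

lemma continuous_on_mult_snd:
  assumes "continuous_on S f"
  shows "continuous_on ({0..1::real} \<times> S) (\<lambda>z. f (snd z))"
  by (rule continuous_on_compose2[OF assms continuous_on_snd]) auto

text \<open>Modulo the complex plane spanned by the columns of \<open>A\<close>, the vectors
  \<open>p\<close> and \<open>q\<close> are complex multiples of the conormal, and these two factors
  are linearly independent over the reals. The first has a continuous logarithm; the quotient of the
  second by the first is never real, so it stays in one open half plane, which contains \<i> or
  -\<i>.\<close>

lemma frame6_conormal_homotopic:
  assumes A: "continuous_on S3 A" "\<And>x. x \<in> S3 \<Longrightarrow> A x \<in> V2C3" and pq: "continuous_on S3 p" "continuous_on S3 q"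
    and ns: "\<And>x. x \<in> S3 \<Longrightarrow> det (frame6 ((*v) (A x)) (p x) (q x)) \<noteq> 0"
  obtains \<sigma> :: real where "\<sigma> = 1 \<or> \<sigma> = - 1"
    "freely_homotopic S3 GL6 (\<lambda>x. frame6 ((*v) (A x)) (p x) (q x))
       (\<lambda>x. frame6 ((*v) (A x)) (conormal (A x)) ((of_real \<sigma> * \<i>) *s conormal (A x)))"
proof -
  define n where "n = (\<lambda>x. conormal (A x))"
  define l where "l w x = herm w (n x) / herm (n x) (n x)" for w x
  have nz: "n x \<noteq> 0" if "x \<in> S3" for x using conormal_nonzero A(2) that by (simp add: n_def)
  have cn: "continuous_on S3 n" unfolding n_def by (intro continuous_intros A)
  have ln: "l w x = 0" if "w = A x *v c" for w x c using that by (simp add: l_def n_def herm_conormal)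
  have l_lin: "l (a *\<^sub>R w + b *\<^sub>R w') x = of_real a * l w x + of_real b * l w' x" for a b w w' x
    by (simp add: l_def herm_add_left herm_scaleR_left add_divide_distrib)
  have dec: "\<exists>c. w = A x *v c + l w x *s n x" if "x \<in> S3" for w x
    using frame_decomposition[OF A(2)[OF that], of w] unfolding l_def n_def by blast
  have indep: "a = 0 \<and> b = 0" if x: "x \<in> S3" and "of_real a * l (p x) x + of_real b * l (q x) x = 0" for a b x
  proof -
    have "l (a *\<^sub>R p x + b *\<^sub>R q x) x = 0" using that l_lin by simp
    then obtain c where "a *\<^sub>R p x + b *\<^sub>R q x = A x *v c"
      using dec[OF x, of "a *\<^sub>R p x + b *\<^sub>R q x"] by auto
    then have "A x *v (- c) + a *\<^sub>R p x + b *\<^sub>R q x = 0"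
      using linear_neg[OF linear_cmatrix, of "A x" c] by (simp add: algebra_simps)
    then show ?thesis
      using ns[OF x] unfolding frame6_nonsingular[OF linear_cmatrix] by blast
  qed
  have cl: "continuous_on S3 (\<lambda>x. l (p x) x)" "continuous_on S3 (\<lambda>x. l (q x) x)"
    unfolding l_def by (intro continuous_intros pq cn; simp add: herm_self nz)+
  have lp: "l (p x) x \<noteq> 0" if "x \<in> S3" for x
    using indep[OF that, of 1 0] by auto
  obtain g where g: "continuous_on S3 g" "\<And>x. x \<in> S3 \<Longrightarrow> l (p x) x = exp (g x)"
    by (rule continuous_log_S3[OF cl(1)]) (use lp in blast)+
  define r where "r x = l (q x) x / l (p x) x" for x
  have cr: "continuous_on S3 r"
    unfolding r_def by (intro continuous_intros cl) (use lp in auto)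
  have Im_r: "Im (r x) \<noteq> 0" if "x \<in> S3" for x
  proof
    assume "Im (r x) = 0"
    then have "r x = of_real (Re (r x))" by (simp add: complex_eq_iff)
    then have "of_real (- Re (r x)) * l (p x) x + of_real 1 * l (q x) x = 0"
      using lp[OF that] by (simp add: r_def field_simps)
    then show False using indep[OF that] by fastforce
  qed
  define \<sigma> where "\<sigma> = sgn (Im (r S3_base))"
  have \<sigma>: "\<sigma> = 1 \<or> \<sigma> = - 1"
    using Im_r[OF S3_base_in] by (auto simp: \<sigma>_def sgn_if)
  have sg: "\<sigma> * Im (r x) > 0" if "x \<in> S3" for x
  proof (rule pos_on_connected[OF connected_S3 _ _ S3_base_in _ that])
    show "continuous_on S3 (\<lambda>x. \<sigma> * Im (r x))" by (intro continuous_intros cr)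
    show "\<sigma> * Im (r S3_base) > 0" using Im_r[OF S3_base_in] by (simp add: \<sigma>_def sgn_mult_self_eq abs_sgn[symmetric] sgn_if)
  qed (use Im_r \<sigma> in auto)
  define wp wq where "wp x = p x - l (p x) x *s n x" and "wq x = q x - l (q x) x *s n x" for x
  have cw: "continuous_on S3 wp" "continuous_on S3 wq"
    unfolding wp_def wq_def by (intro continuous_intros pq cl cn)+
  have w: "\<exists>c. wp x = A x *v c" "\<exists>c. wq x = A x *v c" if "x \<in> S3" for x
    using dec[OF that, of "p x"] dec[OF that, of "q x"] unfolding wp_def wq_def by (metis add_diff_cancel_right')+
  \<comment> \<open>\<open>E\<close> leads from the factor of \<open>p\<close> to 1 by shrinking its
    logarithm. \<open>G\<close> is \<open>E\<close> times a point on the segment from the quotient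
    \<open>r\<close> to \<sigma>\<i>, so the quotient of the two factors never becomes real. The
    components \<open>wp\<close>, \<open>wq\<close> along the plane are shrunk to 0 at the same
    time.\<close>
  define E where "E t x = exp ((1 - of_real t) * g x)" for t :: real and x
  define G where "G t x = E t x * ((1 - of_real t) * r x + of_real (t * \<sigma>) * \<i>)" for t :: real and x
  show ?thesis
  proof (rule that[OF \<sigma>], rule frame6_homotopic[where L = "\<lambda>t x. (*v) (A x)"
        and p = "\<lambda>t x. (1 - t) *\<^sub>R wp x + E t x *s n x" and q = "\<lambda>t x. (1 - t) *\<^sub>R wq x + G t x *s n x"])
    show "linear ((*v) (A x))" for x by (rule linear_cmatrix)
    note c = continuous_on_mult_snd[OF A(1)] continuous_on_mult_snd[OF cw(1)] continuous_on_mult_snd[OF cw(2)]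
      continuous_on_mult_snd[OF g(1)] continuous_on_mult_snd[OF cr] continuous_on_mult_snd[OF cn]
    show "continuous_on ({0..1::real} \<times> S3) (\<lambda>z. A (snd z) *v v)" for v
      by (intro continuous_intros c)
    show "continuous_on ({0..1} \<times> S3) (\<lambda>z. (1 - fst z) *\<^sub>R wp (snd z) + E (fst z) (snd z) *s n (snd z))"
      unfolding E_def by (intro continuous_intros c)
    show "continuous_on ({0..1} \<times> S3) (\<lambda>z. (1 - fst z) *\<^sub>R wq (snd z) + G (fst z) (snd z) *s n (snd z))"
      unfolding G_def E_def by (intro continuous_intros c)
  next
    fix t x v a b
    assume t: "t \<in> {0..1::real}" and x: "x \<in> S3"
      and 0: "A x *v v + a *\<^sub>R ((1 - t) *\<^sub>R wp x + E t x *s n x) + b *\<^sub>R ((1 - t) *\<^sub>R wq x + G t x *s n x) = 0"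
    obtain c d where cd: "wp x = A x *v c" "wq x = A x *v d" using w[OF x] by blast
    \<comment> \<open>Pairing with the conormal removes everything in the plane of \<open>A\<close>
      and leaves a relation between complex numbers.\<close>
    have "herm (A x *v v + a *\<^sub>R ((1 - t) *\<^sub>R wp x + E t x *s n x) + b *\<^sub>R ((1 - t) *\<^sub>R wq x + G t x *s n x)) (n x) = 0"
      unfolding 0 by simp
    then have "(of_real a * E t x + of_real b * G t x) * herm (n x) (n x) = 0"
      unfolding cd n_def herm_add_left herm_scaleR_left herm_scale_left herm_conormal by (simp add: algebra_simps)
    then have "of_real a * E t x + of_real b * G t x = 0"
      using nz[OF x] by (simp add: herm_self)
    then have "E t x * (of_real a + of_real b * ((1 - of_real t) * r x + of_real (t * \<sigma>) * \<i>)) = 0"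
      by (simp add: G_def algebra_simps)
    then have z: "of_real a + of_real b * ((1 - of_real t) * r x + of_real (t * \<sigma>) * \<i>) = 0"
      by (simp add: E_def)
    have "Im (of_real a + of_real b * ((1 - of_real t) * r x + of_real (t * \<sigma>) * \<i>)) = b * ((1 - t) * Im (r x) + t * \<sigma>)"
      by simp
    then have "b * ((1 - t) * Im (r x) + t * \<sigma>) = 0" unfolding z by simp
    moreover have "(1 - t) * Im (r x) + t * \<sigma> \<noteq> 0"
    proof
      assume *: "(1 - t) * Im (r x) + t * \<sigma> = 0"
      have "\<sigma> * ((1 - t) * Im (r x) + t * \<sigma>) = (1 - t) * (\<sigma> * Im (r x)) + t"
        using \<sigma> by (auto simp: algebra_simps)
      also have "\<dots> > 0"
        using sg[OF x] t by (cases "t = 1") (auto intro!: add_pos_nonneg)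
      finally show False unfolding * by simp
    qed
    ultimately have "b = 0" by simp
    with z have "a = 0" by simp
    with 0 \<open>b = 0\<close> have "A x *v v = 0" by simp
    then show "v = 0 \<and> a = 0 \<and> b = 0"
      using \<open>a = 0\<close> \<open>b = 0\<close> A(2)[OF x] V2C3_iff by blast
  next
    fix x assume x: "x \<in> S3"
    show "frame6 ((*v) (A x)) (p x) (q x) = frame6 ((*v) (A x)) ((1 - 0) *\<^sub>R wp x + E 0 x *s n x) ((1 - 0) *\<^sub>R wq x + G 0 x *s n x)"
      using g(2)[OF x] lp[OF x] by (simp add: wp_def wq_def E_def G_def r_def)
    show "frame6 ((*v) (A x)) (conormal (A x)) ((of_real \<sigma> * \<i>) *s conormal (A x)) = frame6 ((*v) (A x)) ((1 - 1) *\<^sub>R wp x + E 1 x *s n x) ((1 - 1) *\<^sub>R wq x + G 1 x *s n x)"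
      by (simp add: E_def G_def n_def)
  qed
qed

text \<open>In each real block the second column is \<i> times the first. So \<open>tau\<close> is
  itself a completion of a complex two-frame by two vectors, which is what makes it comparable with
  the geometric frames.\<close>

lemma tau_eq_frame6: "tau A = frame6 ((*v) (frame_of A)) (column 3 A) (\<i> *s column 3 A)"
proof -
  have "tau A $ i $ k = frame6 ((*v) (frame_of A)) (column 3 A) (\<i> *s column 3 A) $ i $ k" for i k
    using exhaust_6[of i] exhaust_6[of k]
    by (elim disjE; simp add: tau_def frame6_def Let_def second_in_block_def cblock_def to_R6_nth
      matrix_vector_mult_def sum_2 axis_def frame_of_def column_def)
  then show ?thesis by (simp add: vec_eq_iff)
qed

section \<open>The homomorphisms \<open>tau\<close> and \<open>j_incl\<close>\<close>

lemma cblock_simps: "cblock 1 = 1" "cblock 2 = 1" "cblock 3 = 2" "cblock 4 = 2" "cblock 5 = 3" "cblock 6 = 3" "cblock 0 = 3"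
  by (simp_all add: cblock_def)

lemma second_in_block_simps: "\<not> second_in_block 1" "second_in_block 2" "\<not> second_in_block 3" "second_in_block 4"
  "\<not> second_in_block 5" "second_in_block 6" "second_in_block 0"
  by (simp_all add: second_in_block_def)

lemma tau_mult: "tau (A ** B) = tau A ** tau B"
proof -
  have "tau (A ** B) $ i $ k = (tau A ** tau B) $ i $ k" for i k
  proof -
    have "(tau A ** tau B) $ i $ k = (\<Sum>j\<in>UNIV. tau A $ i $ j * tau B $ j $ k)"
      by (simp add: matrix_matrix_mult_def)
    moreover have "tau (A ** B) $ i $ k = (\<Sum>j\<in>UNIV. tau A $ i $ j * tau B $ j $ k)"
      by (cases "second_in_block i"; cases "second_in_block k")
        (simp_all add: tau_def Let_def cblock_simps second_in_block_simps matrix_matrix_mult_def sum_6 sum_3 algebra_simps)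
    ultimately show ?thesis by simp
  qed
  then show ?thesis by (simp add: vec_eq_iff)
qed

lemma tau_mat_1: "tau (mat 1) = mat 1"
proof -
  have "tau (mat 1) $ i $ k = mat 1 $ i $ k" for i k
    using exhaust_6[of i] exhaust_6[of k]
    by (elim disjE; simp add: tau_def Let_def mat_def cblock_def second_in_block_def)
  then show ?thesis by (simp add: vec_eq_iff)
qed

lemma tau_adj: "tau (adj A) = transpose (tau A)"
  by (auto simp: tau_def adj_def transpose_def vec_eq_iff Let_def)

lemma tau_U3_orthogonal: "A \<in> U3 \<Longrightarrow> orthogonal_matrix (tau A)"
  unfolding orthogonal_matrix by (simp add: tau_adj[symmetric] tau_mult[symmetric] adj_mult tau_mat_1)

lemma continuous_on_tau [continuous_intros]:
  assumes "continuous_on S f"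
  shows "continuous_on S (\<lambda>x. tau (f x))"
  unfolding tau_eq_frame6 by (intro continuous_intros assms)

lemma index5_simps: "index5 1 = 1" "index5 2 = 2" "index5 3 = 3" "index5 4 = 4" "index5 5 = 5"
  by (simp_all add: index5_def)

lemma j_incl_mult: "j_incl (A ** B) = j_incl A ** j_incl B"
proof -
  have "j_incl (A ** B) $ i $ k = (j_incl A ** j_incl B) $ i $ k" for i k
  proof -
    have "(j_incl A ** j_incl B) $ i $ k = (\<Sum>j\<in>UNIV. j_incl A $ i $ j * j_incl B $ j $ k)"
      by (simp add: matrix_matrix_mult_def)
    moreover have "j_incl (A ** B) $ i $ k = (\<Sum>j\<in>UNIV. j_incl A $ i $ j * j_incl B $ j $ k)"
      by (cases "i = 6"; cases "k = 6")
        (simp_all add: j_incl_def index5_simps matrix_matrix_mult_def sum_6 sum_5)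
    ultimately show ?thesis by simp
  qed
  then show ?thesis by (simp add: vec_eq_iff)
qed

lemma j_incl_mat_1: "j_incl (mat 1) = mat 1"
proof -
  have "j_incl (mat 1) $ i $ k = mat 1 $ i $ k" for i k
    using exhaust_6[of i] exhaust_6[of k]
    by (elim disjE; simp add: j_incl_def mat_def index5_def)
  then show ?thesis by (simp add: vec_eq_iff)
qed

lemma j_incl_transpose: "j_incl (transpose A) = transpose (j_incl A)"
  by (auto simp: j_incl_def transpose_def vec_eq_iff)

lemma j_incl_orthogonal: "orthogonal_matrix A \<Longrightarrow> orthogonal_matrix (j_incl A)"
  unfolding orthogonal_matrix by (simp add: j_incl_transpose[symmetric] j_incl_mult[symmetric] j_incl_mat_1)

lemma j_incl_det: "det A \<noteq> 0 \<Longrightarrow> det (j_incl A) \<noteq> 0"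
  using arg_cong[OF matrix_inv_both(1)[of A], of "\<lambda>B. det (j_incl B)"]
  by (auto simp: j_incl_mult det_mul j_incl_mat_1)

lemma continuous_on_j_incl [continuous_intros]:
  assumes "continuous_on S f"
  shows "continuous_on S (\<lambda>x. j_incl (f x))"
proof -
  have "continuous_on S (\<lambda>x. if i = 6 \<or> k = 6 then (if i = k then 1 else 0) else f x $ index5 i $ index5 k)" for i k
    by (cases "i = 6 \<or> k = 6") (auto intro!: continuous_intros assms)
  then show ?thesis
    unfolding j_incl_def by (intro continuous_on_vec_lambda)
qed

lemma orthogonal_pointed_SO6:
  assumes "continuous_on S3 f" "\<And>x. x \<in> S3 \<Longrightarrow> orthogonal_matrix (f x)" "f S3_base = mat 1"
  shows "f ` S3 \<subseteq> SO6"
proof -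
  have "det (f x) > 0" if "x \<in> S3" for x
  proof (rule pos_on_connected[OF connected_S3 _ _ S3_base_in _ that])
    show "continuous_on S3 (\<lambda>x. det (f x))" by (intro continuous_intros assms)
    show "det (f x) \<noteq> 0" if "x \<in> S3" for x
      using det_orthogonal_matrix[OF assms(2)[OF that]] by auto
  qed (simp add: assms(3))
  then show ?thesis
    using det_orthogonal_matrix[OF assms(2)] assms(2) by (fastforce simp: SO6_def rotation_matrix_def)
qed

text \<open>The chain rule in matrix form: \<open>K\<close> will be the derivative of the
  parametrisation of the punctured sphere and \<open>B\<close> that of the extension of the
  immersion. The last column, which \<open>j_incl\<close> fixes, will carry the normal of the
  sphere.\<close>

lemma frame6_j_incl:
  assumes K: "linear K"
  shows "frame6 (\<lambda>v. K (to_R5 v)) (K (axis 5 1)) q ** j_incl B = frame6 (\<lambda>v. K (B *v to_R5 v)) (K (B *v axis 5 1)) q"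
proof -
  interpret K: linear K by fact
  have KR: "linear (\<lambda>v. to_R6 (K v))"
    using linear_compose[OF K linear_to_R6] by (simp add: o_def)
  have e: "to_R5 (axis 1 1) = axis 1 1" "to_R5 (axis 1 \<i>) = axis 2 1" "to_R5 (axis 2 1) = axis 3 1" "to_R5 (axis 2 \<i>) = axis 4 1"
    by (simp_all add: vec_eq_iff forall_5 to_R5_nth axis_def)
  have Ba: "to_R6 (K (B *v axis k 1)) $ i = (\<Sum>m\<in>UNIV. B $ m $ k * to_R6 (K (axis m 1)) $ i)" for k i
  proof -
    have "B *v axis k 1 = (\<Sum>m\<in>UNIV. B $ m $ k *\<^sub>R axis m 1)"
      unfolding matrix_vector_mult_basis by (simp add: column_def vec_eq_iff sum_5 forall_5 axis_def)
    then have "to_R6 (K (B *v axis k 1)) = (\<Sum>m\<in>UNIV. B $ m $ k *\<^sub>R to_R6 (K (axis m 1)))"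
      by (simp add: linear_sum[OF KR] linear_scale[OF KR])
    then show ?thesis by simp
  qed
  have "(frame6 (\<lambda>v. K (to_R5 v)) (K (axis 5 1)) q ** j_incl B) $ i $ k
      = frame6 (\<lambda>v. K (B *v to_R5 v)) (K (B *v axis 5 1)) q $ i $ k" for i k
  proof -
    have "(frame6 (\<lambda>v. K (to_R5 v)) (K (axis 5 1)) q ** j_incl B) $ i $ k
        = (\<Sum>m\<in>UNIV. frame6 (\<lambda>v. K (to_R5 v)) (K (axis 5 1)) q $ i $ m * j_incl B $ m $ k)"
      by (simp add: matrix_matrix_mult_def)
    also have "\<dots> = frame6 (\<lambda>v. K (B *v to_R5 v)) (K (B *v axis 5 1)) q $ i $ k"
      using exhaust_6[of k]
      by (elim disjE; simp add: frame6_def sum_6 e Ba sum_5 j_incl_def index5_simps mult.commute)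
    finally show ?thesis .
  qed
  then show ?thesis by (simp add: vec_eq_iff)
qed

lemma frame6_minus_last: "det (frame6 L p (- q)) = - det (frame6 L p q)"
proof -
  define E :: "real^6^6" where "E = (\<chi> i k. if i = k then if i = 6 then -1 else 1 else 0)"
  have "frame6 L p (- q) = frame6 L p q ** E"
  proof -
    have "frame6 L p (- q) $ i $ k = (\<Sum>m\<in>UNIV. frame6 L p q $ i $ m * E $ m $ k)" for i k
      using exhaust_6[of k]
      by (elim disjE; simp add: frame6_def sum_6 E_def linear_neg[OF linear_to_R6])
    then show ?thesis by (simp add: vec_eq_iff matrix_matrix_mult_def)
  qed
  moreover have "det E = -1"
    by (subst det_diagonal) (simp_all add: E_def prod_6)
  ultimately show ?thesis by (simp add: det_mul)
qed

text \<open>The outward normal comes first in the orientation of the sphere but last, with opposite sign, in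
  the frame: the cyclic permutation of six vectors is odd.\<close>

lemma det_normal_last:
  fixes n d1 d2 d3 d4 d5 :: "complex^3"
  assumes "det (vector [to_R6 n, to_R6 d1, to_R6 d2, to_R6 d3, to_R6 d4, to_R6 d5] :: real^6^6) > 0" (is "det ?V > 0")
    and L: "L (axis 1 1) = d1" "L (axis 1 \<i>) = d2" "L (axis 2 1) = d3" "L (axis 2 \<i>) = d4"
  shows "det (frame6 L d5 (- n)) > 0"
proof -
  define p :: "6 \<Rightarrow> 6" where "p = Transposition.transpose 1 2 \<circ> (Transposition.transpose 2 3 \<circ> (Transposition.transpose 3 4 \<circ> (Transposition.transpose 4 5 \<circ> Transposition.transpose 5 6)))"
  have p: "p permutes UNIV"
    unfolding p_def by (intro permutes_compose permutes_swap_id) auto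
  have sgn: "sign p = -1"
    unfolding p_def by (simp add: sign_compose permutation_compose permutation_swap_id sign_swap_id)
  have pv: "p 1 = 2" "p 2 = 3" "p 3 = 4" "p 4 = 5" "p 5 = 6" "p 6 = 1"
    by (simp_all add: p_def transpose_def)
  have "transpose (frame6 L d5 n) = (\<chi> i. ?V $ p i)"
  proof -
    have "transpose (frame6 L d5 n) $ i = ?V $ p i" for i
      using exhaust_6[of i] by (elim disjE; simp only: pv vector_6; simp add: transpose_def frame6_def L)
    then show ?thesis by (simp add: vec_eq_iff)
  qed
  then have "det (frame6 L d5 n) = of_int (sign p) * det ?V"
    using det_permute_rows[OF p, of ?V] det_transpose by metis
  then show ?thesis
    using assms(1) by (simp add: frame6_minus_last sgn)
qed

lemma homotopic_det_pos:
  assumes hom: "freely_homotopic S3 GL6 f g" and x: "a \<in> S3" "det (f a) > 0" "x \<in> S3"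
  shows "det (g x) > 0"
proof -
  obtain h where h: "continuous_on ({0..1::real} \<times> S3) (\<lambda>z. h (fst z) (snd z))"
    "\<And>t x. t \<in> {0..1} \<Longrightarrow> x \<in> S3 \<Longrightarrow> h t x \<in> GL6"
    "\<And>x. h 0 x = f x" "\<And>x. h 1 x = g x"
    by (rule homotopic_canonE[OF hom], rule that, assumption+)
  define F where "F z = det (h (fst z) (snd z))" for z
  have "F (1, x) > 0"
  proof (rule pos_on_connected[OF connected_01_S3])
    show "continuous_on ({0..1} \<times> S3) F"
      unfolding F_def by (intro continuous_intros h(1))
    show "F (0, a) > 0"
      using x by (simp add: F_def h)
  qed (use h x in \<open>auto simp: F_def\<close>)
  then show ?thesis by (simp add: F_def h)
qed

text \<open>Both completions are deformed to the conormal one, which depends on the two-frame alone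
  and therefore follows the given homotopy of two-frames. The two signs agree because both
  determinants are positive at the base point: one side starts from
  \<open>tau (mat 1) = mat 1\<close>, the other from \<open>pos\<close>.\<close>

lemma tau_homotopic_frame6:
  assumes f: "continuous_on S3 f" "f ` S3 \<subseteq> U3" "f S3_base = mat 1"
    and A: "continuous_on S3 A"
    and hom: "freely_homotopic S3 V2C3 (frame_of \<circ> f) A"
    and pq: "continuous_on S3 p" "continuous_on S3 q"
    and pos: "\<And>x. x \<in> S3 \<Longrightarrow> det (frame6 ((*v) (A x)) (p x) (q x)) > 0"
  shows "freely_homotopic S3 GL6 (\<lambda>x. tau (f x)) (\<lambda>x. frame6 ((*v) (A x)) (p x) (q x))"
proof -
  have AV: "A x \<in> V2C3" if "x \<in> S3" for x
    using homotopic_with_imp_subset2[OF hom] that by auto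
  have fU: "f x \<in> U3" if "x \<in> S3" for x using f that by auto
  have tnz: "det (tau (f x)) \<noteq> 0" if "x \<in> S3" for x
    using det_orthogonal_matrix[OF tau_U3_orthogonal[OF fU[OF that]]] by auto
  obtain \<sigma> :: real where \<sigma>: "\<sigma> = 1 \<or> \<sigma> = - 1"
    "freely_homotopic S3 GL6 (\<lambda>x. tau (f x))
       (\<lambda>x. frame6 ((*v) (frame_of (f x))) (conormal (frame_of (f x))) ((of_real \<sigma> * \<i>) *s conormal (frame_of (f x))))"
  proof (rule frame6_conormal_homotopic[of "\<lambda>x. frame_of (f x)" "\<lambda>x. column 3 (f x)" "\<lambda>x. \<i> *s column 3 (f x)"])
    show "continuous_on S3 (\<lambda>x. frame_of (f x))" "continuous_on S3 (\<lambda>x. column 3 (f x))" "continuous_on S3 (\<lambda>x. \<i> *s column 3 (f x))"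
      by (intro continuous_intros f)+
    show "frame_of (f x) \<in> V2C3" if "x \<in> S3" for x
      by (intro frame_of_V2C3 U3_det fU that)
    show "det (frame6 ((*v) (frame_of (f x))) (column 3 (f x)) (\<i> *s column 3 (f x))) \<noteq> 0" if "x \<in> S3" for x
      using tnz[OF that] by (simp add: tau_eq_frame6)
  qed (rule that, assumption, simp add: tau_eq_frame6)
  have ns: "frame6 ((*v) B) (conormal B) ((of_real \<sigma> * \<i>) *s conormal B) \<in> GL6" if B: "B \<in> V2C3" for B
    unfolding mem_Collect_eq frame6_nonsingular[OF linear_cmatrix]
  proof (intro allI impI)
    fix v a b assume 0: "B *v v + a *\<^sub>R conormal B + b *\<^sub>R ((of_real \<sigma> * \<i>) *s conormal B) = 0"
    have "herm (B *v v + a *\<^sub>R conormal B + b *\<^sub>R ((of_real \<sigma> * \<i>) *s conormal B)) (conormal B) = 0"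
      unfolding 0 by simp
    then have "(of_real a + of_real b * (of_real \<sigma> * \<i>)) * herm (conormal B) (conormal B) = 0"
      by (simp add: herm_add_left herm_scaleR_left herm_scale_left herm_conormal algebra_simps)
    then have "of_real a + of_real b * (of_real \<sigma> * \<i>) = 0"
      using conormal_nonzero[OF B] by (simp add: herm_self)
    then have "a = 0" "b = 0" using \<sigma>(1) by (auto simp: complex_eq_iff)
    then show "v = 0 \<and> a = 0 \<and> b = 0" using 0 B by (auto simp: V2C3_iff)
  qed
  have "freely_homotopic S3 GL6 ((\<lambda>B. frame6 ((*v) B) (conormal B) ((of_real \<sigma> * \<i>) *s conormal B)) \<circ> (frame_of \<circ> f))
       ((\<lambda>B. frame6 ((*v) B) (conormal B) ((of_real \<sigma> * \<i>) *s conormal B)) \<circ> A)"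
    by (rule homotopic_with_compose_continuous_left[OF hom]) (use ns in \<open>auto intro!: continuous_intros\<close>)
  then have 1: "freely_homotopic S3 GL6 (\<lambda>x. tau (f x))
       (\<lambda>x. frame6 ((*v) (A x)) (conormal (A x)) ((of_real \<sigma> * \<i>) *s conormal (A x)))"
    using homotopic_with_trans[OF \<sigma>(2)] by (simp add: o_def)
  obtain \<sigma>' :: real where \<sigma>': "\<sigma>' = 1 \<or> \<sigma>' = - 1"
    "freely_homotopic S3 GL6 (\<lambda>x. frame6 ((*v) (A x)) (p x) (q x))
       (\<lambda>x. frame6 ((*v) (A x)) (conormal (A x)) ((of_real \<sigma>' * \<i>) *s conormal (A x)))"
    by (rule frame6_conormal_homotopic[OF A AV pq]) (use pos in force)+
  have "det (frame6 ((*v) (A S3_base)) (conormal (A S3_base)) ((of_real \<sigma> * \<i>) *s conormal (A S3_base))) > 0"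
    using homotopic_det_pos[OF 1 S3_base_in _ S3_base_in] by (simp add: f(3) tau_mat_1)
  moreover have "det (frame6 ((*v) (A S3_base)) (conormal (A S3_base)) ((of_real \<sigma>' * \<i>) *s conormal (A S3_base))) > 0"
    using homotopic_det_pos[OF \<sigma>'(2) S3_base_in pos S3_base_in] S3_base_in by simp
  ultimately have "\<sigma> = \<sigma>'"
    using \<sigma>(1) \<sigma>'(1) frame6_minus_last[of "(*v) (A S3_base)" "conormal (A S3_base)" "\<i> *s conormal (A S3_base)"]
    by (auto simp: vec.scale_minus_left)
  then show ?thesis
    using homotopic_with_trans[OF 1 homotopic_with_symD[OF \<sigma>'(2)[folded \<open>\<sigma> = \<sigma>'\<close>]]] by simp
qed

section \<open>Holomorphic maps of two variables\<close>

lemma cmatrix_vec_scale: "A *v (c *s w) = c *s (A *v w)" for A :: "complex^'n^'m"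
  by (simp add: vec_eq_iff matrix_vector_mult_def sum_distrib_left algebra_simps)

text \<open>Pointwise complex differentiability is all that a holomorphic germ provides. Continuity
  of the Jacobian and second order expansions are derived by restriction to complex lines.\<close>

locale holomorphic_map =
  fixes \<Phi> :: "complex^2 \<Rightarrow> complex^3" and U :: "(complex^2) set"
  assumes open_U: "open U"
    and complex_derivative: "\<And>z. z \<in> U \<Longrightarrow> \<exists>D. (\<Phi> has_derivative D) (at z) \<and> (\<forall>c v. D (c *s v) = c *s D v)"
begin

abbreviation J where "J \<equiv> complex_jacobian \<Phi>"

lemma has_derivative_jacobian:
  assumes "z \<in> U"
  shows "(\<Phi> has_derivative (\<lambda>v. J z *v v)) (at z)"
proof -
  obtain D where D: "(\<Phi> has_derivative D) (at z)" "\<And>c v. D (c *s v) = c *s D v"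
    using complex_derivative[OF assms] by blast
  have fD: "frechet_derivative \<Phi> (at z) = D"
    using D(1) by (rule frechet_derivative_at[symmetric])
  have "D v = J z *v v" for v
  proof -
    have "v = v $ 1 *s axis 1 1 + v $ 2 *s axis 2 1"
      by (simp add: vec_eq_iff forall_2 axis_def)
    then have "D v = v $ 1 *s D (axis 1 1) + v $ 2 *s D (axis 2 1)"
      using D(2) linear_add[OF has_derivative_linear[OF D(1)]] by metis
    then show ?thesis
      by (simp add: vec_eq_iff matrix_vector_mult_def sum_2 complex_jacobian_def fD mult.commute)
  qed
  then have "D = (\<lambda>v. J z *v v)" by auto
  with D(1) show ?thesis by simp
qed

lemma continuous_on_map: "continuous_on U \<Phi>"
  using has_derivative_continuous[OF has_derivative_jacobian] continuous_at_imp_continuous_on by blast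

lemma open_slice: "open {c. z + c *s w \<in> U}"
proof -
  have "continuous_on UNIV (\<lambda>c. z + c *s w)"
    by (intro continuous_intros)
  from open_vimage[OF open_U this] show ?thesis by (simp add: vimage_def)
qed

lemma slice_has_derivative:
  assumes "z + c *s w \<in> U"
  shows "((\<lambda>c. \<Phi> (z + c *s w) $ i) has_field_derivative (J (z + c *s w) *v w) $ i) (at c)"
proof -
  have "((\<lambda>c. z + c *s w) has_derivative (\<lambda>h. h *s w)) (at c)"
  proof -
    have lin: "bounded_linear (\<lambda>h::complex. h *s w)"
      by (rule linear_conv_bounded_linear[THEN iffD1], rule linearI)
         (simp_all add: vec_eq_iff algebra_simps)
    show ?thesis
      using bounded_linear_imp_has_derivative[OF lin, of "at c"] by (auto intro!: derivative_eq_intros)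
  qed
  from has_derivative_compose[OF this has_derivative_jacobian[OF assms]]
  have "((\<lambda>c. \<Phi> (z + c *s w)) has_derivative (\<lambda>h. J (z + c *s w) *v (h *s w))) (at c)"
    by simp
  then have "((\<lambda>c. \<Phi> (z + c *s w) $ i) has_derivative (\<lambda>h. (J (z + c *s w) *v (h *s w)) $ i)) (at c)"
    by (rule bounded_linear.has_derivative[OF bounded_linear_vec_nth])
  moreover have "(J (z + c *s w) *v (h *s w)) $ i = (J (z + c *s w) *v w) $ i * h" for h
    by (simp add: matrix_vector_mult_def sum_2 algebra_simps)
  ultimately show ?thesis
    by (simp add: has_field_derivative_def)
qed

lemma slice_holomorphic: "(\<lambda>c. \<Phi> (z + c *s w) $ i) holomorphic_on {c. z + c *s w \<in> U}"
  using slice_has_derivative by (subst holomorphic_on_open[OF open_slice]) blast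

lemma slice_deriv: "z \<in> U \<Longrightarrow> deriv (\<lambda>c. \<Phi> (z + c *s w) $ i) 0 = (J z *v w) $ i"
  using slice_has_derivative[of z 0 w i] by (simp add: DERIV_imp_deriv)

text \<open>Cauchy's inequality on slices bounds the oscillation of the Jacobian by that of the map.\<close>

lemma continuous_on_jacobian: "continuous_on U J"
proof -
  have "continuous_on U (\<lambda>z. J z $ i $ j)" for i j
  proof (rule continuous_at_imp_continuous_on, rule ballI)
    fix z0 assume z0: "z0 \<in> U"
    \<comment> \<open>The radius 2d leaves room for a disc of radius d about every centre within
      distance d of \<open>z0\<close>.\<close>
    then obtain d where d: "d > 0" "cball z0 (2 * d) \<subseteq> U"
      using open_U open_contains_cball[of U] by (metis field_sum_of_halves mult_2 half_gt_zero)
    have uc: "uniformly_continuous_on (cball z0 (2 * d)) \<Phi>"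
      using continuous_on_subset[OF continuous_on_map d(2)] by (intro compact_uniformly_continuous) auto
    have ax: "norm (axis j 1 :: complex^2) = 1" by simp
    have in_ball: "z + c *s axis j 1 \<in> cball z0 (2 * d)" if "z \<in> cball z0 d" "cmod c \<le> d" for z c
    proof -
      have "norm (z0 - (z + c *s axis j 1)) \<le> norm (z0 - z) + norm (c *s axis j 1)"
        by (metis diff_diff_eq norm_triangle_ineq4)
      then show ?thesis using that by (simp add: dist_norm norm_cscale)
    qed
    show "isCont (\<lambda>z. J z $ i $ j) z0"
      unfolding continuous_at_eps_delta
    proof (intro allI impI)
      fix e :: real assume e: "e > 0"
      obtain r where r: "r > 0" "\<And>x y. x \<in> cball z0 (2 * d) \<Longrightarrow> y \<in> cball z0 (2 * d) \<Longrightarrow> dist y x < r \<Longrightarrow> dist (\<Phi> y) (\<Phi> x) < e * d / 2"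
        using uc[unfolded uniformly_continuous_on_def, rule_format, of "e * d / 2"] e d(1) by auto
      show "\<exists>r>0. \<forall>z. dist z z0 < r \<longrightarrow> dist (J z $ i $ j) (J z0 $ i $ j) < e"
      proof (intro exI[of _ "min r d"] conjI allI impI)
        fix z assume z: "dist z z0 < min r d"
        have zU: "z \<in> U" "z \<in> cball z0 d" "z0 \<in> cball z0 d" using z d by (auto simp: dist_commute)
        \<comment> \<open>The derivative of \<open>F\<close> at 0 is the difference of the two
          Jacobian entries, while uniform continuity bounds \<open>F\<close> on the circle of radius
          d by ed/2.\<close>
        define F where "F c = \<Phi> (z + c *s axis j 1) $ i - \<Phi> (z0 + c *s axis j 1) $ i" for c
        have sub: "z + c *s axis j 1 \<in> U" "z0 + c *s axis j 1 \<in> U" if "c \<in> cball 0 d" for c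
          using in_ball[OF zU(2), of c] in_ball[OF zU(3), of c] d(2) that by auto
        have hol: "F holomorphic_on cball 0 d"
          unfolding F_def
          by (intro holomorphic_on_diff holomorphic_on_subset[OF slice_holomorphic]) (use sub in auto)
        have bd: "cmod (F c) \<le> e * d / 2" if "cmod (0 - c) = d" for c
        proof -
          have "dist (\<Phi> (z + c *s axis j 1)) (\<Phi> (z0 + c *s axis j 1)) < e * d / 2"
            using in_ball[OF zU(2), of c] in_ball[OF zU(3), of c] that z by (intro r(2)) (auto simp: dist_norm)
          moreover have "cmod (F c) \<le> norm (\<Phi> (z + c *s axis j 1) - \<Phi> (z0 + c *s axis j 1))"
            using Finite_Cartesian_Product.norm_nth_le[of "\<Phi> (z + c *s axis j 1) - \<Phi> (z0 + c *s axis j 1)" i] by (simp add: F_def)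
          ultimately show ?thesis by (simp add: dist_norm)
        qed
        have "cmod ((deriv ^^ 1) F 0) \<le> fact 1 * (e * d / 2) / d ^ 1"
        proof (rule Cauchy_inequality[OF _ _ d(1) bd])
          show "F holomorphic_on ball 0 d" by (rule holomorphic_on_subset[OF hol]) auto
          show "continuous_on (cball 0 d) F" by (rule holomorphic_on_imp_continuous_on[OF hol])
        qed
        then have "cmod (deriv F 0) \<le> e / 2" using d(1) by simp
        moreover have "deriv F 0 = J z $ i $ j - J z0 $ i $ j"
        proof -
          have "(F has_field_derivative (J z *v axis j 1) $ i - (J z0 *v axis j 1) $ i) (at 0)"
            unfolding F_def using slice_has_derivative[of z 0 "axis j 1" i] slice_has_derivative[of z0 0 "axis j 1" i] zU z0
            by (intro DERIV_diff) auto
          then show ?thesis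
            by (simp add: DERIV_imp_deriv matrix_vector_mult_def axis_def if_distrib cong: if_cong)
        qed
        ultimately show "dist (J z $ i $ j) (J z0 $ i $ j) < e" using e by (simp add: dist_norm)
      qed (use r d in auto)
    qed
  qed
  then have "continuous_on U (\<lambda>z. \<chi> i j. J z $ i $ j)"
    by (intro continuous_on_vec_lambda)
  then show ?thesis by simp
qed

text \<open>A maximum principle for a vector valued map: pairing with the fixed vector \<Phi>(p)
  gives a scalar holomorphic function on a complex line through p, whose value at p has modulus
  |\<Phi>(p)|^2 and which is bounded by \<epsilon>|\<Phi>(p)| where the line leaves the
  component.\<close>

lemma norm_le_on_bounded_component:
  assumes K: "compact K" "K \<subseteq> ball 0 \<delta>" "ball 0 \<delta> \<subseteq> U" and p: "p \<notin> K"
    and bd: "bounded (connected_component_set (- K) p)" and le: "\<And>z. z \<in> K \<Longrightarrow> norm (\<Phi> z) \<le> \<epsilon>"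
  shows "norm (\<Phi> p) \<le> \<epsilon>"
proof (cases "\<Phi> p = 0 \<or> K = {}")
  case True
  show ?thesis
  proof (cases "K = {}")
    case True
    then show ?thesis using bd by (simp add: connected_component_UNIV)
  next
    case False
    then obtain z where "z \<in> K" by auto
    have "0 \<le> norm (\<Phi> z)" by simp
    also have "\<dots> \<le> \<epsilon>" by (rule le[OF \<open>z \<in> K\<close>])
    finally show ?thesis using True False by simp
  qed
next
  case False
  define C where "C = connected_component_set (- K) p"
  have oC: "open C" unfolding C_def using K(1) by (intro open_connected_component) (simp add: compact_imp_closed open_Compl)
  have pC: "p \<in> C" using p by (simp add: C_def)
  \<comment> \<open>The complement of the ball is connected, unbounded and disjoint from
    \<open>K\<close>; if it met \<open>C\<close>, it would be contained in the bounded set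
    \<open>C\<close>.\<close>
  have Cb: "C \<subseteq> ball 0 \<delta>"
  proof
    fix x assume x: "x \<in> C"
    show "x \<in> ball 0 \<delta>"
    proof (rule ccontr)
      assume nx: "x \<notin> ball 0 \<delta>"
      have "connected (- ball (0::complex^2) \<delta>)"
        by (rule connected_complement_bounded_convex) auto
      moreover have "- ball 0 \<delta> \<subseteq> - K" "x \<in> - ball 0 \<delta>" using K(2) nx by auto
      ultimately have "- ball 0 \<delta> \<subseteq> connected_component_set (- K) x"
        by (intro connected_component_maximal)
      also have "connected_component_set (- K) x = C"
        using x unfolding C_def by (metis connected_component_eq)
      finally have "bounded (- ball (0::complex^2) \<delta>)" using bd C_def bounded_subset by blast
      then have "bounded (- ball (0::complex^2) \<delta> \<union> ball 0 \<delta>)"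
        using bounded_ball[of "0::complex^2" \<delta>] by (simp only: bounded_Un simp_thms)
      moreover have "- ball (0::complex^2) \<delta> \<union> ball 0 \<delta> = UNIV" by blast
      ultimately show False using not_bounded_UNIV[where 'a = "complex^2"] by simp
    qed
  qed
  \<comment> \<open>Components of the open set -K are open, so a limit point of \<open>C\<close>
    outside \<open>K\<close> has its own component meeting \<open>C\<close>.\<close>
  have clC: "closure C \<subseteq> C \<union> K"
  proof
    fix x assume x: "x \<in> closure C"
    show "x \<in> C \<union> K"
    proof (rule ccontr)
      assume nx: "x \<notin> C \<union> K"
      define D where "D = connected_component_set (- K) x"
      have "open D" unfolding D_def using K(1) by (intro open_connected_component) (simp add: compact_imp_closed open_Compl)
      moreover have "x \<in> D" using nx by (simp add: D_def)
      ultimately obtain y where "y \<in> C" "y \<in> D"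
        using x by (metis IntE closure_iff_nhds_not_empty open_subset_interior disjoint_iff order_refl)
      then have "C = D" unfolding C_def D_def by (metis connected_component_eq)
      then show False using nx \<open>x \<in> D\<close> by auto
    qed
  qed
  \<comment> \<open>The slice of the component by the complex line through p in the first coordinate
    direction; any other direction would serve equally well.\<close>
  define S where "S = {c. p + c *s axis 1 1 \<in> C}"
  have cont: "continuous_on UNIV (\<lambda>c. p + c *s (axis 1 1 :: complex^2))" by (intro continuous_intros)
  have oS: "open S" using open_vimage[OF oC cont] by (simp add: S_def vimage_def)
  have clS: "p + c *s axis 1 1 \<in> C \<union> K" if "c \<in> closure S" for c
  proof -
    have "closed {c. p + c *s axis 1 1 \<in> closure C}"
      using closed_vimage[OF closed_closure[of C] cont] by (simp add: vimage_def)
    then have "closure S \<subseteq> {c. p + c *s axis 1 1 \<in> closure C}"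
      by (intro closure_minimal) (auto simp: S_def closure_subset[THEN subsetD])
    then show ?thesis using that clC by auto
  qed
  define h where "h c = (\<Sum>i\<in>UNIV. cnj (\<Phi> p $ i) * \<Phi> (p + c *s axis 1 1) $ i)" for c
  have h_eq: "h c = herm (\<Phi> (p + c *s axis 1 1)) (\<Phi> p)" for c
    by (simp add: h_def herm_def mult.commute)
  have hol: "h holomorphic_on {c. p + c *s axis 1 1 \<in> U}"
    unfolding h_def by (intro holomorphic_intros slice_holomorphic)
  have CK_U: "C \<union> K \<subseteq> U" using Cb K by auto
  have herm_CS: "cmod (herm u v) \<le> norm u * norm v" for u v :: "complex^3"
  proof -
    have "cmod (herm u v) \<le> (\<Sum>i\<in>UNIV. cmod (u $ i) * cmod (v $ i))"
      unfolding herm_def by (rule order_trans[OF norm_sum]) (simp add: norm_mult)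
    also have "\<dots> \<le> norm u * norm v"
      unfolding norm_vec_def using L2_set_mult_ineq[of "\<lambda>i. cmod (u $ i)" "\<lambda>i. cmod (v $ i)" UNIV] by simp
    finally show ?thesis .
  qed
  have "cmod (h 0) \<le> \<epsilon> * norm (\<Phi> p)"
  proof (rule maximum_modulus_frontier[of h S])
    show "h holomorphic_on interior S"
      using CK_U interior_subset[of S] by (intro holomorphic_on_subset[OF hol]) (auto simp: S_def)
    show "continuous_on (closure S) h"
      using CK_U clS by (intro continuous_on_subset[OF holomorphic_on_imp_continuous_on[OF hol]]) auto
    show "bounded S"
    proof -
      have "S \<subseteq> cball 0 (\<delta> + norm p)"
      proof
        fix c assume "c \<in> S"
        then have "norm (p + c *s axis 1 1) < \<delta>" using Cb by (auto simp: S_def)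
        moreover have "norm (c *s axis 1 1 :: complex^2) \<le> norm (p + c *s axis 1 1) + norm p"
          by (metis add_diff_cancel_left' norm_triangle_ineq4)
        ultimately show "c \<in> cball 0 (\<delta> + norm p)" by (simp add: norm_cscale)
      qed
      then show ?thesis using bounded_cball bounded_subset by blast
    qed
    show "0 \<in> S" using pC by (simp add: S_def)
    fix c assume "c \<in> frontier S"
    then have "c \<in> closure S" "c \<notin> S" using oS by (auto simp: frontier_def interior_open)
    then have "p + c *s axis 1 1 \<in> K" using clS by (auto simp: S_def)
    then have "norm (\<Phi> (p + c *s axis 1 1)) * norm (\<Phi> p) \<le> \<epsilon> * norm (\<Phi> p)"
      using le by (intro mult_right_mono) auto
    then show "cmod (h c) \<le> \<epsilon> * norm (\<Phi> p)"
      unfolding h_eq using herm_CS order_trans by blast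
  qed
  moreover have "cmod (h 0) = norm (\<Phi> p) * norm (\<Phi> p)"
    by (simp add: h_eq herm_self norm_power power2_eq_square norm_mult)
  ultimately show ?thesis using False by simp
qed

section \<open>Gradient and Levi form of |\<Phi>|^2\<close>

lemma has_derivative_norm_square:
  assumes "y \<in> U"
  shows "((\<lambda>y. (norm (\<Phi> y))\<^sup>2) has_derivative (\<lambda>v. 2 * ((J y *v v) \<bullet> \<Phi> y))) (at y)"
  unfolding power2_norm_eq_inner
  by (rule derivative_eq_intros has_derivative_jacobian[OF assms] refl | simp add: inner_commute)+

text \<open>The derivative of |\<Phi>|^2 is continuous and vanishes at z, so it is a small Lipschitz
  constant nearby. This makes harmless the replacement of a point on a tangent line by a point of
  the link at distance O(s^2): the value changes by o(s^2) only.\<close>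

lemma norm_square_flat_at_critical_point:
  assumes z: "z \<in> U" and crit: "\<And>v. (J z *v v) \<bullet> \<Phi> z = 0" and "\<eta> > 0"
  obtains r where "r > 0" "ball z r \<subseteq> U"
    "\<And>p q. p \<in> ball z r \<Longrightarrow> q \<in> ball z r \<Longrightarrow> \<bar>(norm (\<Phi> p))\<^sup>2 - (norm (\<Phi> q))\<^sup>2\<bar> \<le> \<eta> * norm (p - q)"
proof -
  \<comment> \<open>A continuous bound for the norm of the derivative at \<open>y\<close>. It
    vanishes at z because criticality in the directions v and \<i> v kills both real and imaginary
    parts of the Hermitian products.\<close>
  define k where "k y = 2 * (cmod (herm (column 1 (J y)) (\<Phi> y)) + cmod (herm (column 2 (J y)) (\<Phi> y)))" for y
  have ck: "continuous_on U k"
    unfolding k_def by (intro continuous_intros continuous_on_jacobian continuous_on_map)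
  have h0: "herm (column j (J z)) (\<Phi> z) = 0" for j
  proof -
    have e: "J z *v (c *s axis j 1) = c *s column j (J z)" for c
      by (simp add: vec_eq_iff matrix_vector_mult_def column_def axis_def if_distrib cong: if_cong)
    have "Re (herm (column j (J z)) (\<Phi> z)) = 0"
      using crit[of "1 *s axis j 1"] unfolding e inner_eq_Re_herm by simp
    moreover have "Im (herm (column j (J z)) (\<Phi> z)) = 0"
      using crit[of "\<i> *s axis j 1"] unfolding e inner_eq_Re_herm herm_scale_left by simp
    ultimately show ?thesis by (simp add: complex_eq_iff)
  qed
  have "k z = 0" by (simp add: k_def h0)
  then have "\<exists>r>0. ball z r \<subseteq> U \<and> (\<forall>y\<in>ball z r. k y \<le> \<eta>)"
  proof -
    have "open (U \<inter> k -` {..<\<eta>})"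
      using continuous_open_preimage[OF ck open_U, of "{..<\<eta>}"] by simp
    moreover have "z \<in> U \<inter> k -` {..<\<eta>}" using z \<open>k z = 0\<close> \<open>\<eta> > 0\<close> by simp
    ultimately obtain r where "r > 0" "ball z r \<subseteq> U \<inter> k -` {..<\<eta>}"
      using open_contains_ball by blast
    then show ?thesis by (intro exI[of _ r]) force
  qed
  then obtain r where r: "r > 0" "ball z r \<subseteq> U" "\<And>y. y \<in> ball z r \<Longrightarrow> k y \<le> \<eta>" by blast
  have "norm ((norm (\<Phi> p))\<^sup>2 - (norm (\<Phi> q))\<^sup>2) \<le> \<eta> * norm (p - q)" if pq: "p \<in> ball z r" "q \<in> ball z r" for p q
  proof (rule differentiable_bound[OF convex_ball[of z r] _ _ pq])
    fix y assume y: "y \<in> ball z r"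
    show "((\<lambda>y. (norm (\<Phi> y))\<^sup>2) has_derivative (\<lambda>v. 2 * ((J y *v v) \<bullet> \<Phi> y))) (at y within ball z r)"
      using r(2) y by (intro has_derivative_at_withinI[OF has_derivative_norm_square]) auto
    show "onorm (\<lambda>v. 2 * ((J y *v v) \<bullet> \<Phi> y)) \<le> \<eta>"
    proof (rule onorm_le)
      fix v
      have "norm (2 * ((J y *v v) \<bullet> \<Phi> y)) \<le> 2 * cmod (herm (J y *v v) (\<Phi> y))"
        unfolding inner_eq_Re_herm using abs_Re_le_cmod[of "herm (J y *v v) (\<Phi> y)"] by (simp add: abs_mult)
      also have "\<dots> = 2 * cmod (v $ 1 * herm (column 1 (J y)) (\<Phi> y) + v $ 2 * herm (column 2 (J y)) (\<Phi> y))"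
        by (simp add: mult_vec_2 herm_add_left herm_scale_left)
      also have "\<dots> \<le> 2 * (norm v * cmod (herm (column 1 (J y)) (\<Phi> y)) + norm v * cmod (herm (column 2 (J y)) (\<Phi> y)))"
        using Finite_Cartesian_Product.norm_nth_le[of v] by (intro mult_left_mono order_trans[OF norm_triangle_ineq] add_mono) (auto simp: norm_mult intro!: mult_right_mono)
      also have "\<dots> = k y * norm v" by (simp add: k_def algebra_simps)
      also have "\<dots> \<le> \<eta> * norm v" using r(3)[OF y] by (intro mult_right_mono) auto
      finally show "norm (2 * ((J y *v v) \<bullet> \<Phi> y)) \<le> \<eta> * norm v" .
    qed
  qed
  then show ?thesis using that[OF r(1,2)] by simp
qed

text \<open>The difference quotient of a slice, completed by the derivative at 0, is again
  holomorphic. Its own difference quotient is the remainder \<open>c\<close>, which therefore has a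
  limit at 0.\<close>

lemma slice_second_order:
  assumes z: "z \<in> U"
  obtains c where "\<And>s. s \<noteq> 0 \<Longrightarrow> \<Phi> (z + s *s w) = \<Phi> z + s *s (J z *v w) + s\<^sup>2 *s c s" "\<exists>l. (c \<longlongrightarrow> l) (at 0)"
proof -
  define c where "c s = (\<chi> i. (\<Phi> (z + s *s w) $ i - \<Phi> z $ i - s * (J z *v w) $ i) / s\<^sup>2)" for s
  have "\<Phi> (z + s *s w) = \<Phi> z + s *s (J z *v w) + s\<^sup>2 *s c s" if "s \<noteq> 0" for s
    using that by (simp add: vec_eq_iff c_def)
  moreover have "\<exists>l. ((\<lambda>s. c s $ i) \<longlongrightarrow> l) (at 0)" for i
  proof -
    let ?S = "{c. z + c *s w \<in> U}" and ?f = "\<lambda>c. \<Phi> (z + c *s w) $ i"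
    define g where "g s = (if s = 0 then deriv ?f 0 else (?f s - ?f 0) / (s - 0))" for s
    have S: "open ?S" "0 \<in> ?S" using open_slice z by auto
    have "g holomorphic_on ?S"
      unfolding g_def by (rule pole_lemma_open[OF slice_holomorphic S(1)])
    then have "(g has_field_derivative deriv g 0) (at 0)"
      using S holomorphic_derivI by blast
    then have t1: "((\<lambda>s. (g s - g 0) / (s - 0)) \<longlongrightarrow> deriv g 0) (at 0)"
      by (simp add: has_field_derivative_iff)
    have t2: "\<forall>\<^sub>F s in at 0. (g s - g 0) / (s - 0) = c s $ i"
      by (rule eventually_at_filter[THEN iffD2, OF always_eventually])
         (use slice_deriv[OF z, of w i] in \<open>auto simp: g_def c_def field_simps power2_eq_square\<close>)
    show ?thesis
      by (rule exI, rule Lim_transform_eventually[OF t1 t2])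
  qed
  then obtain l where "\<And>i. ((\<lambda>s. c s $ i) \<longlongrightarrow> l i) (at 0)" by metis
  then have "(c \<longlongrightarrow> (\<chi> i. l i)) (at 0)" by (intro vec_tendstoI) simp
  ultimately show ?thesis using that by blast
qed

text \<open>The second derivatives in the directions \<open>w\<close> and \<open>\<i> w\<close> add up to the Levi form, because the
  complex Hessian of a holomorphic map is complex bilinear.\<close>

lemma norm_square_levi_form:
  assumes z: "z \<in> U" and crit: "\<And>v. (J z *v v) \<bullet> \<Phi> z = 0"
  shows "((\<lambda>s. ((norm (\<Phi> (z + s *\<^sub>R w)))\<^sup>2 + (norm (\<Phi> (z + s *\<^sub>R (\<i> *s w))))\<^sup>2 - 2 * (norm (\<Phi> z))\<^sup>2) / s\<^sup>2)
    \<longlongrightarrow> 2 * (norm (J z *v w))\<^sup>2) (at (0::real))"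
proof -
  obtain c l where c: "\<And>s. s \<noteq> 0 \<Longrightarrow> \<Phi> (z + s *s w) = \<Phi> z + s *s (J z *v w) + s\<^sup>2 *s c s" "(c \<longlongrightarrow> l) (at 0)"
    using slice_second_order[OF z, of w] by blast
  define a b b' where "a = \<Phi> z" and "b = J z *v w" and "b' = \<i> *s b"
  \<comment> \<open>The direction \<i> w belongs to the same slice, at imaginary parameter. Since
    (s\<i>)^2 = -s^2, its quadratic term has the opposite sign; both remainders tend to the same
    limit, so they cancel against each other.\<close>
  define c1 c2 where "c1 s = c (of_real s)" and "c2 s = c (of_real s * \<i>)" for s :: real
  have of0: "filterlim (\<lambda>s. complex_of_real s) (at 0) (at 0)"
    unfolding filterlim_at by (auto intro!: tendsto_eq_intros simp: eventually_at_filter)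
  have of1: "filterlim (\<lambda>s. complex_of_real s * \<i>) (at 0) (at 0)"
    unfolding filterlim_at by (auto intro!: tendsto_eq_intros simp: eventually_at_filter)
  have lim: "(c1 \<longlongrightarrow> l) (at 0)" "(c2 \<longlongrightarrow> l) (at 0)"
    unfolding c1_def c2_def using filterlim_compose[OF c(2) of0] filterlim_compose[OF c(2) of1] .
  have ab: "b \<bullet> a = 0" "b' \<bullet> a = 0" "norm b' = norm b"
    using crit[of w] crit[of "\<i> *s w"] by (simp_all add: a_def b_def b'_def norm_cscale cmatrix_vec_scale)
  have e1: "\<Phi> (z + s *\<^sub>R w) = a + s *\<^sub>R b + s\<^sup>2 *\<^sub>R c1 s" if "s \<noteq> 0" for s
    using c(1)[of "of_real s"] that by (simp add: scaleR_cvec a_def b_def c1_def)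
  have e2: "\<Phi> (z + s *\<^sub>R (\<i> *s w)) = a + s *\<^sub>R b' - s\<^sup>2 *\<^sub>R c2 s" if "s \<noteq> 0" for s
    using c(1)[of "of_real s * \<i>"] that
    by (simp add: scaleR_cvec a_def b_def b'_def c2_def power_mult_distrib vec_eq_iff mult.assoc)
  have "((\<lambda>s. 2 * (norm b)\<^sup>2 + s\<^sup>2 * ((norm (c1 s))\<^sup>2 + (norm (c2 s))\<^sup>2) + 2 * (a \<bullet> (c1 s - c2 s))
      + 2 * s * (b \<bullet> c1 s) - 2 * s * (b' \<bullet> c2 s)) \<longlongrightarrow>
      2 * (norm b)\<^sup>2 + 0\<^sup>2 * ((norm l)\<^sup>2 + (norm l)\<^sup>2) + 2 * (a \<bullet> (l - l)) + 2 * 0 * (b \<bullet> l) - 2 * 0 * (b' \<bullet> l)) (at 0)"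
    by (intro tendsto_intros lim)
  then have "((\<lambda>s. 2 * (norm b)\<^sup>2 + s\<^sup>2 * ((norm (c1 s))\<^sup>2 + (norm (c2 s))\<^sup>2) + 2 * (a \<bullet> (c1 s - c2 s))
      + 2 * s * (b \<bullet> c1 s) - 2 * s * (b' \<bullet> c2 s)) \<longlongrightarrow> 2 * (norm b)\<^sup>2) (at 0)"
    by simp
  then show ?thesis
    unfolding b_def[symmetric]
  proof (rule Lim_transform_eventually)
    have "2 * (norm b)\<^sup>2 + s\<^sup>2 * ((norm (c1 s))\<^sup>2 + (norm (c2 s))\<^sup>2) + 2 * (a \<bullet> (c1 s - c2 s)) + 2 * s * (b \<bullet> c1 s) - 2 * s * (b' \<bullet> c2 s)
      = ((norm (\<Phi> (z + s *\<^sub>R w)))\<^sup>2 + (norm (\<Phi> (z + s *\<^sub>R (\<i> *s w))))\<^sup>2 - 2 * (norm (\<Phi> z))\<^sup>2) / s\<^sup>2" if "s \<noteq> 0" for s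
    proof -
      have n1: "(norm (a + s *\<^sub>R b + s\<^sup>2 *\<^sub>R c1 s))\<^sup>2 = (norm a)\<^sup>2 + s\<^sup>2 * (norm b)\<^sup>2 + s^4 * (norm (c1 s))\<^sup>2 + 2 * s\<^sup>2 * (a \<bullet> c1 s) + 2 * s^3 * (b \<bullet> c1 s)"
        using ab unfolding power2_norm_eq_inner
        by (simp add: inner_add_left inner_add_right inner_commute algebra_simps power2_eq_square power3_eq_cube power4_eq_xxxx)
      have n2: "(norm (a + s *\<^sub>R b' - s\<^sup>2 *\<^sub>R c2 s))\<^sup>2 = (norm a)\<^sup>2 + s\<^sup>2 * (norm b')\<^sup>2 + s^4 * (norm (c2 s))\<^sup>2 - 2 * s\<^sup>2 * (a \<bullet> c2 s) - 2 * s^3 * (b' \<bullet> c2 s)"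
        using ab unfolding power2_norm_eq_inner
        by (simp add: inner_add_left inner_add_right inner_diff_left inner_diff_right inner_commute algebra_simps power2_eq_square power3_eq_cube power4_eq_xxxx)
      show ?thesis
        unfolding e1[OF that] e2[OF that] n1 n2 a_def[symmetric] using that
        by (simp add: ab(3) field_simps inner_diff_right power2_eq_square power3_eq_cube power4_eq_xxxx)
    qed
    then show "\<forall>\<^sub>F s in at 0. 2 * (norm b)\<^sup>2 + s\<^sup>2 * ((norm (c1 s))\<^sup>2 + (norm (c2 s))\<^sup>2) + 2 * (a \<bullet> (c1 s - c2 s)) + 2 * s * (b \<bullet> c1 s) - 2 * s * (b' \<bullet> c2 s)
      = ((norm (\<Phi> (z + s *\<^sub>R w)))\<^sup>2 + (norm (\<Phi> (z + s *\<^sub>R (\<i> *s w))))\<^sup>2 - 2 * (norm (\<Phi> z))\<^sup>2) / s\<^sup>2"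
      by (simp add: eventually_at_filter)
  qed
qed

end

text \<open>A nonzero kernel vector (c_1, c_2) forces every row to be a multiple of (-c_2, c_1), so
  the row rank is at most 1.\<close>

lemma rank_ge_2_V2C3:
  fixes A :: "complex^2^3"
  assumes "\<not> rank A < 2"
  shows "A \<in> V2C3"
  unfolding V2C3_iff
proof (intro allI impI, rule ccontr)
  fix c assume 0: "A *v c = 0" and "c \<noteq> 0"
  have r: "A $ i $ 1 * c $ 1 + A $ i $ 2 * c $ 2 = 0" for i
    using arg_cong[OF 0, of "\<lambda>v. v $ i"] by (simp add: matrix_vector_mult_def sum_2)
  define u :: "complex^2" where "u = vector [- c $ 2, c $ 1]"
  have "rows A \<subseteq> vec.span {u}"
  proof
    fix x assume "x \<in> rows A"
    then obtain i where x: "x = A $ i" by (auto simp: rows_def row_def)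
    have "\<exists>k. x = k *s u"
    proof (cases "c $ 1 = 0")
      case True
      then have "c $ 2 \<noteq> 0" using \<open>c \<noteq> 0\<close> by (auto simp: vec_eq_iff forall_2)
      then have "x = (- (A $ i $ 1) / c $ 2) *s u"
        using r[of i] True by (simp add: x u_def vec_eq_iff forall_2)
      then show ?thesis by blast
    next
      case False
      then have "x = (A $ i $ 2 / c $ 1) *s u"
        using r[of i] by (simp add: x u_def vec_eq_iff forall_2 field_simps eq_neg_iff_add_eq_0)
      then show ?thesis by blast
    qed
    then show "x \<in> vec.span {u}" by (auto intro: vec.span_scale vec.span_base)
  qed
  then have "vec.dim (rows A) \<le> card {u}"
    by (intro vec.dim_le_card) auto
  then show False using assms by (simp add: row_rank_def_gen)
qed

section \<open>Isotopies of the three-sphere\<close>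

lemma great_circle:
  assumes "norm x = 1" "norm e = 1" "e \<bullet> x = 0"
  shows "norm (cos s *\<^sub>R x + sin s *\<^sub>R e) = 1"
proof -
  have "(norm (cos s *\<^sub>R x + sin s *\<^sub>R e))\<^sup>2 = (cos s)\<^sup>2 * (norm x)\<^sup>2 + (sin s)\<^sup>2 * (norm e)\<^sup>2 + 2 * cos s * sin s * (e \<bullet> x)"
    unfolding power2_norm_eq_inner
    by (simp add: inner_add_left inner_add_right inner_commute algebra_simps power2_eq_square)
  then have "(norm (cos s *\<^sub>R x + sin s *\<^sub>R e))\<^sup>2 = 1"
    using assms by simp
  then show ?thesis
    by (simp add: power2_eq_1_iff) (smt (verit) norm_ge_zero)
qed

lemma great_circle_derivative:
  "((\<lambda>s. cos s *\<^sub>R x + sin s *\<^sub>R e) has_vector_derivative (- sin s *\<^sub>R x + cos s *\<^sub>R e)) (at s)"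
  for x :: "'a::real_normed_vector"
  by (auto intro!: derivative_eq_intros)

text \<open>Every tangent direction is the velocity of a great circle, which stays in the sphere.
  This makes derivatives along \<open>S3\<close> independent of the extension and compares maps that
  agree only on \<open>S3\<close>.\<close>

lemma tangential_derivative_unique:
  fixes f h :: "complex^2 \<Rightarrow> 'b::real_normed_vector"
  assumes f: "(f has_derivative f') (at x)" and h: "(h has_derivative h') (at x)"
    and eq: "\<And>y. y \<in> S3 \<Longrightarrow> f y = h y" and x: "x \<in> S3" and v: "v \<bullet> x = 0"
  shows "f' v = h' v"
proof -
  interpret f': linear f' by (rule has_derivative_linear[OF f])
  interpret h': linear h' by (rule has_derivative_linear[OF h])
  show ?thesis
  proof (cases "v = 0")
    case True
    then show ?thesis by (simp add: f'.zero h'.zero)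
  next
    case False
    define e where "e = inverse (norm v) *\<^sub>R v"
    have e: "norm e = 1" "e \<bullet> x = 0" using False v by (simp_all add: e_def)
    define c where "c s = cos s *\<^sub>R x + sin s *\<^sub>R e" for s
    have c0: "c 0 = x" by (simp add: c_def)
    have cd: "(c has_vector_derivative e) (at 0)"
      using great_circle_derivative[of x e 0] by (simp add: c_def[abs_def])
    have cS: "c s \<in> S3" for s using great_circle[of x e s] x e by (simp add: c_def)
    have "(f \<circ> c has_vector_derivative f' e) (at 0)"
      by (rule vector_derivative_diff_chain_within[OF cd]) (use f c0 has_derivative_at_withinI in auto)
    moreover have "(h \<circ> c has_vector_derivative h' e) (at 0)"
      by (rule vector_derivative_diff_chain_within[OF cd]) (use h c0 has_derivative_at_withinI in auto)
    moreover have "f \<circ> c = h \<circ> c" using eq cS by auto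
    ultimately have "f' e = h' e" using vector_derivative_unique_at by metis
    moreover have "v = norm v *\<^sub>R e" using False by (simp add: e_def)
    ultimately show ?thesis by (metis f'.scale h'.scale)
  qed
qed

text \<open>Quaternionic multiplication by j. It maps x into its Hermitian complement and thereby
  trivialises the tangent bundle of \<open>S3\<close> globally.\<close>

definition jmap :: "complex^2 \<Rightarrow> complex^2" where
  "jmap x = vector [- cnj (x $ 2), cnj (x $ 1)]"

lemma jmap_nth [simp]: "jmap x $ 1 = - cnj (x $ 2)" "jmap x $ 2 = cnj (x $ 1)"
  by (simp_all add: jmap_def)

lemma herm_jmap: "herm x (jmap x) = 0" "herm (jmap x) x = 0" "herm (jmap x) (jmap x) = herm x x"
  by (simp_all add: herm_def sum_2 algebra_simps)

lemma norm_jmap [simp]: "norm (jmap x) = norm x"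
proof -
  have "complex_of_real ((norm (jmap x))\<^sup>2) = of_real ((norm x)\<^sup>2)"
    unfolding herm_self[symmetric] by (rule herm_jmap)
  then have "(norm (jmap x))\<^sup>2 = (norm x)\<^sup>2" by (simp only: of_real_eq_iff)
  then show ?thesis by simp
qed

lemma herm_basis: "herm v x *s x + herm v (jmap x) *s jmap x = herm x x *s v"
  by (simp add: vec_eq_iff forall_2 herm_def sum_2 algebra_simps)

lemma continuous_on_jmap [continuous_intros]:
  assumes "continuous_on S f" shows "continuous_on S (\<lambda>x. jmap (f x))"
proof -
  have "continuous_on S (\<lambda>x. jmap (f x) $ 1)" "continuous_on S (\<lambda>x. jmap (f x) $ 2)"
    unfolding jmap_nth by (intro continuous_intros assms)+
  then have "continuous_on S (\<lambda>x. jmap (f x) $ i)" for i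
    using exhaust_2[of i] by (elim disjE) simp_all
  from continuous_on_vec_lambda[of S "\<lambda>i x. jmap (f x) $ i", OF this] show ?thesis by simp
qed

text \<open>The orthonormal frame \<open>\<i> x, j x, \<i> j x\<close> of the tangent space at \<open>x\<close>; the index \<open>1\<close> is not used.\<close>

definition tframe :: "4 \<Rightarrow> complex^2 \<Rightarrow> complex^2" where
  "tframe i x = (if i = 2 then \<i> *s x else if i = 3 then jmap x else \<i> *s jmap x)"

lemma continuous_on_tframe [continuous_intros]:
  "continuous_on S f \<Longrightarrow> continuous_on S (\<lambda>x. tframe i (f x))"
  unfolding tframe_def by (cases "i = 2"; cases "i = 3") (auto intro!: continuous_intros)

lemma tframe_tangent: "tframe i x \<bullet> x = 0"
  by (simp add: tframe_def inner_eq_Re_herm herm_scale_left herm_jmap herm_self)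

lemma tframe_basis:
  assumes "norm x = 1"
  shows "v = (v \<bullet> x) *\<^sub>R x + (v \<bullet> tframe 2 x) *\<^sub>R tframe 2 x + (v \<bullet> tframe 3 x) *\<^sub>R tframe 3 x + (v \<bullet> tframe 4 x) *\<^sub>R tframe 4 x"
proof -
  have "(v \<bullet> x) *\<^sub>R x + (v \<bullet> tframe 2 x) *\<^sub>R tframe 2 x = herm v x *s x"
    unfolding tframe_def inner_eq_Re_herm scaleR_cvec
    by (simp add: vec_eq_iff herm_scale_right complex_eq_iff algebra_simps)
  moreover have "(v \<bullet> tframe 3 x) *\<^sub>R tframe 3 x + (v \<bullet> tframe 4 x) *\<^sub>R tframe 4 x = herm v (jmap x) *s jmap x"
    unfolding tframe_def inner_eq_Re_herm scaleR_cvec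
    by (simp add: vec_eq_iff herm_scale_right complex_eq_iff algebra_simps)
  ultimately show ?thesis
    using herm_basis[of v x] assms by (simp add: herm_self add.assoc)
qed

lemma tframe_orthonormal:
  assumes "norm x = 1" "i \<in> {2, 3, 4}" "k \<in> {2, 3, 4}"
  shows "tframe i x \<bullet> tframe k x = (if i = k then 1 else 0)"
  using assms by (auto simp: tframe_def inner_eq_Re_herm herm_scale_left herm_scale_right herm_jmap herm_self norm_cscale)

definition to_R4 :: "complex^2 \<Rightarrow> real^4" where
  "to_R4 z = vector [Re (z $ 1), Im (z $ 1), Re (z $ 2), Im (z $ 2)]"

lemma to_R4_nth: "to_R4 z $ 1 = Re (z $ 1)" "to_R4 z $ 2 = Im (z $ 1)" "to_R4 z $ 3 = Re (z $ 2)" "to_R4 z $ 4 = Im (z $ 2)"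
  unfolding to_R4_def vector_def by simp_all

lemma linear_to_R4: "linear to_R4"
  by (rule linearI) (simp_all add: vec_eq_iff forall_4 to_R4_nth)

lemma to_R4_eq_0: "to_R4 z = 0 \<longleftrightarrow> z = 0"
  by (auto simp: vec_eq_iff forall_4 forall_2 to_R4_nth complex_eq_iff)

lemma continuous_on_to_R4 [continuous_intros]:
  "continuous_on S f \<Longrightarrow> continuous_on S (\<lambda>x. to_R4 (f x))"
  by (rule bounded_linear.continuous_on[OF linear_conv_bounded_linear[THEN iffD1, OF linear_to_R4]])

section \<open>Derivatives along an isotopy and a continuous choice of normals\<close>

lemma smooth_differentiable:
  assumes "smooth_on_open W g" "z \<in> W"
  shows "(g has_derivative frechet_derivative g (at z)) (at z)"
proof -
  have "Ck_on (Suc 0) W g" using assms(1) unfolding smooth_on_open_def by blast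
  then show ?thesis using assms(2) by (simp add: frechet_derivative_works)
qed

lemma smooth_derivative_continuous:
  assumes "smooth_on_open W g"
  shows "continuous_on W (\<lambda>z. frechet_derivative g (at z) v)"
proof -
  have "Ck_on (Suc 0) W g" using assms unfolding smooth_on_open_def by blast
  then show ?thesis by simp
qed

lemma smooth_derivative_differentiable:
  assumes "smooth_on_open W g" "z \<in> W"
  shows "(\<lambda>z. frechet_derivative g (at z) v) differentiable (at z)"
proof -
  have "Ck_on (Suc (Suc 0)) W g" using assms(1) unfolding smooth_on_open_def by blast
  then show ?thesis using assms(2) by simp
qed

text \<open>\<open>Ck_on\<close> speaks of derivatives in fixed directions; expanding in an
  orthonormal basis lets the direction move with the point.\<close>

lemma continuous_on_derivative_moving:
  fixes g :: "'a::euclidean_space \<Rightarrow> 'b::real_normed_vector"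
  assumes g: "smooth_on_open W g" and y: "continuous_on S y" "y ` S \<subseteq> W" and v: "continuous_on S v"
  shows "continuous_on S (\<lambda>z. frechet_derivative g (at (y z)) (v z))"
proof -
  have "frechet_derivative g (at (y z)) (v z) = (\<Sum>b\<in>Basis. (v z \<bullet> b) *\<^sub>R frechet_derivative g (at (y z)) b)" if "z \<in> S" for z
  proof -
    have lin: "linear (frechet_derivative g (at (y z)))"
      using smooth_differentiable[OF g] y(2) that by (intro has_derivative_linear) auto
    have "frechet_derivative g (at (y z)) (v z) = frechet_derivative g (at (y z)) (\<Sum>b\<in>Basis. (v z \<bullet> b) *\<^sub>R b)"
      by (simp add: euclidean_representation)
    then show ?thesis by (simp add: linear_sum[OF lin] linear_scale[OF lin])
  qed
  moreover have "continuous_on S (\<lambda>z. \<Sum>b\<in>Basis. (v z \<bullet> b) *\<^sub>R frechet_derivative g (at (y z)) b)"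
    by (intro continuous_intros v continuous_on_compose2[OF smooth_derivative_continuous[OF g] y])
  ultimately show ?thesis
    using continuous_on_cong by (metis (no_types, lifting))
qed

locale sphere_isotopy =
  fixes g :: "real \<times> (complex^2) \<Rightarrow> complex^2" and W :: "(real \<times> (complex^2)) set" and r :: real
  assumes smooth: "smooth_on_open W g" and sub_W: "{0..1} \<times> S3 \<subseteq> W" and r: "r > 0"
    and embedding: "\<And>t. t \<in> {0..1} \<Longrightarrow> S3_embedding (\<lambda>x. g (t, x))"
    and start: "\<And>x. x \<in> S3 \<Longrightarrow> g (0, x) = r *\<^sub>R x"
begin

text \<open>Only the values on vectors tangent to \<open>S3\<close> are determined by the isotopy;
  the radial one depends on the extension \<open>g\<close>.\<close>

definition G where "G t x v = frechet_derivative g (at (t, x)) (0, v)"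

lemma slice_derivative:
  assumes "(t, x) \<in> W"
  shows "((\<lambda>x. g (t, x)) has_derivative G t x) (at x)"
proof -
  have "((\<lambda>x. (t, x)) has_derivative (\<lambda>v. (0, v))) (at x)"
    by (auto intro!: derivative_eq_intros)
  from has_derivative_compose[OF this smooth_differentiable[OF smooth assms]]
  show ?thesis by (simp add: G_def[abs_def])
qed

lemma linear_G: "(t, x) \<in> W \<Longrightarrow> linear (G t x)"
  using slice_derivative by (rule has_derivative_linear)

lemma continuous_on_G:
  assumes "continuous_on S t" "continuous_on S x" "continuous_on S v" "\<And>z. z \<in> S \<Longrightarrow> (t z, x z) \<in> W"
  shows "continuous_on S (\<lambda>z. G (t z) (x z) (v z))"
  unfolding G_def
  by (rule continuous_on_derivative_moving[OF smooth]) (use assms in \<open>auto intro!: continuous_intros\<close>)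

lemma continuous_on_g: "continuous_on W g"
  using has_derivative_continuous[OF smooth_differentiable[OF smooth]] continuous_at_imp_continuous_on by blast

text \<open>The immersion condition for a single stage refers to some other extension
  \<open>g'\<close>; in tangent directions the two derivatives agree.\<close>

lemma G_tangent_nonzero:
  assumes t: "t \<in> {0..1}" and x: "x \<in> S3" and v: "v \<bullet> x = 0" "v \<noteq> 0"
  shows "G t x v \<noteq> 0"
proof -
  obtain W' g' where g': "S3 \<subseteq> W'" "smooth_on_open W' g'" "\<And>x. x \<in> S3 \<Longrightarrow> g' x = g (t, x)"
    "\<And>x v. x \<in> S3 \<Longrightarrow> v \<bullet> x = 0 \<Longrightarrow> v \<noteq> 0 \<Longrightarrow> frechet_derivative g' (at x) v \<noteq> 0"
    using embedding[OF t] unfolding S3_embedding_def S3_immersion_def by blast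
  have "G t x v = frechet_derivative g' (at x) v"
  proof (rule tangential_derivative_unique[OF slice_derivative smooth_differentiable[OF g'(2)] _ x v(1)])
    show "(t, x) \<in> W" "x \<in> W'" using sub_W g'(1) t x by auto
  qed (use g'(3) in auto)
  then show ?thesis using g'(4)[OF x v] by simp
qed

lemma G_start: "x \<in> S3 \<Longrightarrow> v \<bullet> x = 0 \<Longrightarrow> G 0 x v = r *\<^sub>R v"
  by (rule tangential_derivative_unique[where f = "\<lambda>x. g (0, x)" and h = "\<lambda>x. r *\<^sub>R x" and x = x])
     (use sub_W start in \<open>auto intro!: slice_derivative derivative_eq_intros\<close>)

text \<open>The vector representing this linear functional is the cross product, in R^4, of the
  three image vectors of the tangent frame. A global tangent frame makes it continuous without local
  choices.\<close>

definition normal_det :: "real \<Rightarrow> complex^2 \<Rightarrow> complex^2 \<Rightarrow> real" where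
  "normal_det t x w = det (\<chi> i::4. if i = 1 then to_R4 w else to_R4 (G t x (tframe i x)))"

lemma linear_normal_det: "linear (normal_det t x)"
proof (rule linearI)
  fix a b c
  show "normal_det t x (a + b) = normal_det t x a + normal_det t x b"
    unfolding normal_det_def linear_add[OF linear_to_R4] by (rule det_row_add)
  show "normal_det t x (c *\<^sub>R a) = c *\<^sub>R normal_det t x a"
    unfolding normal_det_def linear_scale[OF linear_to_R4] scalar_mult_eq_scaleR[symmetric] det_row_mul by simp
qed

lemma normal_det_tangent:
  assumes t: "t \<in> {0..1}" and x: "x \<in> S3" and v: "v \<bullet> x = 0"
  shows "normal_det t x (G t x v) = 0"
proof -
  interpret G: linear "G t x" using sub_W t x by (intro linear_G) auto
  interpret N: linear "normal_det t x" by (rule linear_normal_det)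
  have 0: "normal_det t x (G t x (tframe i x)) = 0" if "i \<noteq> 1" for i
    unfolding normal_det_def using that by (intro det_identical_rows[of 1 i]) (auto simp: row_def)
  have "v = (v \<bullet> tframe 2 x) *\<^sub>R tframe 2 x + (v \<bullet> tframe 3 x) *\<^sub>R tframe 3 x + (v \<bullet> tframe 4 x) *\<^sub>R tframe 4 x"
    using tframe_basis[of x v] x v by simp
  then have "normal_det t x (G t x v) = normal_det t x (G t x ((v \<bullet> tframe 2 x) *\<^sub>R tframe 2 x + (v \<bullet> tframe 3 x) *\<^sub>R tframe 3 x + (v \<bullet> tframe 4 x) *\<^sub>R tframe 4 x))"
    by simp
  then show ?thesis
    by (simp add: G.add G.scale N.add N.scale 0)
qed

text \<open>Three vectors do not span R^4, and a nonzero vector orthogonal to the images of the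
  tangent frame completes them to a basis.\<close>

lemma normal_det_nonzero:
  assumes t: "t \<in> {0..1}" and x: "x \<in> S3"
  shows "\<exists>w. normal_det t x w \<noteq> 0"
proof -
  interpret G: linear "G t x" using sub_W t x by (intro linear_G) auto
  let ?S = "{G t x (tframe 2 x), G t x (tframe 3 x), G t x (tframe 4 x)}"
  have "dim ?S \<le> card ?S" by (rule dim_le_card') simp
  also have "card ?S \<le> 3" by (rule card_insert_le_m1; simp)+ 
  finally have "dim ?S < DIM(complex^2)" by simp
  then obtain w where w: "w \<noteq> 0" "\<And>y. y \<in> span ?S \<Longrightarrow> orthogonal w y"
    using orthogonal_to_subspace_exists by blast
  have wG: "w \<bullet> G t x (tframe i x) = 0" if "i \<in> {2, 3, 4}" for i
    using w(2)[of "G t x (tframe i x)"] that by (auto simp: orthogonal_def span_base)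
  define M where "M = (\<chi> i::4. if i = 1 then to_R4 w else to_R4 (G t x (tframe i x)))"
  have "det (transpose M) \<noteq> 0"
  proof -
    have "u = 0" if u: "transpose M *v u = 0" for u
    proof -
      have "transpose M *v u = to_R4 (u $ 1 *\<^sub>R w + G t x (u $ 2 *\<^sub>R tframe 2 x + u $ 3 *\<^sub>R tframe 3 x + u $ 4 *\<^sub>R tframe 4 x))"
        by (simp add: vec_eq_iff matrix_vector_mult_def sum_4 transpose_def M_def G.add G.scale
            linear_add[OF linear_to_R4] linear_scale[OF linear_to_R4] mult.commute)
      then have 0: "u $ 1 *\<^sub>R w + G t x (u $ 2 *\<^sub>R tframe 2 x + u $ 3 *\<^sub>R tframe 3 x + u $ 4 *\<^sub>R tframe 4 x) = 0"
        using u by (simp add: to_R4_eq_0)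
      have "w \<bullet> (u $ 1 *\<^sub>R w + G t x (u $ 2 *\<^sub>R tframe 2 x + u $ 3 *\<^sub>R tframe 3 x + u $ 4 *\<^sub>R tframe 4 x)) = u $ 1 * (w \<bullet> w)"
        by (simp add: inner_add_right G.add G.scale wG)
      then have u1: "u $ 1 = 0" unfolding 0 using w(1) by simp
      define v where "v = u $ 2 *\<^sub>R tframe 2 x + u $ 3 *\<^sub>R tframe 3 x + u $ 4 *\<^sub>R tframe 4 x"
      have "v \<bullet> x = 0" by (simp add: v_def inner_add_left tframe_tangent)
      moreover have "G t x v = 0" using 0 u1 by (simp add: v_def)
      ultimately have "v = 0" using G_tangent_nonzero[OF t x] by blast
      have "v \<bullet> tframe 2 x = u $ 2" "v \<bullet> tframe 3 x = u $ 3" "v \<bullet> tframe 4 x = u $ 4"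
        using x by (simp_all add: v_def inner_add_left tframe_orthonormal)
      then have "u $ 2 = 0" "u $ 3 = 0" "u $ 4 = 0" unfolding \<open>v = 0\<close> by simp_all
      with u1 show "u = 0" by (simp add: vec_eq_iff forall_4)
    qed
    then have "\<exists>B. B ** transpose M = mat 1" unfolding matrix_left_invertible_ker by blast
    then show ?thesis by (metis invertible_det_nz invertible_left_inverse)
  qed
  then have "normal_det t x w \<noteq> 0" by (simp add: normal_det_def M_def det_transpose)
  then show ?thesis by blast
qed

text \<open>The cross product is never zero and is orthogonal to the images of tangent vectors. At
  time 0 it is radial, and one global sign turns it outward there; continuity then fixes the side at
  all later times.\<close>

lemma exists_normal:
  obtains \<nu> :: "real \<Rightarrow> complex^2 \<Rightarrow> complex^2" where
    "continuous_on ({0..1} \<times> S3) (\<lambda>z. \<nu> (fst z) (snd z))"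
    "\<And>t x. t \<in> {0..1} \<Longrightarrow> x \<in> S3 \<Longrightarrow> \<nu> t x \<noteq> 0"
    "\<And>t x v. t \<in> {0..1} \<Longrightarrow> x \<in> S3 \<Longrightarrow> v \<bullet> x = 0 \<Longrightarrow> \<nu> t x \<bullet> G t x v = 0"
    "\<And>x. x \<in> S3 \<Longrightarrow> \<exists>a>0. \<nu> 0 x = a *\<^sub>R x"
proof -
  define \<mu> where "\<mu> t x = (\<Sum>b\<in>Basis. normal_det t x b *\<^sub>R b)" for t x
  have \<mu>: "\<mu> t x \<bullet> w = normal_det t x w" for t x w
  proof -
    interpret N: linear "normal_det t x" by (rule linear_normal_det)
    have "normal_det t x w = normal_det t x (\<Sum>b\<in>Basis. (w \<bullet> b) *\<^sub>R b)" by (simp add: euclidean_representation)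
    then have "normal_det t x w = (\<Sum>b\<in>Basis. (w \<bullet> b) * normal_det t x b)" by (simp add: N.sum N.scale)
    moreover have "\<mu> t x \<bullet> w = (\<Sum>b\<in>Basis. normal_det t x b * (b \<bullet> w))" by (simp add: \<mu>_def inner_sum_left)
    ultimately show ?thesis by (simp add: inner_commute mult.commute)
  qed
  have c\<mu>: "continuous_on ({0..1} \<times> S3) (\<lambda>z. \<mu> (fst z) (snd z))"
  proof -
    have "continuous_on ({0..1} \<times> S3) (\<lambda>z. if i = 1 then to_R4 b else to_R4 (G (fst z) (snd z) (tframe i (snd z))))" for i and b
      using sub_W by (cases "i = 1") (auto intro!: continuous_intros continuous_on_G)
    then show ?thesis
      unfolding \<mu>_def normal_det_def by (intro continuous_intros continuous_on_vec_lambda)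
  qed
  have nz: "\<mu> t x \<noteq> 0" if "t \<in> {0..1}" "x \<in> S3" for t x
    using normal_det_nonzero[OF that] \<mu> by (metis inner_zero_left)
  have tan: "\<mu> t x \<bullet> G t x v = 0" if "t \<in> {0..1}" "x \<in> S3" "v \<bullet> x = 0" for t x v
    using normal_det_tangent[OF that] by (simp add: \<mu>)
  have st: "\<mu> 0 x = (\<mu> 0 x \<bullet> x) *\<^sub>R x" if x: "x \<in> S3" for x
  proof -
    have "\<mu> 0 x \<bullet> tframe i x = 0" for i
      using tan[of 0 x "tframe i x"] x r by (simp add: tframe_tangent G_start)
    then show ?thesis using tframe_basis[of x "\<mu> 0 x"] x by simp
  qed
  have nz0: "\<mu> 0 x \<bullet> x \<noteq> 0" if "x \<in> S3" for x
    using st[OF that] nz[of 0 x] that by auto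
  define \<sigma> where "\<sigma> = sgn (\<mu> 0 S3_base \<bullet> S3_base)"
  have \<sigma>: "\<sigma> = 1 \<or> \<sigma> = - 1" using nz0[OF S3_base_in] by (auto simp: \<sigma>_def sgn_if)
  have pos: "\<sigma> * (\<mu> 0 x \<bullet> x) > 0" if "x \<in> S3" for x
  proof (rule pos_on_connected[OF connected_S3 _ _ S3_base_in _ that])
    have "continuous_on S3 (\<lambda>x. \<mu> 0 x)"
      by (rule continuous_on_compose2[OF c\<mu>, of _ "\<lambda>x. (0, x)", simplified]) (auto intro!: continuous_intros)
    then show "continuous_on S3 (\<lambda>x. \<sigma> * (\<mu> 0 x \<bullet> x))" by (intro continuous_intros)
    show "\<sigma> * (\<mu> 0 S3_base \<bullet> S3_base) > 0" using nz0[OF S3_base_in] by (simp add: \<sigma>_def sgn_if)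
  qed (use nz0 \<sigma> in auto)
  show ?thesis
  proof (rule that[of "\<lambda>t x. \<sigma> *\<^sub>R \<mu> t x"])
    show "\<exists>a>0. \<sigma> *\<^sub>R \<mu> 0 x = a *\<^sub>R x" if "x \<in> S3" for x
      using pos[OF that] st[OF that] by (intro exI[of _ "\<sigma> * (\<mu> 0 x \<bullet> x)"]) (metis scaleR_scaleR)
  qed (use c\<mu> nz tan \<sigma> in \<open>auto intro!: continuous_intros\<close>)
qed

end

section \<open>First and second order approximation of the embedded spheres\<close>

context sphere_isotopy begin

lemma W_open: "open W"
  using smooth unfolding smooth_on_open_def by blast

lemma W_in: "t \<in> {0..1} \<Longrightarrow> x \<in> S3 \<Longrightarrow> (t, x) \<in> W"
  using sub_W by auto

text \<open>Compactness of the time interval makes the estimate uniform in t, so that one push-off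
  distance can later serve the whole isotopy.\<close>

lemma uniform_tangent_approximation:
  assumes x0: "x0 \<in> S3" and k: "k > 0"
  obtains d where "d > 0" "\<And>t y. t \<in> {0..1} \<Longrightarrow> norm (y - x0) < d \<Longrightarrow>
    norm (g (t, y) - g (t, x0) - G t x0 (y - x0)) \<le> k * norm (y - x0)"
proof -
  have "compact ({0..1::real} \<times> {x0})" by (intro compact_Times) auto
  moreover have "{0..1} \<times> {x0} \<subseteq> W" using W_in x0 by auto
  ultimately obtain e where e: "e > 0" "(\<Union>z\<in>{0..1} \<times> {x0}. ball z e) \<subseteq> W"
    using compact_subset_open_imp_ball_epsilon_subset W_open by metis
  have inW: "(t, y) \<in> W" if "t \<in> {0..1}" "norm (y - x0) < e" for t y
    using e(2) that by (force simp: dist_Pair_Pair dist_norm norm_minus_commute)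
  define K where "K = {0..1::real} \<times> cball x0 (e / 2)"
  have KW: "(fst z, snd z) \<in> W" "(fst z, x0) \<in> W" if "z \<in> K" for z
    using inW[of "fst z" "snd z"] inW[of "fst z" x0] that e(1) by (auto simp: K_def dist_norm norm_minus_commute)
  \<comment> \<open>Bounds the operator norm of the change of \<open>G\<close> relative to
    \<open>x0\<close> and vanishes there; uniform continuity on a compact set makes it small near
    \<open>x0\<close> for all times at once.\<close>
  define T where "T z = (\<Sum>b\<in>Basis. norm (G (fst z) (snd z) b - G (fst z) x0 b))" for z
  have "continuous_on K T"
    unfolding T_def by (intro continuous_intros continuous_on_G KW)
  then have "uniformly_continuous_on K T"
    unfolding K_def by (intro compact_uniformly_continuous compact_Times) auto
  from this[unfolded uniformly_continuous_on_def, rule_format, OF k]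
  obtain d where d: "d > 0" "\<And>z z'. z \<in> K \<Longrightarrow> z' \<in> K \<Longrightarrow> dist z' z < d \<Longrightarrow> dist (T z') (T z) < k"
    by blast
  define d' where "d' = min d (e / 2)"
  have Tk: "T (t, y) \<le> k" if "t \<in> {0..1}" "norm (y - x0) < d'" for t y
  proof -
    have "dist (T (t, y)) (T (t, x0)) < k"
      using that e(1) by (intro d(2)) (auto simp: K_def d'_def dist_norm norm_minus_commute dist_Pair_Pair)
    then show ?thesis by (simp add: T_def dist_norm)
  qed
  show ?thesis
  proof (rule that[of d'])
    show "d' > 0" using d e by (simp add: d'_def)
    fix t y assume t: "t \<in> {0..1::real}" and y: "norm (y - x0) < d'"
    interpret G0: linear "G t x0" using t x0 by (intro linear_G W_in)
    have "norm ((g (t, y) - G t x0 y) - (g (t, x0) - G t x0 x0)) \<le> k * norm (y - x0)"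
    proof (rule differentiable_bound[OF convex_ball[of x0 d']])
      fix w assume w: "w \<in> ball x0 d'"
      then have wd: "norm (w - x0) < d'" by (simp add: dist_norm norm_minus_commute)
      then have wW: "(t, w) \<in> W" using e(1) t by (intro inW) (auto simp: d'_def)
      show "((\<lambda>y. g (t, y) - G t x0 y) has_derivative (\<lambda>v. G t w v - G t x0 v)) (at w within ball x0 d')"
        by (intro has_derivative_diff has_derivative_at_withinI[OF slice_derivative[OF wW]]
            bounded_linear_imp_has_derivative linear_conv_bounded_linear[THEN iffD1] G0.linear_axioms)
      show "onorm (\<lambda>v. G t w v - G t x0 v) \<le> k"
      proof (rule onorm_le)
        fix v
        interpret Gw: linear "G t w" using wW by (rule linear_G)
        have "G t w v - G t x0 v = G t w (\<Sum>b\<in>Basis. (v \<bullet> b) *\<^sub>R b) - G t x0 (\<Sum>b\<in>Basis. (v \<bullet> b) *\<^sub>R b)"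
          by (simp add: euclidean_representation)
        also have "\<dots> = (\<Sum>b\<in>Basis. (v \<bullet> b) *\<^sub>R (G t w b - G t x0 b))"
          by (simp add: Gw.sum Gw.scale G0.sum G0.scale scaleR_diff_right sum_subtractf)
        also have "norm \<dots> \<le> (\<Sum>b\<in>Basis. norm v * norm (G t w b - G t x0 b))"
          by (intro order_trans[OF norm_sum] sum_mono) (auto intro!: mult_right_mono Basis_le_norm)
        also have "\<dots> = T (t, w) * norm v" by (simp add: T_def sum_distrib_left mult.commute)
        also have "\<dots> \<le> k * norm v" using Tk[OF t wd] by (intro mult_right_mono) auto
        finally show "norm (G t w v - G t x0 v) \<le> k * norm v" .
      qed
    qed (use y in \<open>auto simp: dist_norm norm_minus_commute d'_def d e\<close>)
    then show "norm (g (t, y) - g (t, x0) - G t x0 (y - x0)) \<le> k * norm (y - x0)"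
      by (simp add: G0.diff algebra_simps)
  qed
qed

text \<open>The image of a great circle has a velocity that is differentiable at 0, hence deviates
  from its tangent by O(s^2). The quadratic rate is what a comparison of second derivatives
  requires.\<close>

lemma tangent_curve:
  assumes t: "t \<in> {0..1}" and x: "x \<in> S3" and u: "u \<bullet> x = 0" "u \<noteq> 0"
  obtains C d where "d > 0" "C \<ge> 0" "\<And>s. \<bar>s\<bar> < d \<Longrightarrow> \<exists>y\<in>S3. norm (g (t, y) - g (t, x) - s *\<^sub>R G t x u) \<le> C * s\<^sup>2"
proof -
  define e where "e = inverse (norm u) *\<^sub>R u"
  have e: "norm e = 1" "e \<bullet> x = 0" using u by (simp_all add: e_def)
  define c where "c s = cos s *\<^sub>R x + sin s *\<^sub>R e" for s
  have c0: "c 0 = x" by (simp add: c_def)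
  have cS: "c s \<in> S3" for s using great_circle[of x e s] x e by (simp add: c_def)
  have cd: "(c has_vector_derivative (- sin s *\<^sub>R x + cos s *\<^sub>R e)) (at s)" for s
    using great_circle_derivative[of x e s] by (simp add: c_def[abs_def])
  define \<gamma> \<gamma>' where "\<gamma> s = g (t, c s)" and "\<gamma>' s = - sin s *\<^sub>R G t (c s) x + cos s *\<^sub>R G t (c s) e" for s
  have gd: "(\<gamma> has_vector_derivative \<gamma>' s) (at s)" for s
  proof -
    interpret Gs: linear "G t (c s)" using t cS by (intro linear_G W_in)
    have "((\<lambda>x. g (t, x)) \<circ> c has_vector_derivative G t (c s) (- sin s *\<^sub>R x + cos s *\<^sub>R e)) (at s)"
      by (rule vector_derivative_diff_chain_within[OF cd])
         (rule has_derivative_at_withinI[OF slice_derivative[OF W_in[OF t cS]]])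
    moreover have "G t (c s) (- sin s *\<^sub>R x + cos s *\<^sub>R e) = \<gamma>' s"
      by (simp only: Gs.add Gs.scale \<gamma>'_def)
    ultimately show ?thesis by (simp add: o_def \<gamma>_def[abs_def])
  qed
  have Gd: "\<exists>D. ((\<lambda>s. G t (c s) v) has_derivative D) (at 0)" for v
  proof -
    have "(\<lambda>z. frechet_derivative g (at z) (0, v)) differentiable (at (t, c 0))"
      by (rule smooth_derivative_differentiable[OF smooth W_in[OF t cS]])
    then obtain D where D: "((\<lambda>z. frechet_derivative g (at z) (0, v)) has_derivative D) (at (t, c 0))"
      unfolding differentiable_def by blast
    have "((\<lambda>s. (t, c s)) has_derivative (\<lambda>h. (0, h *\<^sub>R (- sin 0 *\<^sub>R x + cos 0 *\<^sub>R e)))) (at 0)"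
      using cd[of 0, unfolded has_vector_derivative_def] by (intro has_derivative_Pair has_derivative_const)
    from has_derivative_compose[OF this D] show ?thesis unfolding G_def by blast
  qed
  obtain D1 D2 where "((\<lambda>s. G t (c s) x) has_derivative D1) (at 0)" "((\<lambda>s. G t (c s) e) has_derivative D2) (at 0)"
    using Gd by blast
  then have "\<exists>D. (\<gamma>' has_derivative D) (at 0)"
    unfolding \<gamma>'_def by (intro exI) (rule derivative_intros | assumption | simp)+
  then obtain D where D: "(\<gamma>' has_derivative D) (at 0)" by blast
  then have bl: "bounded_linear D" by (rule has_derivative_bounded_linear)
  obtain d where d: "d > 0" "\<And>s. \<bar>s\<bar> < d \<Longrightarrow> norm (\<gamma>' s - \<gamma>' 0 - D s) \<le> 1 * \<bar>s\<bar>"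
    using D[unfolded has_derivative_at_alt, THEN conjunct2, rule_format, of 1] by auto
  \<comment> \<open>The 1 absorbs the error in the differentiability of \<gamma>' at 0.\<close>
  define B where "B = onorm D + 1"
  have B: "norm (\<gamma>' s - \<gamma>' 0) \<le> B * \<bar>s\<bar>" if "\<bar>s\<bar> < d" for s
  proof -
    have "norm (\<gamma>' s - \<gamma>' 0) \<le> norm (\<gamma>' s - \<gamma>' 0 - D s) + norm (D s)"
      by (metis diff_add_cancel norm_triangle_ineq)
    then show ?thesis
      using d(2)[OF that] onorm[OF bl, of s] by (simp add: B_def algebra_simps)
  qed
  have B0: "B \<ge> 0" using onorm_pos_le[OF bl] by (simp add: B_def)
  have bound: "norm (\<gamma> s - \<gamma> 0 - s *\<^sub>R \<gamma>' 0) \<le> B * s\<^sup>2" if s: "\<bar>s\<bar> < d" for s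
  proof -
    have "norm ((\<gamma> s - s *\<^sub>R \<gamma>' 0) - (\<gamma> 0 - 0 *\<^sub>R \<gamma>' 0)) \<le> (B * \<bar>s\<bar>) * norm (s - 0)"
    proof (rule differentiable_bound[of "{- \<bar>s\<bar>..\<bar>s\<bar>}"])
      fix p assume p: "p \<in> {- \<bar>s\<bar>..\<bar>s\<bar>}"
      show "((\<lambda>s. \<gamma> s - s *\<^sub>R \<gamma>' 0) has_derivative (\<lambda>h. h *\<^sub>R \<gamma>' p - h *\<^sub>R \<gamma>' 0)) (at p within {- \<bar>s\<bar>..\<bar>s\<bar>})"
        using gd[of p, unfolded has_vector_derivative_def, THEN has_derivative_at_withinI]
        by (intro has_derivative_diff) (auto intro!: derivative_eq_intros)
      show "onorm (\<lambda>h. h *\<^sub>R \<gamma>' p - h *\<^sub>R \<gamma>' 0) \<le> B * \<bar>s\<bar>"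
      proof (rule onorm_le)
        fix h :: real
        have "norm (h *\<^sub>R \<gamma>' p - h *\<^sub>R \<gamma>' 0) = \<bar>h\<bar> * norm (\<gamma>' p - \<gamma>' 0)"
          by (metis norm_scaleR scaleR_diff_right)
        also have "\<dots> \<le> \<bar>h\<bar> * (B * \<bar>p\<bar>)" using p s by (intro mult_left_mono B) auto
        also have "\<dots> \<le> \<bar>h\<bar> * (B * \<bar>s\<bar>)" using p B0 by (intro mult_left_mono) auto
        finally show "norm (h *\<^sub>R \<gamma>' p - h *\<^sub>R \<gamma>' 0) \<le> B * \<bar>s\<bar> * norm h" by (simp add: mult.commute)
      qed
    qed auto
    then show ?thesis by (simp add: power2_eq_square mult.assoc algebra_simps)
  qed
  have G0: "norm u *\<^sub>R \<gamma>' 0 = G t x u"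
  proof -
    interpret Gx: linear "G t x" using t x by (intro linear_G W_in)
    have "\<gamma>' 0 = G t x e" by (simp add: \<gamma>'_def c0)
    then show ?thesis using u by (simp add: Gx.scale[symmetric] e_def)
  qed
  show ?thesis
  \<comment> \<open>The great circle has unit speed, so the parameter s for \<open>u\<close>
    corresponds to the parameter s times the norm of \<open>u\<close> on the circle.\<close>
  proof (rule that[of "d / norm u" "B * (norm u)\<^sup>2"])
    fix s assume "\<bar>s\<bar> < d / norm u"
    then have "\<bar>norm u * s\<bar> < d" using u by (simp add: abs_mult field_simps)
    from bound[OF this] show "\<exists>y\<in>S3. norm (g (t, y) - g (t, x) - s *\<^sub>R G t x u) \<le> B * (norm u)\<^sup>2 * s\<^sup>2"
      unfolding G0[symmetric] using cS[of "norm u * s"]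
      by (intro bexI[of _ "c (norm u * s)"]) (simp_all add: \<gamma>_def c0 power_mult_distrib mult.commute mult.left_commute)
  qed (use d(1) u B0 in auto)
qed

end

locale cooriented_isotopy = sphere_isotopy +
  fixes \<nu> :: "real \<Rightarrow> complex^2 \<Rightarrow> complex^2"
  assumes continuous_normal: "continuous_on ({0..1} \<times> S3) (\<lambda>z. \<nu> (fst z) (snd z))"
    and normal_nonzero: "\<And>t x. t \<in> {0..1} \<Longrightarrow> x \<in> S3 \<Longrightarrow> \<nu> t x \<noteq> 0"
    and normal_orthogonal: "\<And>t x v. t \<in> {0..1} \<Longrightarrow> x \<in> S3 \<Longrightarrow> v \<bullet> x = 0 \<Longrightarrow> \<nu> t x \<bullet> G t x v = 0"
    and normal_start: "\<And>x. x \<in> S3 \<Longrightarrow> \<exists>a>0. \<nu> 0 x = a *\<^sub>R x"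
begin

text \<open>Near \<open>x0\<close> the displacement along the sphere is almost tangential; the
  normal shift is orthogonal to it and cannot cancel it. Away from \<open>x0\<close>, injectivity
  and compactness keep the sphere at a positive distance from g(t, x0). All constants are uniform in
  t.\<close>

lemma normal_pushoff_disjoint:
  assumes x0: "x0 \<in> S3"
  obtains s0 where "s0 > 0" "\<And>s t y. 0 < s \<Longrightarrow> s < s0 \<Longrightarrow> t \<in> {0..1} \<Longrightarrow> y \<in> S3 \<Longrightarrow> g (t, y) \<noteq> g (t, x0) - s *\<^sub>R \<nu> t x0"
proof -
  have x0n: "norm x0 = 1" using x0 by simp
  define K where "K = {0..1::real} \<times> (sphere 0 1 \<inter> {v. x0 \<bullet> v = 0})"
  have "compact K" unfolding K_def by (intro compact_Times compact_Int_closed closed_hyperplane) auto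
  moreover have "(0, tframe 2 x0) \<in> K"
    using tframe_tangent[of 2 x0] tframe_orthonormal[OF x0n, of 2 2] by (auto simp: K_def inner_commute norm_eq_1)
  moreover have "continuous_on K (\<lambda>z. norm (G (fst z) x0 (snd z)))"
    using W_in x0 by (intro continuous_intros continuous_on_G) (auto simp: K_def)
  ultimately obtain zm where zm: "zm \<in> K" "\<And>z. z \<in> K \<Longrightarrow> norm (G (fst zm) x0 (snd zm)) \<le> norm (G (fst z) x0 (snd z))"
    using continuous_attains_inf[of K "\<lambda>z. norm (G (fst z) x0 (snd z))"] by blast
  define c where "c = norm (G (fst zm) x0 (snd zm))"
  have c: "c > 0"
  proof -
    have "snd zm \<noteq> 0" using zm(1) by (auto simp: K_def)
    then show ?thesis
      using zm(1) G_tangent_nonzero[of "fst zm" x0 "snd zm"] x0 by (auto simp: c_def K_def inner_commute)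
  qed
  have cG: "c * norm v \<le> norm (G t x0 v)" if t: "t \<in> {0..1}" and v: "v \<bullet> x0 = 0" for t v
  proof (cases "v = 0")
    case False
    interpret Gx: linear "G t x0" using t x0 by (intro linear_G W_in)
    have "(t, inverse (norm v) *\<^sub>R v) \<in> K" using False v t by (simp add: K_def inner_commute)
    from zm(2)[OF this] have "c \<le> norm (G t x0 v) / norm v"
      by (simp add: c_def Gx.scale divide_inverse mult.commute)
    then show ?thesis using False by (simp add: field_simps)
  qed simp
  obtain N where N: "N > 0" "\<And>t. t \<in> {0..1} \<Longrightarrow> norm (G t x0 x0) \<le> N"
  proof -
    have "continuous_on {0..1} (\<lambda>t. G t x0 x0)"
      using W_in x0 by (intro continuous_on_G) (auto intro: continuous_intros)
    then have "bounded ((\<lambda>t. G t x0 x0) ` {0..1})"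
      by (intro compact_imp_bounded compact_continuous_image) auto
    then obtain B where "B > 0" "\<forall>w\<in>(\<lambda>t. G t x0 x0) ` {0..1}. norm w \<le> B" using bounded_pos by blast
    then show ?thesis using that by auto
  qed
  have cnu: "continuous_on {0..1} (\<lambda>t. \<nu> t x0)"
    by (rule continuous_on_compose2[OF continuous_normal, of _ "\<lambda>t. (t, x0)", simplified]) (use x0 in \<open>auto intro!: continuous_intros\<close>)
  obtain B where B: "B > 0" "\<And>t. t \<in> {0..1} \<Longrightarrow> norm (\<nu> t x0) \<le> B"
  proof -
    have "bounded ((\<lambda>t. \<nu> t x0) ` {0..1})"
      by (intro compact_imp_bounded compact_continuous_image cnu) auto
    then obtain B where "B > 0" "\<forall>w\<in>(\<lambda>t. \<nu> t x0) ` {0..1}. norm w \<le> B" using bounded_pos by blast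
    then show ?thesis using that by auto
  qed
  obtain d where d: "d > 0" "\<And>t y. t \<in> {0..1} \<Longrightarrow> norm (y - x0) < d \<Longrightarrow>
    norm (g (t, y) - g (t, x0) - G t x0 (y - x0)) \<le> c / 8 * norm (y - x0)"
    using uniform_tangent_approximation[OF x0, of "c / 8"] c by auto
  \<comment> \<open>For a chord of length l < d', the bound 1 keeps the tangential part at least
    l/2, and the last bound keeps the image of the radial part at most cl/8.\<close>
  define d' where "d' = min d (min 1 (c / (4 * N)))"
  have d': "d' > 0" "d' \<le> d" "d' \<le> 1" "N * d' \<le> c / 4"
  proof -
    show "d' > 0" "d' \<le> d" "d' \<le> 1" using d c N by (simp_all add: d'_def)
    have "d' \<le> c / (4 * N)" by (simp add: d'_def)
    then show "N * d' \<le> c / 4" using N by (simp add: field_simps)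
  qed
  have near: "g (t, y) \<noteq> g (t, x0) - s *\<^sub>R \<nu> t x0" if s: "s > 0" and t: "t \<in> {0..1}" and y: "y \<in> S3" "norm (y - x0) < d'" for s t y
  proof (cases "y = x0")
    case True
    then show ?thesis using normal_nonzero[OF t x0] s by simp
  next
    case False
    interpret Gx: linear "G t x0" using t x0 by (intro linear_G W_in)
    define v where "v = y - x0"
    define l where "l = norm v"
    have l: "l > 0" "l < d'" using False y by (simp_all add: l_def v_def)
    \<comment> \<open>Both ends of the chord are unit vectors, so its radial component is quadratic
      in its length.\<close>
    have vx: "v \<bullet> x0 = - l\<^sup>2 / 2"
    proof -
      have "l\<^sup>2 = y \<bullet> y - 2 * (y \<bullet> x0) + x0 \<bullet> x0"
        unfolding l_def v_def power2_norm_eq_inner by (simp add: inner_diff_left inner_diff_right inner_commute)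
      moreover have "y \<bullet> y = 1" "x0 \<bullet> x0 = 1" using y(1) x0n by (simp_all add: norm_eq_1[symmetric])
      ultimately show ?thesis by (simp add: v_def inner_diff_left)
    qed
    define w where "w = v - (v \<bullet> x0) *\<^sub>R x0"
    have wx: "w \<bullet> x0 = 0" using x0n by (simp add: w_def inner_diff_left norm_eq_1)
    have "norm w \<ge> norm v - norm ((v \<bullet> x0) *\<^sub>R x0)" unfolding w_def by (rule norm_triangle_ineq2)
    then have "norm w \<ge> l - l\<^sup>2 / 2" using x0n vx by (simp add: l_def)
    moreover have "l\<^sup>2 \<le> l" using l d'(3) by (simp add: power2_eq_square mult_le_cancel_left1)
    ultimately have w: "norm w \<ge> l / 2" by simp
    have "(norm (G t x0 w + s *\<^sub>R \<nu> t x0))\<^sup>2 = (norm (G t x0 w))\<^sup>2 + (norm (s *\<^sub>R \<nu> t x0))\<^sup>2"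
      unfolding power2_norm_eq_inner using normal_orthogonal[OF t x0 wx]
      by (simp add: inner_add_left inner_add_right inner_commute)
    then have "(norm (G t x0 w))\<^sup>2 \<le> (norm (G t x0 w + s *\<^sub>R \<nu> t x0))\<^sup>2" by simp
    then have 1: "norm (G t x0 w) \<le> norm (G t x0 w + s *\<^sub>R \<nu> t x0)" by (rule power2_le_imp_le) simp
    have 2: "c * (l / 2) \<le> norm (G t x0 w)"
      using cG[OF t wx] w c by (meson mult_left_mono order_trans less_imp_le)
    have 3: "norm (G t x0 ((v \<bullet> x0) *\<^sub>R x0)) \<le> c * l / 8"
    proof -
      have "norm (G t x0 ((v \<bullet> x0) *\<^sub>R x0)) = l\<^sup>2 / 2 * norm (G t x0 x0)"
        unfolding Gx.scale norm_scaleR vx by simp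
      also have "\<dots> \<le> l\<^sup>2 / 2 * N" using N(2)[OF t] by (intro mult_left_mono) auto
      also have "\<dots> = l / 2 * (N * l)" by (simp add: power2_eq_square)
      also have "\<dots> \<le> l / 2 * (N * d')" using l N by (intro mult_left_mono) auto
      also have "\<dots> \<le> l / 2 * (c / 4)" using l d' by (intro mult_left_mono) auto
      finally show ?thesis by (simp add: mult.commute)
    qed
    have 4: "norm (g (t, y) - g (t, x0) - G t x0 v) \<le> c / 8 * l"
      using d(2)[OF t, of y] y(2) d'(2) by (simp add: v_def l_def)
    show ?thesis
    proof
      assume eq: "g (t, y) = g (t, x0) - s *\<^sub>R \<nu> t x0"
      have "v = w + (v \<bullet> x0) *\<^sub>R x0" by (simp add: w_def)
      then have "G t x0 v = G t x0 w + G t x0 ((v \<bullet> x0) *\<^sub>R x0)" by (metis Gx.add)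
      then have "G t x0 w + s *\<^sub>R \<nu> t x0 = - (g (t, y) - g (t, x0) - G t x0 v) - G t x0 ((v \<bullet> x0) *\<^sub>R x0)"
        using eq by simp
      then have "norm (G t x0 w + s *\<^sub>R \<nu> t x0) \<le> norm (g (t, y) - g (t, x0) - G t x0 v) + norm (G t x0 ((v \<bullet> x0) *\<^sub>R x0))"
        by (metis norm_minus_cancel norm_triangle_ineq4)
      \<comment> \<open>The tangential term, at least cl/2, would have to be balanced by two errors
        of at most cl/8 each.\<close>
      with 1 2 3 4 have "c * (l / 2) \<le> c / 8 * l + c * l / 8" by linarith
      moreover have "c * l > 0" using c l by simp
      ultimately show False by simp
    qed
  qed
  define K2 where "K2 = {0..1::real} \<times> (S3 \<inter> {y. d' \<le> norm (y - x0)})"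
  have "\<exists>m>0. \<forall>z\<in>K2. m \<le> norm (g z - g (fst z, x0))"
  proof (cases "K2 = {}")
    case True
    then show ?thesis by (intro exI[of _ 1]) auto
  next
    case False
    have "compact K2" unfolding K2_def
      by (intro compact_Times compact_Int_closed closed_Collect_le continuous_intros) auto
    moreover have "continuous_on K2 (\<lambda>z. norm (g z - g (fst z, x0)))"
      using W_in x0
      by (intro continuous_intros continuous_on_subset[OF continuous_on_g] continuous_on_compose2[OF continuous_on_g, of _ "\<lambda>z. (fst z, x0)"])
         (auto simp: K2_def intro!: continuous_intros)
    ultimately obtain z0 where z0: "z0 \<in> K2" "\<And>z. z \<in> K2 \<Longrightarrow> norm (g z0 - g (fst z0, x0)) \<le> norm (g z - g (fst z, x0))"
      using continuous_attains_inf[of K2 "\<lambda>z. norm (g z - g (fst z, x0))"] False by blast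
    obtain t y where ty: "z0 = (t, y)" "t \<in> {0..1}" "y \<in> S3" "d' \<le> norm (y - x0)"
      using z0(1) by (auto simp: K2_def)
    then have "y \<noteq> x0" using d'(1) by auto
    then have "g (t, y) \<noteq> g (t, x0)"
      using embedding[OF ty(2)] ty(3) x0 unfolding S3_embedding_def inj_on_def by blast
    then show ?thesis using z0(2) ty by (intro exI[of _ "norm (g z0 - g (fst z0, x0))"]) auto
  qed
  then obtain m where m: "m > 0" "\<And>z. z \<in> K2 \<Longrightarrow> m \<le> norm (g z - g (fst z, x0))" by blast
  show ?thesis
  proof (rule that[of "m / B"])
    show "m / B > 0" using m B by simp
    fix s t :: real and y assume s: "0 < s" "s < m / B" and t: "t \<in> {0..1}" and y: "y \<in> S3"
    show "g (t, y) \<noteq> g (t, x0) - s *\<^sub>R \<nu> t x0"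
    proof (cases "norm (y - x0) < d'")
      case True
      then show ?thesis using near s(1) t y by blast
    next
      case False
      then have "m \<le> norm (g (t, y) - g (t, x0))" using m(2)[of "(t, y)"] t y by (auto simp: K2_def)
      moreover have "norm (s *\<^sub>R \<nu> t x0) < m"
      proof -
        have "norm (s *\<^sub>R \<nu> t x0) \<le> s * B" using B(2)[OF t] s by simp
        also have "\<dots> < m" using s B by (simp add: field_simps)
        finally show ?thesis .
      qed
      ultimately show ?thesis by (metis add_diff_cancel_left' diff_add_cancel leD minus_diff_eq norm_minus_cancel)
    qed
  qed
qed

text \<open>Keeps the derivative of the isotopy on tangent vectors and replaces its radial value,
  which depends on the extension, by the normal. This makes it an isomorphism of R^4.\<close>

definition D where "D t x v = G t x (v - (v \<bullet> x) *\<^sub>R x) + (v \<bullet> x) *\<^sub>R \<nu> t x"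

lemma tangential_part: "x \<in> S3 \<Longrightarrow> (v - (v \<bullet> x) *\<^sub>R x) \<bullet> x = 0"
  by (simp add: inner_diff_left norm_eq_1)

lemma linear_D:
  assumes "t \<in> {0..1}" "x \<in> S3" shows "linear (D t x)"
proof -
  interpret G: linear "G t x" using assms by (intro linear_G W_in)
  show ?thesis
    by (rule linearI) (simp_all add: D_def G.diff G.add G.scale inner_add_left algebra_simps)
qed

lemma D_nonzero:
  assumes t: "t \<in> {0..1}" and x: "x \<in> S3" and 0: "D t x v = 0"
  shows "v = 0"
proof -
  let ?w = "v - (v \<bullet> x) *\<^sub>R x"
  have "\<nu> t x \<bullet> D t x v = (v \<bullet> x) * (\<nu> t x \<bullet> \<nu> t x)"
    unfolding D_def using normal_orthogonal[OF t x tangential_part[OF x]] by (simp add: inner_add_right)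
  then have vx: "v \<bullet> x = 0" unfolding 0 using normal_nonzero[OF t x] by simp
  then have "G t x v = 0" using 0 by (simp add: D_def)
  then show ?thesis using G_tangent_nonzero[OF t x vx] by blast
qed

lemma D_surjective:
  assumes t: "t \<in> {0..1}" and x: "x \<in> S3"
  obtains v where "D t x v = w"
proof -
  interpret L: linear "D t x" by (rule linear_D[OF t x])
  have "inj (D t x)" unfolding L.inj_iff_eq_0 using D_nonzero[OF t x] by blast
  then have "surj (D t x)" using linear_injective_imp_surjective[OF L.linear_axioms] by blast
  then show ?thesis using that by (metis surjD)
qed

lemma tangent_if_orthogonal:
  assumes t: "t \<in> {0..1}" and x: "x \<in> S3" and w: "\<nu> t x \<bullet> w = 0"
  obtains u where "u \<bullet> x = 0" "G t x u = w"
proof -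
  obtain v where v: "D t x v = w" using D_surjective[OF t x] by blast
  have "\<nu> t x \<bullet> D t x v = (v \<bullet> x) * (\<nu> t x \<bullet> \<nu> t x)"
    unfolding D_def using normal_orthogonal[OF t x tangential_part[OF x]] by (simp add: inner_add_right)
  then have vx: "v \<bullet> x = 0" unfolding v w using normal_nonzero[OF t x] by simp
  then show ?thesis using that v by (simp add: D_def)
qed

lemma continuous_on_D:
  "continuous_on ({0..1} \<times> S3) (\<lambda>z. D (fst z) (snd z) v)"
  unfolding D_def by (intro continuous_intros continuous_on_G continuous_normal) (use sub_W in auto)

text \<open>Positivity of the quadratic form keeps the segment from \<open>D 0 x\<close> to the
  identity within the isomorphisms.\<close>

lemma D_start: "x \<in> S3 \<Longrightarrow> v \<noteq> 0 \<Longrightarrow> D 0 x v \<bullet> v > 0"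
proof -
  assume x: "x \<in> S3" and v: "v \<noteq> 0"
  obtain a where a: "a > 0" "\<nu> 0 x = a *\<^sub>R x" using normal_start[OF x] by blast
  let ?w = "v - (v \<bullet> x) *\<^sub>R x"
  have "D 0 x v \<bullet> v = r * (?w \<bullet> v) + a * (v \<bullet> x)\<^sup>2"
    unfolding D_def G_start[OF x tangential_part[OF x]] a(2)
    by (simp add: inner_add_left inner_commute[of x v] power2_eq_square)
  also have "?w \<bullet> v = ?w \<bullet> ?w"
    using tangential_part[OF x, of v] by (simp add: inner_diff_right)
  finally have *: "D 0 x v \<bullet> v = r * (norm ?w)\<^sup>2 + a * (v \<bullet> x)\<^sup>2" by (simp add: power2_norm_eq_inner)
  show ?thesis
  proof (cases "v \<bullet> x = 0")
    case True
    then show ?thesis using * r v by simp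
  next
    case False
    then show ?thesis unfolding * using r a by (intro add_nonneg_pos) auto
  qed
qed

text \<open>The map \<open>x \<mapsto> g(t,x) - p\<^sub>t\<close> with \<open>p\<^sub>t\<close> on the inner side of the image is a homotopy from an
  essential map, so \<open>p\<^sub>1\<close> does not lie in the unbounded component.\<close>

lemma inner_pushoff_in_bounded_component:
  assumes x0: "x0 \<in> S3"
  obtains s1 where "s1 > 0" "\<And>s. 0 < s \<Longrightarrow> s < s1 \<Longrightarrow> g (1, x0) - s *\<^sub>R \<nu> 1 x0 \<notin> (\<lambda>x. g (1, x)) ` S3 \<and>
    bounded (connected_component_set (- (\<lambda>x. g (1, x)) ` S3) (g (1, x0) - s *\<^sub>R \<nu> 1 x0))"
proof -
  obtain s0 where s0: "s0 > 0" "\<And>s t y. 0 < s \<Longrightarrow> s < s0 \<Longrightarrow> t \<in> {0..1} \<Longrightarrow> y \<in> S3 \<Longrightarrow> g (t, y) \<noteq> g (t, x0) - s *\<^sub>R \<nu> t x0"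
    using normal_pushoff_disjoint[OF x0] by blast
  obtain a where a: "a > 0" "\<nu> 0 x0 = a *\<^sub>R x0" using normal_start[OF x0] by blast
  let ?\<phi> = "\<lambda>x. g (1, x)"
  have c\<phi>: "continuous_on S3 ?\<phi>"
    using W_in by (intro continuous_on_compose2[OF continuous_on_g, of _ "\<lambda>x. (1, x)"]) (auto intro!: continuous_intros)
  have cg: "continuous_on ({0..1} \<times> S3) (\<lambda>z. g (fst z, snd z))"
    using continuous_on_subset[OF continuous_on_g sub_W] by simp
  have cg0: "continuous_on ({0..1} \<times> S3) (\<lambda>z. g (fst z, x0))"
    using W_in x0 by (intro continuous_on_compose2[OF continuous_on_g, of _ "\<lambda>z. (fst z, x0)"]) (auto intro!: continuous_intros)
  have cn0: "continuous_on ({0..1} \<times> S3) (\<lambda>z. \<nu> (fst z) x0)"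
    using x0 by (intro continuous_on_compose2[OF continuous_normal, of _ "\<lambda>z. (fst z, x0)", simplified]) (auto intro!: continuous_intros)
  show ?thesis
  proof (rule that[of "min s0 (r / a)"])
    show "min s0 (r / a) > 0" using s0 r a by simp
    fix s assume s: "0 < s" "s < min s0 (r / a)"
    define p where "p t = g (t, x0) - s *\<^sub>R \<nu> t x0" for t
    \<comment> \<open>At time 0 the pushed point lies on the ray through \<open>x0\<close> at
      distance b from the origin; s < r/a keeps it strictly inside the round sphere.\<close>
    define b where "b = r - s * a"
    have b: "0 < b" "b < r" using s a by (auto simp: b_def field_simps)
    have p0: "p 0 = b *\<^sub>R x0" using start[OF x0] a(2) by (simp add: p_def b_def algebra_simps)
    have ne: "g (t, y) - p t \<noteq> 0" if "t \<in> {0..1}" "y \<in> S3" for t y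
      using s0(2)[of s t y] s that by (simp add: p_def)
    have h1: "freely_homotopic S3 S3 (\<lambda>x. inverse (norm (g (0, x) - p 0)) *\<^sub>R (g (0, x) - p 0))
       (\<lambda>x. inverse (norm (g (1, x) - p 1)) *\<^sub>R (g (1, x) - p 1))"
    proof (rule homotopic_freeI[where h = "\<lambda>t x. inverse (norm (g (t, x) - p t)) *\<^sub>R (g (t, x) - p t)"])
      show "continuous_on ({0..1} \<times> S3) (\<lambda>z. inverse (norm (g (fst z, snd z) - p (fst z))) *\<^sub>R (g (fst z, snd z) - p (fst z)))"
        using ne unfolding p_def by (intro continuous_intros cg cg0 cn0) auto
    qed (use ne in auto)
    have ne0: "r *\<^sub>R x - ((1 - t) * b) *\<^sub>R x0 \<noteq> 0" if "0 \<le> t" "t \<le> 1" "x \<in> S3" for t x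
    proof
      assume "r *\<^sub>R x - ((1 - t) * b) *\<^sub>R x0 = 0"
      then have "norm (r *\<^sub>R x) = norm (((1 - t) * b) *\<^sub>R x0)" by simp
      then have "r = (1 - t) * b" using that r b x0 by (simp add: abs_mult)
      also have "\<dots> \<le> 1 * b" using that b by (intro mult_right_mono) auto
      finally show False using b by simp
    qed
    \<comment> \<open>Moving the centre along a radius to the origin stays inside the round sphere
      and ends at the identity.\<close>
    have h0: "freely_homotopic S3 S3 (\<lambda>x. inverse (norm (g (0, x) - p 0)) *\<^sub>R (g (0, x) - p 0)) id"
    proof (rule homotopic_freeI[where h = "\<lambda>t x. inverse (norm (r *\<^sub>R x - ((1 - t) * b) *\<^sub>R x0)) *\<^sub>R (r *\<^sub>R x - ((1 - t) * b) *\<^sub>R x0)"])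
      show "continuous_on ({0..1} \<times> S3) (\<lambda>z. inverse (norm (r *\<^sub>R snd z - ((1 - fst z) * b) *\<^sub>R x0)) *\<^sub>R (r *\<^sub>R snd z - ((1 - fst z) * b) *\<^sub>R x0))"
        using ne0 by (intro continuous_intros) auto
    qed (use ne0 start p0 r in auto)
    define M where "M = ?\<phi> ` S3"
    have cM: "compact M" unfolding M_def by (intro compact_continuous_image c\<phi>) simp
    have pM: "p 1 \<notin> M"
    proof
      assume "p 1 \<in> M"
      then obtain y where "y \<in> S3" "p 1 = g (1, y)" by (auto simp: M_def)
      then show False using ne[of 1 y] by simp
    qed
    have "bounded (connected_component_set (- M) (p 1))"
    proof (rule ccontr)
      \<comment> \<open>By Borsuk's criterion the map seen from a point of the unbounded component
        is null homotopic; composed with the parametrisation of \<open>M\<close> it would contract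
        the identity of \<open>S3\<close>.\<close>
      assume "\<not> bounded (connected_component_set (- M) (p 1))"
      then obtain c where c: "freely_homotopic M (sphere 0 1) (\<lambda>x. inverse (norm (x - p 1)) *\<^sub>R (x - p 1)) (\<lambda>x. c)"
        unfolding Borsuk_map_essential_bounded_component[OF cM pM] by blast
      have "freely_homotopic S3 (sphere 0 1) ((\<lambda>x. inverse (norm (x - p 1)) *\<^sub>R (x - p 1)) \<circ> ?\<phi>) ((\<lambda>x. c) \<circ> ?\<phi>)"
        by (rule homotopic_with_compose_continuous_right[OF c c\<phi>]) (auto simp: M_def)
      then have "freely_homotopic S3 S3 (\<lambda>x. inverse (norm (g (1, x) - p 1)) *\<^sub>R (g (1, x) - p 1)) (\<lambda>x. c)"
        by (simp add: o_def)
      from homotopic_with_trans[OF homotopic_with_trans[OF homotopic_with_symD[OF h0] h1] this]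
      have "contractible S3" unfolding contractible_def by blast
      then show False by (simp add: contractible_sphere)
    qed
    then show "g (1, x0) - s *\<^sub>R \<nu> 1 x0 \<notin> ?\<phi> ` S3 \<and>
      bounded (connected_component_set (- ?\<phi> ` S3) (g (1, x0) - s *\<^sub>R \<nu> 1 x0))"
      using pM by (simp add: M_def p_def)
  qed
qed

end

section \<open>Growth of |\<Phi>|^2 across the link\<close>

locale link_isotopy = cooriented_isotopy g W r \<nu> + holomorphic_map \<Phi> U
  for g W r \<nu> \<Phi> U +
  fixes \<delta> \<epsilon> :: real
  assumes ball_U: "ball 0 \<delta> \<subseteq> U"
    and link: "(\<lambda>x. g (1, x)) ` S3 = {z \<in> ball 0 \<delta>. norm (\<Phi> z) = \<epsilon>}"
    and regular: "\<And>z. z \<in> ball 0 \<delta> \<Longrightarrow> z \<noteq> 0 \<Longrightarrow> complex_jacobian \<Phi> z \<in> V2C3"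
    and avoids_0: "\<And>t x. t \<in> {0..1} \<Longrightarrow> x \<in> S3 \<Longrightarrow> g (t, x) \<noteq> 0"
begin

lemma link_point: "x \<in> S3 \<Longrightarrow> g (1, x) \<in> ball 0 \<delta> \<and> norm (\<Phi> (g (1, x))) = \<epsilon> \<and> g (1, x) \<in> U"
  using link ball_U by blast

lemma continuous_on_end: "continuous_on S3 (\<lambda>x. g (1, x))"
  using W_in by (intro continuous_on_compose2[OF continuous_on_g, of _ "\<lambda>x. (1, x)"]) (auto intro!: continuous_intros)

text \<open>At a critical point of \<open>|\<Phi>|\<^sup>2\<close> on the link the Hessian vanishes on the tangent space, which contains
  a complex line, but the Levi form is positive.\<close>

lemma not_critical:
  assumes x: "x \<in> S3"
  shows "\<exists>v. (J (g (1, x)) *v v) \<bullet> \<Phi> (g (1, x)) \<noteq> 0"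
proof (rule ccontr)
  define z where "z = g (1, x)"
  assume "\<nexists>v. (J (g (1, x)) *v v) \<bullet> \<Phi> (g (1, x)) \<noteq> 0"
  then have crit: "(J z *v v) \<bullet> \<Phi> z = 0" for v by (simp add: z_def)
  have one: "(1::real) \<in> {0..1}" by simp
  have zU: "z \<in> U" and zn: "norm (\<Phi> z) = \<epsilon>" and zV: "J z \<in> V2C3"
    using link_point[OF x] regular avoids_0[OF one x] by (auto simp: z_def)
  define n where "n = \<nu> 1 x"
  have n: "n \<noteq> 0" using normal_nonzero[OF one x] by (simp add: n_def)
  \<comment> \<open>The Hermitian complement of the normal is the complex line in the tangent space:
    both \<open>w\<close> and \<i> w are orthogonal to \<open>n\<close> over the reals.\<close>
  define w where "w = jmap n"
  have w0: "w \<noteq> 0" using n norm_jmap[of n] by (auto simp: w_def simp del: norm_jmap)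
  have orth: "n \<bullet> w = 0" "n \<bullet> (\<i> *s w) = 0"
    by (simp_all add: inner_eq_Re_herm w_def herm_scale_right herm_jmap)
  \<comment> \<open>Within C s^2 of the tangent line there is a point of the link, where |\<Phi>|^2
    equals \<epsilon>^2, and near a critical point |\<Phi>|^2 has an arbitrarily small Lipschitz
    constant \<eta>.\<close>
  have flat: "((\<lambda>s. ((norm (\<Phi> (z + s *\<^sub>R w')))\<^sup>2 - \<epsilon>\<^sup>2) / s\<^sup>2) \<longlongrightarrow> 0) (at (0::real))"
    if w': "n \<bullet> w' = 0" "w' \<noteq> 0" for w'
  proof -
    obtain u where u: "u \<bullet> x = 0" "G 1 x u = w'"
      using tangent_if_orthogonal[OF one x] w'(1) unfolding n_def by blast
    have u0: "u \<noteq> 0"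
    proof
      assume "u = 0"
      then have "w' = 0" using u(2) linear_0[OF linear_G[OF W_in[OF one x]]] by simp
      then show False using w'(2) by simp
    qed
    obtain C d where C: "d > 0" "C \<ge> 0" "\<And>s. \<bar>s\<bar> < d \<Longrightarrow> \<exists>y\<in>S3. norm (g (1, y) - g (1, x) - s *\<^sub>R G 1 x u) \<le> C * s\<^sup>2"
      by (rule tangent_curve[OF one x u(1) u0], rule that, assumption+)
    show ?thesis
      unfolding tendsto_iff
    proof (intro allI impI)
      fix e :: real assume e: "e > 0"
      define \<eta> where "\<eta> = e / (2 * (C + 1))"
      have \<eta>: "\<eta> > 0" "\<eta> * C < e" using e C(2) mult_nonneg_nonneg[of C e] by (auto simp: \<eta>_def field_simps add_nonneg_pos)
      obtain \<rho> where \<rho>: "\<rho> > 0" "ball z \<rho> \<subseteq> U"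
        "\<And>p q. p \<in> ball z \<rho> \<Longrightarrow> q \<in> ball z \<rho> \<Longrightarrow> \<bar>(norm (\<Phi> p))\<^sup>2 - (norm (\<Phi> q))\<^sup>2\<bar> \<le> \<eta> * norm (p - q)"
        using norm_square_flat_at_critical_point[OF zU crit \<eta>(1)] by blast
      \<comment> \<open>Keeps both the point on the tangent line and the nearby point of the link
        inside the ball of radius \<rho>; s^2 \<le> |s| is used for the latter.\<close>
      define k where "k = min (min d 1) (\<rho> / (norm w' + C + 1))"
      have kpos: "k > 0" using C \<rho> by (simp add: k_def add_nonneg_pos)
      have "dist (((norm (\<Phi> (z + s *\<^sub>R w')))\<^sup>2 - \<epsilon>\<^sup>2) / s\<^sup>2) 0 < e" if s: "s \<noteq> 0" "\<bar>s\<bar> < k" for s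
      proof -
        obtain y where y: "y \<in> S3" "norm (g (1, y) - z - s *\<^sub>R w') \<le> C * s\<^sup>2"
          using C(3)[of s] s u(2) by (auto simp: k_def z_def)
        have sk: "\<bar>s\<bar> * (norm w' + C + 1) < \<rho>"
          using s C(2) by (simp add: k_def pos_less_divide_eq add_nonneg_pos)
        have s2: "s\<^sup>2 \<le> \<bar>s\<bar>"
        proof -
          have "s\<^sup>2 = \<bar>s\<bar> * \<bar>s\<bar>" by (simp add: power2_eq_square)
          also have "\<dots> \<le> \<bar>s\<bar> * 1" using s by (intro mult_left_mono) (auto simp: k_def)
          finally show ?thesis by simp
        qed
        have "norm (s *\<^sub>R w') \<le> \<bar>s\<bar> * (norm w' + C + 1)"
          using C(2) by (simp add: distrib_left)
        then have b1: "z + s *\<^sub>R w' \<in> ball z \<rho>" using sk by (simp add: dist_norm)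
        have "norm (g (1, y) - z) \<le> norm (g (1, y) - z - s *\<^sub>R w') + norm (s *\<^sub>R w')"
          by (metis diff_add_cancel norm_triangle_ineq)
        also have "\<dots> \<le> C * \<bar>s\<bar> + \<bar>s\<bar> * norm w'"
          using y(2) s2 C(2) by (simp add: add_mono order_trans[OF _ mult_left_mono])
        also have "\<dots> \<le> \<bar>s\<bar> * (norm w' + C + 1)" by (simp add: algebra_simps)
        finally have b2: "g (1, y) \<in> ball z \<rho>" using sk by (simp add: dist_norm norm_minus_commute)
        have "\<bar>(norm (\<Phi> (z + s *\<^sub>R w')))\<^sup>2 - (norm (\<Phi> (g (1, y))))\<^sup>2\<bar> \<le> \<eta> * norm (z + s *\<^sub>R w' - g (1, y))"
          by (rule \<rho>(3)[OF b1 b2])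
        also have "norm (z + s *\<^sub>R w' - g (1, y)) \<le> C * s\<^sup>2"
          using y(2) by (metis diff_diff_add norm_minus_commute)
        finally have "\<bar>(norm (\<Phi> (z + s *\<^sub>R w')))\<^sup>2 - \<epsilon>\<^sup>2\<bar> \<le> (\<eta> * C) * s\<^sup>2"
          using link_point[OF y(1)] \<eta>(1) by (simp add: mult.assoc)
        also have "\<dots> < e * s\<^sup>2" using \<eta>(2) s(1) by simp
        finally show ?thesis using s(1) by (simp add: dist_norm abs_divide field_simps)
      qed
      then show "\<forall>\<^sub>F s in at 0. dist (((norm (\<Phi> (z + s *\<^sub>R w')))\<^sup>2 - \<epsilon>\<^sup>2) / s\<^sup>2) 0 < e"
        unfolding eventually_at using kpos by (intro exI[of _ k]) (auto simp: dist_norm)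
    qed
  qed
  have "((\<lambda>s. ((norm (\<Phi> (z + s *\<^sub>R w)))\<^sup>2 - \<epsilon>\<^sup>2) / s\<^sup>2 + ((norm (\<Phi> (z + s *\<^sub>R (\<i> *s w))))\<^sup>2 - \<epsilon>\<^sup>2) / s\<^sup>2) \<longlongrightarrow> 0 + 0) (at (0::real))"
    using w0 orth norm_cscale[of \<i> w] by (intro tendsto_add flat) auto
  moreover have "((\<lambda>s. ((norm (\<Phi> (z + s *\<^sub>R w)))\<^sup>2 - \<epsilon>\<^sup>2) / s\<^sup>2 + ((norm (\<Phi> (z + s *\<^sub>R (\<i> *s w))))\<^sup>2 - \<epsilon>\<^sup>2) / s\<^sup>2) \<longlongrightarrow> 2 * (norm (J z *v w))\<^sup>2) (at (0::real))"
    using norm_square_levi_form[OF zU crit, of w] by (simp add: zn add_divide_distrib[symmetric] algebra_simps)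
  ultimately have "2 * (norm (J z *v w))\<^sup>2 = 0"
    using tendsto_unique[OF trivial_limit_at] by fastforce
  then have "J z *v w = 0" by simp
  then show False using zV w0 unfolding V2C3_iff by blast
qed

text \<open>|\<Phi>|^2 is constant along the link, so its tangential derivatives vanish; since
  \<open>D 1 x\<close> is onto, a zero derivative along the normal would give a critical point. A
  negative one would give values above \<epsilon>^2 at inner push-offs.\<close>

lemma normal_derivative_positive:
  assumes x: "x \<in> S3"
  shows "(J (g (1, x)) *v \<nu> 1 x) \<bullet> \<Phi> (g (1, x)) > 0"
proof -
  define z where "z = g (1, x)"
  have one: "(1::real) \<in> {0..1}" by simp
  have zU: "z \<in> U" and zn: "norm (\<Phi> z) = \<epsilon>"
    using link_point[OF x] by (auto simp: z_def)
  interpret Jz: linear "(*v) (J z)" by (rule linear_cmatrix)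
  have tangent: "(J z *v G 1 x u) \<bullet> \<Phi> z = 0" if u: "u \<bullet> x = 0" for u
  proof -
    have "((\<lambda>y. (norm (\<Phi> (g (1, y))))\<^sup>2) has_derivative (\<lambda>v. 2 * ((J z *v G 1 x v) \<bullet> \<Phi> z))) (at x)"
      using has_derivative_compose[OF slice_derivative[OF W_in[OF one x]], of "\<lambda>y. (norm (\<Phi> y))\<^sup>2"]
        has_derivative_norm_square[OF zU] by (simp add: z_def)
    moreover have "((\<lambda>y. \<epsilon>\<^sup>2) has_derivative (\<lambda>v. 0)) (at x)" by simp
    ultimately have "2 * ((J z *v G 1 x u) \<bullet> \<Phi> z) = 0"
      by (rule tangential_derivative_unique) (use link_point x u in auto)
    then show ?thesis by simp
  qed
  have nz: "(J z *v \<nu> 1 x) \<bullet> \<Phi> z \<noteq> 0"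
  proof
    assume 0: "(J z *v \<nu> 1 x) \<bullet> \<Phi> z = 0"
    have "(J z *v v) \<bullet> \<Phi> z = 0" for v
    proof -
      obtain u where "D 1 x u = v" using D_surjective[OF one x] by blast
      then have "J z *v v = J z *v G 1 x (u - (u \<bullet> x) *\<^sub>R x) + (u \<bullet> x) *\<^sub>R (J z *v \<nu> 1 x)"
        by (simp add: D_def Jz.add Jz.scale flip: \<open>D 1 x u = v\<close>)
      then show ?thesis using 0 tangent[OF tangential_part[OF x]] by (simp add: inner_add_left)
    qed
    then show False using not_critical[OF x] by (simp add: z_def)
  qed
  have "\<not> (J z *v \<nu> 1 x) \<bullet> \<Phi> z < 0"
  proof
    assume neg: "(J z *v \<nu> 1 x) \<bullet> \<Phi> z < 0"
    define q where "q s = (norm (\<Phi> (z - s *\<^sub>R \<nu> 1 x)))\<^sup>2" for s :: real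
    have "((\<lambda>s. z - s *\<^sub>R \<nu> 1 x) has_derivative (\<lambda>h. - h *\<^sub>R \<nu> 1 x)) (at 0)"
      by (auto intro!: derivative_eq_intros)
    then have "(q has_derivative (\<lambda>h. 2 * ((J z *v (- h *\<^sub>R \<nu> 1 x)) \<bullet> \<Phi> z))) (at 0)"
      unfolding q_def using has_derivative_compose[of "\<lambda>s. z - s *\<^sub>R \<nu> 1 x" _ 0 UNIV "\<lambda>y. (norm (\<Phi> y))\<^sup>2"]
        has_derivative_norm_square[OF zU] by simp
    moreover have "2 * ((J z *v (- h *\<^sub>R \<nu> 1 x)) \<bullet> \<Phi> z) = - 2 * ((J z *v \<nu> 1 x) \<bullet> \<Phi> z) * h" for h
      by (simp only: Jz.scale) simp
    ultimately have "DERIV q 0 :> - 2 * ((J z *v \<nu> 1 x) \<bullet> \<Phi> z)"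
      by (simp only: has_field_derivative_def)
    moreover have "- 2 * ((J z *v \<nu> 1 x) \<bullet> \<Phi> z) > 0" using neg by simp
    ultimately obtain d where d: "d > 0" "\<And>h. h > 0 \<Longrightarrow> h < d \<Longrightarrow> q 0 < q (0 + h)"
      using DERIV_pos_inc_right by metis
    obtain s1 where s1: "s1 > 0" "\<And>s. 0 < s \<Longrightarrow> s < s1 \<Longrightarrow> z - s *\<^sub>R \<nu> 1 x \<notin> (\<lambda>x. g (1, x)) ` S3 \<and>
      bounded (connected_component_set (- (\<lambda>x. g (1, x)) ` S3) (z - s *\<^sub>R \<nu> 1 x))"
      using inner_pushoff_in_bounded_component[OF x] unfolding z_def by blast
    define s where "s = min s1 d / 2"
    have s: "0 < s" "s < s1" "s < d" using s1(1) d(1) by (auto simp: s_def)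
    have "norm (\<Phi> (z - s *\<^sub>R \<nu> 1 x)) \<le> \<epsilon>"
    proof (rule norm_le_on_bounded_component)
      show "compact ((\<lambda>x. g (1, x)) ` S3)" by (intro compact_continuous_image continuous_on_end) simp
      show "(\<lambda>x. g (1, x)) ` S3 \<subseteq> ball 0 \<delta>" "\<And>y. y \<in> (\<lambda>x. g (1, x)) ` S3 \<Longrightarrow> norm (\<Phi> y) \<le> \<epsilon>" using link_point by auto
    qed (use ball_U s1(2)[OF s(1,2)] in auto)
    then have "q s \<le> \<epsilon>\<^sup>2" unfolding q_def by (intro power_mono) auto
    moreover have "q 0 < q s" using d(2)[OF s(1,3)] by simp
    ultimately show False by (simp add: q_def zn)
  qed
  with nz show ?thesis by (simp add: z_def)
qed

end

section \<open>Comparison of the two invariants\<close>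

context link_isotopy begin

lemma smale_frame_homotopic:
  fixes k :: "real^5 \<Rightarrow> complex^3" and F :: "real^5 \<Rightarrow> real^5"
  assumes k: "smooth_on_open UNIV k" and kn: "\<And>y. norm (k y) = \<epsilon>" and eps: "\<epsilon> > 0"
    and F: "smooth_on_open V F" "to_R5 ` S3 \<subseteq> V"
    and kF: "\<And>x. x \<in> S3 \<Longrightarrow> k (F (to_R5 x)) = \<Phi> (g (1, x))"
    and C: "\<And>y. C y = frame6 (\<lambda>v. frechet_derivative k (at y) (to_R5 v)) (frechet_derivative k (at y) (axis 5 1)) (- k y)"
    and Cnz: "\<And>y. det (C y) \<noteq> 0"
    and B: "\<And>x. B x = jacobian F (at (to_R5 x))" and cB: "continuous_on S3 B" and Bnz: "\<And>x. x \<in> S3 \<Longrightarrow> det (B x) \<noteq> 0"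
  obtains p q where "continuous_on S3 p" "continuous_on S3 q"
    "freely_homotopic S3 GL6 (\<lambda>x. C 0 ** j_incl (B x)) (\<lambda>x. frame6 ((*v) (J (g (1, x)))) (p x) (q x))"
proof -
  define dk where "dk y = frechet_derivative k (at y)" for y
  have kd: "(k has_derivative dk y) (at y)" for y
    unfolding dk_def by (rule smooth_differentiable[OF k]) simp
  have lk: "linear (dk y)" for y using kd by (rule has_derivative_linear)
  have ck: "continuous_on UNIV k"
    using has_derivative_continuous[OF kd] continuous_at_imp_continuous_on by blast
  have cdk: "continuous_on S (\<lambda>z. dk (y z) (v z))" if "continuous_on S y" "continuous_on S v" for S y v
    unfolding dk_def by (rule continuous_on_derivative_moving[OF k]) (use that in auto)
  have ckc: "continuous_on S (\<lambda>z. k (y z))" if "continuous_on S y" for S y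
    by (rule continuous_on_compose2[OF ck that]) auto
  \<comment> \<open>The values of \<open>k\<close> have constant norm, so its derivative is tangent
    to the sphere.\<close>
  have k_orth: "dk y w \<bullet> k y = 0" for y w
  proof -
    have "((\<lambda>y. k y \<bullet> k y) has_derivative (\<lambda>w. k y \<bullet> dk y w + dk y w \<bullet> k y)) (at y)"
      by (rule has_derivative_inner[OF kd kd])
    moreover have "(\<lambda>y. k y \<bullet> k y) = (\<lambda>y. \<epsilon>\<^sup>2)" using kn by (simp add: power2_norm_eq_inner[symmetric])
    ultimately have "((\<lambda>y::real^5. \<epsilon>\<^sup>2) has_derivative (\<lambda>w. k y \<bullet> dk y w + dk y w \<bullet> k y)) (at y)" by simp
    then have "(\<lambda>w. k y \<bullet> dk y w + dk y w \<bullet> k y) = (\<lambda>w. 0)"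
      using has_derivative_unique has_derivative_const by blast
    then show ?thesis by (metis inner_commute mult_2 mult_eq_0_iff zero_neq_numeral)
  qed
  have C': "C y = frame6 (\<lambda>v. dk y (to_R5 v)) (dk y (axis 5 1)) (- k y)" for y
    unfolding C dk_def ..
  define Y where "Y x = F (to_R5 x)" for x
  have cR5: "continuous_on S to_R5" for S :: "(complex^2) set"
    by (rule bounded_linear.continuous_on[OF linear_conv_bounded_linear[THEN iffD1, OF linear_to_R5] continuous_on_id])
  have Fd: "(F has_derivative ((*v) (B x))) (at (to_R5 x))" if x: "x \<in> S3" for x
  proof -
    have "F differentiable (at (to_R5 x))"
      using smooth_differentiable[OF F(1)] F(2) x unfolding differentiable_def by blast
    then show ?thesis unfolding jacobian_works B .
  qed
  have cF: "continuous_on V F"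
    using has_derivative_continuous[OF smooth_differentiable[OF F(1)]] continuous_at_imp_continuous_on by blast
  have cY: "continuous_on S3 Y"
    unfolding Y_def by (rule continuous_on_compose2[OF cF cR5 F(2)])
  have kY: "k (Y x) = \<Phi> (g (1, x))" if "x \<in> S3" for x using kF[OF that] by (simp add: Y_def)
  define L p N where "L x v = dk (Y x) (B x *v to_R5 v)" and "p x = dk (Y x) (B x *v axis 5 1)" and "N x = \<Phi> (g (1, x))" for x v
  have linL: "linear (L x)" for x
  proof -
    have "linear (dk (Y x) \<circ> ((*v) (B x) \<circ> to_R5))"
      by (intro linear_compose linear_to_R5 lk matrix_vector_mul_linear)
    then show ?thesis by (simp add: o_def L_def[abs_def])
  qed
  have cL: "continuous_on S3 (\<lambda>x. L x (v x))" if "continuous_on S3 v" for v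
    unfolding L_def by (intro cdk cY continuous_intros cB bounded_linear.continuous_on[OF linear_conv_bounded_linear[THEN iffD1, OF linear_to_R5]] that)
  have cp: "continuous_on S3 p"
    unfolding p_def by (intro cdk cY continuous_intros cB)
  have cN: "continuous_on S3 N"
    unfolding N_def using link_point by (intro continuous_on_compose2[OF continuous_on_map continuous_on_end]) auto
  have ns: "v = 0 \<and> a = 0 \<and> b = 0" if x: "x \<in> S3" and 0: "L x v + a *\<^sub>R p x + b *\<^sub>R N x = 0" for x v a b
  proof -
    have "C (Y x) ** j_incl (B x) = frame6 (L x) (p x) (- N x)"
      unfolding C' frame6_j_incl[OF lk] by (simp add: L_def[abs_def] p_def N_def kY[OF x])
    then have "det (frame6 (L x) (p x) (- N x)) \<noteq> 0"
      using Cnz[of "Y x"] j_incl_det[OF Bnz[OF x]] by (metis det_mul mult_eq_0_iff)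
    then have "v = 0 \<and> a = 0 \<and> - b = 0"
      using 0 unfolding frame6_nonsingular[OF linL] by (metis scaleR_minus_left scaleR_minus_right minus_minus)
    then show ?thesis by simp
  qed
  have orthL: "L x v \<bullet> N x = 0" "p x \<bullet> N x = 0" if "x \<in> S3" for x v
    unfolding L_def p_def N_def kY[OF that, symmetric] by (rule k_orth)+
  have NN: "N x \<bullet> N x > 0" if "x \<in> S3" for x
  proof -
    have "norm (N x) = \<epsilon>" using link_point[OF that] by (simp add: N_def)
    then have "N x \<noteq> 0" using eps by auto
    then show ?thesis by simp
  qed
  \<comment> \<open>The two composites agree on \<open>S3\<close> only, so their derivatives are
    compared in tangent directions only; the radial value of \<open>L\<close> is unrelated to
    \<Phi>.\<close>
  have L_tangent: "L x v = J (g (1, x)) *v G 1 x v" if x: "x \<in> S3" and v: "v \<bullet> x = 0" for x v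
  proof (rule tangential_derivative_unique[OF _ _ _ x v])
    have "(to_R5 has_derivative to_R5) (at x)"
      by (rule bounded_linear_imp_has_derivative[OF linear_conv_bounded_linear[THEN iffD1, OF linear_to_R5]])
    from has_derivative_compose[OF has_derivative_compose[OF this Fd[OF x]] kd]
    show "((\<lambda>z. k (F (to_R5 z))) has_derivative L x) (at x)"
      by (simp add: L_def[abs_def] Y_def)
    show "((\<lambda>z. \<Phi> (g (1, z))) has_derivative (\<lambda>v. J (g (1, x)) *v G 1 x v)) (at x)"
      using has_derivative_compose[OF slice_derivative[OF W_in] has_derivative_jacobian] link_point[OF x] x by auto
  qed (rule kF)
  have cJ: "continuous_on S3 (\<lambda>x. J (g (1, x)))"
    using link_point by (intro continuous_on_compose2[OF continuous_on_jacobian continuous_on_end]) auto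
  have cnu: "continuous_on S3 (\<lambda>x. \<nu> 1 x)"
    by (rule continuous_on_compose2[OF continuous_normal, of _ "\<lambda>x. (1, x)", simplified]) (auto intro!: continuous_intros)
  define P where "P x v = v - (v \<bullet> x) *\<^sub>R x" for x v :: "complex^2"
  have linP: "P x (v + w) = P x v + P x w" "P x (c *\<^sub>R v) = c *\<^sub>R P x v" for x v w c
    by (simp_all add: P_def inner_add_left algebra_simps)
  have Px: "P x v \<bullet> x = 0" if "x \<in> S3" for x v
    unfolding P_def by (rule tangential_part[OF that])
  have Pv: "v = P x v + (v \<bullet> x) *\<^sub>R x" for x v by (simp add: P_def)
  have cP: "continuous_on S3 (\<lambda>x. P x v)" for v unfolding P_def by (intro continuous_intros)
  have xx: "x \<bullet> x = 1" if "x \<in> S3" for x :: "complex^2" using that by (simp add: norm_eq_1)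
  note cs = continuous_on_mult_snd
  have c1: "continuous_on ({0..1::real} \<times> S3) (\<lambda>z. L (snd z) (P (snd z) v))"
     "continuous_on ({0..1::real} \<times> S3) (\<lambda>z. L (snd z) (snd z))"
     "continuous_on ({0..1::real} \<times> S3) (\<lambda>z. p (snd z))" "continuous_on ({0..1::real} \<times> S3) (\<lambda>z. N (snd z))"
     "continuous_on ({0..1::real} \<times> S3) (\<lambda>z. J (g (1, snd z)))" "continuous_on ({0..1::real} \<times> S3) (\<lambda>z. \<nu> 1 (snd z))" for v
    by (rule cs[OF cL[OF cP]] cs[OF cL[OF continuous_on_id]] cs[OF cp] cs[OF cN] cs[OF cJ] cs[OF cnu])+
  \<comment> \<open>The parametrisation \<open>k\<close> is defined on all of R^5, so its frame
    \<open>C\<close> along the immersion contracts to the constant frame at the origin by scaling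
    the argument.\<close>
  have h0: "freely_homotopic S3 GL6 (\<lambda>x. C 0 ** j_incl (B x)) (\<lambda>x. frame6 (L x) (p x) (- N x))"
  proof (rule homotopic_freeI[where h = "\<lambda>t x. C (t *\<^sub>R Y x) ** j_incl (B x)"])
    show "continuous_on ({0..1} \<times> S3) (\<lambda>z. C (fst z *\<^sub>R Y (snd z)) ** j_incl (B (snd z)))"
      unfolding C' by (intro continuous_intros cdk ckc cs[OF cY] cs[OF cB])
    show "C (t *\<^sub>R Y x) ** j_incl (B x) \<in> GL6" if "x \<in> S3" for t x
      using Cnz j_incl_det[OF Bnz[OF that]] by (simp add: det_mul)
    show "C (1 *\<^sub>R Y x) ** j_incl (B x) = frame6 (L x) (p x) (- N x)" if "x \<in> S3" for x
      unfolding scaleR_one C' frame6_j_incl[OF lk] by (simp add: L_def[abs_def] p_def N_def kY[OF that])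
  qed simp
  have h1: "freely_homotopic S3 GL6 (\<lambda>x. frame6 (L x) (p x) (- N x))
     (\<lambda>x. frame6 (\<lambda>v. L x (P x v) + (v \<bullet> x) *\<^sub>R N x) (p x) (L x x))"
  proof (rule frame6_homotopic[where p = "\<lambda>t x. p x"
      and L = "\<lambda>t x v. L x (P x v) + (v \<bullet> x) *\<^sub>R (cos (t * pi / 2) *\<^sub>R L x x + sin (t * pi / 2) *\<^sub>R N x)"
      and q = "\<lambda>t x. - (cos (t * pi / 2) *\<^sub>R N x) + sin (t * pi / 2) *\<^sub>R L x x"])
    fix t x assume x: "x \<in> S3"
    interpret L: linear "L x" by (rule linL)
    show "linear (\<lambda>v. L x (P x v) + (v \<bullet> x) *\<^sub>R (cos (t * pi / 2) *\<^sub>R L x x + sin (t * pi / 2) *\<^sub>R N x))"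
      by (rule linearI) (simp_all add: linP L.add L.scale inner_add_left algebra_simps)
    show "v = 0 \<and> a = 0 \<and> b = 0" if 0: "L x (P x v) + (v \<bullet> x) *\<^sub>R (cos (t * pi / 2) *\<^sub>R L x x + sin (t * pi / 2) *\<^sub>R N x)
        + a *\<^sub>R p x + b *\<^sub>R (- (cos (t * pi / 2) *\<^sub>R N x) + sin (t * pi / 2) *\<^sub>R L x x) = 0" for v a b
    proof -
      \<comment> \<open>A quarter turn in the plane of \<open>L x x\<close> and \<open>N x\<close>.
        Independence reduces to inverting a rotation of the two coefficients v \<bullet> x and
        b.\<close>
      define c s where "c = cos (t * pi / 2)" and "s = sin (t * pi / 2)"
      have sc: "c * c + s * s = 1" using sin_cos_squared_add3[of "t * pi / 2"] by (simp add: c_def s_def)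
      have "L x (P x v + ((v \<bullet> x) * c + b * s) *\<^sub>R x) + a *\<^sub>R p x + ((v \<bullet> x) * s - b * c) *\<^sub>R N x = 0"
        using 0[folded c_def s_def] by (simp add: L.add L.scale algebra_simps)
      from ns[OF x this] have z: "P x v + ((v \<bullet> x) * c + b * s) *\<^sub>R x = 0" "a = 0" "(v \<bullet> x) * s - b * c = 0" by auto
      have "(P x v + ((v \<bullet> x) * c + b * s) *\<^sub>R x) \<bullet> x = (v \<bullet> x) * c + b * s"
        using Px[OF x] xx[OF x] by (simp add: inner_add_left)
      then have z2: "(v \<bullet> x) * c + b * s = 0" unfolding z(1) by simp
      have "(c * c + s * s) * (v \<bullet> x) = c * ((v \<bullet> x) * c + b * s) + s * ((v \<bullet> x) * s - b * c)"
        by (simp add: algebra_simps)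
      then have vx: "v \<bullet> x = 0" using z(3) z2 sc by simp
      have "(c * c + s * s) * b = s * ((v \<bullet> x) * c + b * s) - c * ((v \<bullet> x) * s - b * c)"
        by (simp add: algebra_simps)
      then have "b = 0" using z(3) z2 sc by simp
      moreover have "v = 0" using z(1) Pv[of v x] vx \<open>b = 0\<close> by simp
      ultimately show ?thesis using z(2) by simp
    qed
    show "frame6 (L x) (p x) (- N x) = frame6 (\<lambda>v. L x (P x v) + (v \<bullet> x) *\<^sub>R (cos (0 * pi / 2) *\<^sub>R L x x + sin (0 * pi / 2) *\<^sub>R N x)) (p x)
      (- (cos (0 * pi / 2) *\<^sub>R N x) + sin (0 * pi / 2) *\<^sub>R L x x)"
    proof -
      have "L x (P x v) + (v \<bullet> x) *\<^sub>R L x x = L x v" for v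
        by (subst (3) Pv[of v x]) (simp only: L.add L.scale)
      then show ?thesis by simp
    qed
  qed (auto intro!: continuous_intros c1)
  have pos: "(J (g (1, x)) *v \<nu> 1 x) \<bullet> N x > 0" if "x \<in> S3" for x
    using normal_derivative_positive[OF that] by (simp add: N_def)
  have ns2: "v = 0 \<and> a = 0 \<and> b = 0" if x: "x \<in> S3" and t: "t \<in> {0..1}"
    and 0: "L x (P x v) + (v \<bullet> x) *\<^sub>R ((1 - t) *\<^sub>R N x + t *\<^sub>R (J (g (1, x)) *v \<nu> 1 x)) + a *\<^sub>R p x + b *\<^sub>R L x x = 0" for t x v a b
  proof -
    interpret L: linear "L x" by (rule linL)
    \<comment> \<open>All other vectors are tangent to the target sphere, so only the coefficient of
      the moving vector survives the pairing with \<open>N x\<close>, and both its ends pair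
      positively.\<close>
    have "(L x (P x v) + (v \<bullet> x) *\<^sub>R ((1 - t) *\<^sub>R N x + t *\<^sub>R (J (g (1, x)) *v \<nu> 1 x)) + a *\<^sub>R p x + b *\<^sub>R L x x) \<bullet> N x
      = (v \<bullet> x) * ((1 - t) * (N x \<bullet> N x) + t * ((J (g (1, x)) *v \<nu> 1 x) \<bullet> N x))"
      using orthL[OF x] by (simp add: inner_add_left)
    then have "(v \<bullet> x) * ((1 - t) * (N x \<bullet> N x) + t * ((J (g (1, x)) *v \<nu> 1 x) \<bullet> N x)) = 0"
      unfolding 0 by simp
    moreover have "(1 - t) * (N x \<bullet> N x) + t * ((J (g (1, x)) *v \<nu> 1 x) \<bullet> N x) > 0"
      using t NN[OF x] pos[OF x] by (cases "t = 0") (auto intro!: add_nonneg_pos)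
    ultimately have vx: "v \<bullet> x = 0" by simp
    then have "L x (P x v + b *\<^sub>R x) + a *\<^sub>R p x + 0 *\<^sub>R N x = 0"
      using 0 by (simp add: L.add L.scale algebra_simps)
    from ns[OF x this] have z: "P x v + b *\<^sub>R x = 0" "a = 0" by auto
    have "(P x v + b *\<^sub>R x) \<bullet> x = b" using Px[OF x] xx[OF x] by (simp add: inner_add_left)
    then have "b = 0" unfolding z(1) by simp
    then show ?thesis using z vx Pv[of v x] by simp
  qed
  have JD: "L x (P x v) + (v \<bullet> x) *\<^sub>R (J (g (1, x)) *v \<nu> 1 x) = J (g (1, x)) *v D 1 x v" if x: "x \<in> S3" for x v
  proof -
    interpret Jz: linear "(*v) (J (g (1, x)))" by (rule linear_cmatrix)
    show ?thesis by (simp add: D_def Jz.add Jz.scale L_tangent[OF x Px[OF x]] flip: P_def)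
  qed
  have h2: "freely_homotopic S3 GL6 (\<lambda>x. frame6 (\<lambda>v. L x (P x v) + (v \<bullet> x) *\<^sub>R N x) (p x) (L x x))
    (\<lambda>x. frame6 (\<lambda>v. J (g (1, x)) *v D 1 x v) (p x) (L x x))"
  proof (rule frame6_homotopic[where p = "\<lambda>t x. p x" and q = "\<lambda>t x. L x x"
      and L = "\<lambda>t x v. L x (P x v) + (v \<bullet> x) *\<^sub>R ((1 - t) *\<^sub>R N x + t *\<^sub>R (J (g (1, x)) *v \<nu> 1 x))"])
    fix t x assume x: "x \<in> S3"
    interpret L: linear "L x" by (rule linL)
    show "linear (\<lambda>v. L x (P x v) + (v \<bullet> x) *\<^sub>R ((1 - t) *\<^sub>R N x + t *\<^sub>R (J (g (1, x)) *v \<nu> 1 x)))"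
      (is "linear (\<lambda>v. _ + (v \<bullet> x) *\<^sub>R ?m)")
    proof -
      have "linear (\<lambda>v. L x (P x v) + (v \<bullet> x) *\<^sub>R m)" for m
        by (rule linearI) (simp_all add: linP L.add L.scale inner_add_left algebra_simps)
      from this[of ?m] show ?thesis .
    qed
  qed (use ns2 JD in \<open>auto intro!: continuous_intros c1\<close>)
  have ns3: "v' = 0 \<and> a = 0 \<and> b = 0" if x: "x \<in> S3" and 0: "J (g (1, x)) *v v' + a *\<^sub>R p x + b *\<^sub>R L x x = 0" for x v' a b
  proof -
    have one: "(1::real) \<in> {0..1}" by simp
    obtain v where v: "D 1 x v = v'" using D_surjective[OF one x] by blast
    have "v = 0 \<and> a = 0 \<and> b = 0"
      by (rule ns2[OF x one]) (use 0 in \<open>simp add: JD[OF x] v\<close>)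
    then show ?thesis using v linear_0[OF linear_D[OF one x]] by simp
  qed
  \<comment> \<open>Only \<open>D\<close> moves. The image of \<open>J (g (1, x))\<close> is all
    that matters for independence from \<open>p x\<close> and \<open>L x x\<close>, and it does not
    change. This homotopy is used backwards.\<close>
  have h3: "freely_homotopic S3 GL6 (\<lambda>x. frame6 (\<lambda>v. J (g (1, x)) *v D 0 x v) (p x) (L x x))
    (\<lambda>x. frame6 (\<lambda>v. J (g (1, x)) *v D 1 x v) (p x) (L x x))"
  proof (rule frame6_homotopic[where p = "\<lambda>t x. p x" and q = "\<lambda>t x. L x x" and L = "\<lambda>t x v. J (g (1, x)) *v D t x v"])
    fix t x assume t: "t \<in> {0..1::real}" and x: "x \<in> S3"
    show "linear (\<lambda>v. J (g (1, x)) *v D t x v)"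
      using linear_compose[OF linear_D[OF t x] linear_cmatrix] by (simp add: o_def)
    show "v = 0 \<and> a = 0 \<and> b = 0" if "J (g (1, x)) *v D t x v + a *\<^sub>R p x + b *\<^sub>R L x x = 0" for v a b
      using ns3[OF x that] D_nonzero[OF t x] by blast
  qed (auto intro!: continuous_intros c1 continuous_on_D)
  have h4: "freely_homotopic S3 GL6 (\<lambda>x. frame6 (\<lambda>v. J (g (1, x)) *v D 0 x v) (p x) (L x x))
    (\<lambda>x. frame6 ((*v) (J (g (1, x)))) (p x) (L x x))"
  proof (rule frame6_homotopic[where p = "\<lambda>t x. p x" and q = "\<lambda>t x. L x x"
      and L = "\<lambda>t x v. J (g (1, x)) *v ((1 - t) *\<^sub>R D 0 x v + t *\<^sub>R v)"])
    fix t x assume t: "t \<in> {0..1::real}" and x: "x \<in> S3"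
    have lD: "linear (D 0 x)" using x by (intro linear_D) auto
    have "linear (\<lambda>v. (1 - t) *\<^sub>R D 0 x v + t *\<^sub>R v)"
      by (rule linearI) (simp_all add: linear_add[OF lD] linear_scale[OF lD] algebra_simps)
    from linear_compose[OF this linear_cmatrix]
    show "linear (\<lambda>v. J (g (1, x)) *v ((1 - t) *\<^sub>R D 0 x v + t *\<^sub>R v))" by (simp add: o_def)
    show "v = 0 \<and> a = 0 \<and> b = 0" if 0: "J (g (1, x)) *v ((1 - t) *\<^sub>R D 0 x v + t *\<^sub>R v) + a *\<^sub>R p x + b *\<^sub>R L x x = 0" for v a b
    proof -
      have z: "(1 - t) *\<^sub>R D 0 x v + t *\<^sub>R v = 0" "a = 0" "b = 0" using ns3[OF x 0] by auto
      have "v = 0"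
      proof (rule ccontr)
        assume v: "v \<noteq> 0"
        have "((1 - t) *\<^sub>R D 0 x v + t *\<^sub>R v) \<bullet> v = (1 - t) * (D 0 x v \<bullet> v) + t * (v \<bullet> v)"
          by (simp add: inner_add_left)
        also have "\<dots> > 0"
          using t D_start[OF x v] v by (cases "t = 0") (auto intro!: add_nonneg_pos)
        finally show False unfolding z(1) by simp
      qed
      then show ?thesis using z by simp
    qed
  next
    have "continuous_on S3 (\<lambda>x. D 0 x v)" for v
      by (rule continuous_on_compose2[OF continuous_on_D, of _ "\<lambda>x. (0, x)", simplified]) (auto intro!: continuous_intros)
    from cs[OF this] show "continuous_on ({0..1} \<times> S3) (\<lambda>z. J (g (1, snd z)) *v ((1 - fst z) *\<^sub>R D 0 (snd z) v + fst z *\<^sub>R v))" for v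
      by (intro continuous_intros c1)
  qed (auto intro!: continuous_intros c1)
  show ?thesis
  proof (rule that[OF cp cL[OF continuous_on_id]])
    show "freely_homotopic S3 GL6 (\<lambda>x. C 0 ** j_incl (B x)) (\<lambda>x. frame6 ((*v) (J (g (1, x)))) (p x) (L x x))"
      by (intro homotopic_with_trans[OF h0] homotopic_with_trans[OF h1] homotopic_with_trans[OF h2]
        homotopic_with_trans[OF homotopic_with_symD[OF h3]] h4)
  qed
qed

text \<open>The isotopy may leave the ball on which the Jacobian has rank 2. The map
  \<open>c\<close> pulls points radially back to norm at most m, the largest norm on the link, so
  that m < \<delta> and the link itself stays fixed; the initial sphere of radius r becomes one of
  radius \<open>min r m\<close>.\<close>

lemma jacobian_homotopic_round_sphere:
  obtains r' where "0 < r'" "r' < \<delta>"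
    "freely_homotopic S3 V2C3 (\<lambda>x. J (r' *\<^sub>R x)) (\<lambda>x. J (g (1, x)))"
proof -
  have "compact ((\<lambda>x. g (1, x)) ` S3)" by (intro compact_continuous_image continuous_on_end) simp
  then have c: "compact (norm ` (\<lambda>x. g (1, x)) ` S3)"
    by (rule compact_continuous_image[OF continuous_on_norm_id])
  have ne: "norm ` (\<lambda>x. g (1, x)) ` S3 \<noteq> {}" using S3_base_in by blast
  from compact_attains_sup[OF c ne] obtain m where m: "m \<in> norm ` (\<lambda>x. g (1, x)) ` S3"
    "\<And>y. y \<in> norm ` (\<lambda>x. g (1, x)) ` S3 \<Longrightarrow> y \<le> m"
    by blast
  have m\<delta>: "0 < m" "m < \<delta>" using m(1) link_point avoids_0[of 1] by auto
  have le: "norm (g (1, x)) \<le> m" if "x \<in> S3" for x using m(2) that by blast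
  define c where "c z = min 1 (m / norm z) *\<^sub>R z" for z :: "complex^2"
  have c0: "c z \<noteq> 0" if "z \<noteq> 0" for z using that m\<delta> by (simp add: c_def min_def)
  have cb: "c z \<in> ball 0 \<delta>" if "z \<noteq> 0" for z
  proof -
    have "norm (c z) = min 1 (m / norm z) * norm z" using m\<delta> by (simp add: c_def)
    also have "\<dots> \<le> m / norm z * norm z" by (intro mult_right_mono) auto
    finally show ?thesis using that m\<delta> by simp
  qed
  have c_id: "c z = z" if "norm z \<le> m" "z \<noteq> 0" for z
    using that by (simp add: c_def min_def field_simps)
  have cg: "continuous_on ({0..1} \<times> S3) (\<lambda>z. g (fst z, snd z))"
    using continuous_on_subset[OF continuous_on_g sub_W] by simp
  show ?thesis
  proof (rule that[of "min r m"])
    show "0 < min r m" "min r m < \<delta>" using r m\<delta> by auto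
    show "freely_homotopic S3 V2C3 (\<lambda>x. J (min r m *\<^sub>R x)) (\<lambda>x. J (g (1, x)))"
    proof (rule homotopic_freeI[where h = "\<lambda>t x. J (c (g (t, x)))"])
      show "continuous_on ({0..1} \<times> S3) (\<lambda>z. J (c (g (fst z, snd z))))"
      proof (rule continuous_on_compose2[OF continuous_on_jacobian])
        show "continuous_on ({0..1} \<times> S3) (\<lambda>z. c (g (fst z, snd z)))"
          unfolding c_def using avoids_0 by (intro continuous_intros cg) auto
        show "(\<lambda>z. c (g (fst z, snd z))) ` ({0..1} \<times> S3) \<subseteq> U"
          using cb avoids_0 ball_U by force
      qed
      show "J (c (g (t, x))) \<in> V2C3" if "0 \<le> t \<and> t \<le> 1" "x \<in> S3" for t x
        using that avoids_0[of t x] by (intro regular cb c0) auto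
      show "J (c (g (0, x))) = J (min r m *\<^sub>R x)" if "x \<in> S3" for x
      proof -
        have "c (g (0, x)) = min r m *\<^sub>R x"
          using start[OF that] r m\<delta> that by (simp add: c_def min_def field_simps)
        then show ?thesis by simp
      qed
      show "J (c (g (1, x))) = J (g (1, x))" if "x \<in> S3" for x
        using c_id[OF le[OF that]] avoids_0[of 1 x] that by simp
    qed
  qed
qed

end

lemma S3_embedding_cong:
  assumes "S3_embedding f" "\<And>x. x \<in> S3 \<Longrightarrow> g x = f x"
  shows "S3_embedding g"
proof -
  have "inj_on g S3" using assms unfolding S3_embedding_def inj_on_def by auto
  moreover have "S3_immersion g"
    using assms unfolding S3_embedding_def S3_immersion_def by auto
  ultimately show ?thesis by (simp add: S3_embedding_def)
qed

lemma punctured_S5_param_det: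
  assumes "punctured_S5_param \<epsilon> q k"
  shows "det (frame6 (\<lambda>v. frechet_derivative k (at y) (to_R5 v)) (frechet_derivative k (at y) (axis 5 1)) (- k y)) > 0"
proof (rule det_normal_last)
  show "det (vector [to_R6 (k y), to_R6 (frechet_derivative k (at y) (axis 1 1)), to_R6 (frechet_derivative k (at y) (axis 2 1)),
     to_R6 (frechet_derivative k (at y) (axis 3 1)), to_R6 (frechet_derivative k (at y) (axis 4 1)),
     to_R6 (frechet_derivative k (at y) (axis 5 1))] :: real^6^6) > 0"
    using assms unfolding punctured_S5_param_def Let_def by blast
  have e: "to_R5 (axis 1 1) = axis 1 1" "to_R5 (axis 1 \<i>) = axis 2 1" "to_R5 (axis 2 1) = axis 3 1" "to_R5 (axis 2 \<i>) = axis 4 1"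
    by (simp_all add: vec_eq_iff forall_5 to_R5_nth axis_def)
  show "frechet_derivative k (at y) (to_R5 (axis 1 1)) = frechet_derivative k (at y) (axis 1 1)"
    "frechet_derivative k (at y) (to_R5 (axis 1 \<i>)) = frechet_derivative k (at y) (axis 2 1)"
    "frechet_derivative k (at y) (to_R5 (axis 2 1)) = frechet_derivative k (at y) (axis 3 1)"
    "frechet_derivative k (at y) (to_R5 (axis 2 \<i>)) = frechet_derivative k (at y) (axis 4 1)"
    by (simp_all add: e)
qed

text \<open>Agreement is shown for arbitrary representatives of the two classes, because
  \<open>pi3_map\<close> is a union over all of them.\<close>

lemma smale_invariant_classes_agree:
  assumes \<Phi>: "holomorphic_map \<Phi> U" and \<delta>: "0 < \<delta>" "ball 0 \<delta> \<subseteq> U" and eps: "\<epsilon> > 0"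
    and regular: "\<And>z. z \<in> ball 0 \<delta> \<Longrightarrow> z \<noteq> 0 \<Longrightarrow> complex_jacobian \<Phi> z \<in> V2C3"
    and assoc: "associated_immersion \<Phi> \<delta> \<epsilon> f" and smale: "is_smale_invariant_S5 \<epsilon> f \<omega>"
    and a: "a \<in> \<omega>"
    and h: "continuous_on S3 h" "h ` S3 \<subseteq> U3" "h S3_base = mat 1"
      "\<And>r. 0 < r \<Longrightarrow> r < \<delta> \<Longrightarrow> freely_homotopic S3 V2C3 (frame_of \<circ> h) (\<lambda>x. complex_jacobian \<Phi> (r *\<^sub>R x))"
  shows "pi3_class SO6 (mat 1) (tau \<circ> h) = pi3_class SO6 (mat 1) (j_incl \<circ> a)"
proof -
  obtain \<phi> where \<phi>: "identifies_S3 (link_at_origin \<Phi> \<delta> \<epsilon>) \<phi>" and f: "f = \<Phi> \<circ> \<phi>"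
    using assoc unfolding associated_immersion_def by blast
  obtain r H where r: "r > 0" and \<phi>S: "\<phi> ` S3 = link_at_origin \<Phi> \<delta> \<epsilon>" and H: "smooth_on ({0..1} \<times> S3) H"
    "\<And>t. t \<in> {0..1} \<Longrightarrow> S3_embedding (\<lambda>x. H (t, x))" "\<And>t x. t \<in> {0..1} \<Longrightarrow> x \<in> S3 \<Longrightarrow> H (t, x) \<noteq> 0"
    "\<And>x. x \<in> S3 \<Longrightarrow> H (0::real, x) = r *\<^sub>R x" "\<And>x. x \<in> S3 \<Longrightarrow> H (1, x) = \<phi> x"
    using \<phi> unfolding identifies_S3_def by blast
  obtain W g where g: "{0..1} \<times> S3 \<subseteq> W" "smooth_on_open W g" "\<And>z. z \<in> {0..1} \<times> S3 \<Longrightarrow> g z = H z"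
    using H(1) unfolding smooth_on_def by blast
  have g1: "g (1, x) = \<phi> x" if "x \<in> S3" for x using g(3)[of "(1, x)"] H(5) that by simp
  interpret sphere_isotopy g W r
  proof
    show "S3_embedding (\<lambda>x. g (t, x))" if "t \<in> {0..1}" for t
      by (rule S3_embedding_cong[OF H(2)[OF that]]) (use g(3) that in auto)
  qed (use g r H(4) in auto)
  obtain \<nu> where \<nu>: "continuous_on ({0..1} \<times> S3) (\<lambda>z. \<nu> (fst z) (snd z))"
    "\<And>t x. t \<in> {0..1} \<Longrightarrow> x \<in> S3 \<Longrightarrow> \<nu> t x \<noteq> 0"
    "\<And>t x v. t \<in> {0..1} \<Longrightarrow> x \<in> S3 \<Longrightarrow> v \<bullet> x = 0 \<Longrightarrow> \<nu> t x \<bullet> G t x v = 0"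
    "\<And>x. x \<in> S3 \<Longrightarrow> \<exists>a>0. \<nu> 0 x = a *\<^sub>R x"
    by (rule exists_normal, rule that, assumption+)
  interpret holomorphic_map \<Phi> U by (rule \<Phi>)
  interpret link_isotopy g W r \<nu> \<Phi> U \<delta> \<epsilon>
  proof
    have "(\<lambda>x. g (1, x)) ` S3 = \<phi> ` S3" using g1 by (intro image_cong) auto
    then show "(\<lambda>x. g (1, x)) ` S3 = {z \<in> ball 0 \<delta>. norm (\<Phi> z) = \<epsilon>}"
      unfolding \<phi>S link_at_origin_def by simp
    show "g (t, x) \<noteq> 0" if "t \<in> {0..1}" "x \<in> S3" for t x
      using g(3)[of "(t, x)"] H(3) that by simp
  qed (use \<nu> \<delta> regular in auto)
  obtain q k where q: "q \<in> sphere 0 \<epsilon> - f ` S3" and k: "punctured_S5_param \<epsilon> q k"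
    and inv: "is_smale_invariant_R5 (inv k \<circ> f) \<omega>" and fS: "f ` S3 \<subseteq> sphere 0 \<epsilon>"
    using smale unfolding is_smale_invariant_S5_def by blast
  obtain V F where \<omega>: "\<omega> \<in> pi3 SO5 (mat 1)" and F: "to_R5 ` S3 \<subseteq> V" "smooth_on_open V F"
    "\<And>y. y \<in> V \<Longrightarrow> det (jacobian F (at y)) > 0" "\<And>x. x \<in> S3 \<Longrightarrow> F (to_R5 x) = (inv k \<circ> f) x"
    and cls: "is_class_of GLpos5 (pi3_map GLpos5 (mat 1) (\<lambda>A. A) \<omega>) (\<lambda>x. jacobian F (at (to_R5 x)))"
    using inv unfolding is_smale_invariant_R5_def by blast
  have kb: "bij_betw k UNIV (sphere 0 \<epsilon> - {q})" using k unfolding punctured_S5_param_def by blast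
  have kn: "norm (k y) = \<epsilon>" for y using bij_betwE[OF kb] by auto
  have ks: "smooth_on_open UNIV k"
  proof -
    obtain W' g' where "UNIV \<subseteq> W'" "smooth_on_open W' g'" "\<forall>x\<in>UNIV. g' x = k x"
      using k unfolding punctured_S5_param_def smooth_on_def by blast
    moreover then have "W' = UNIV" "g' = k" by auto
    ultimately show ?thesis by simp
  qed
  have kF: "k (F (to_R5 x)) = \<Phi> (g (1, x))" if x: "x \<in> S3" for x
  proof -
    have "f x \<in> sphere 0 \<epsilon>" "f x \<noteq> q" using fS q x by blast+
    then have "f x \<in> range k" using kb unfolding bij_betw_def by blast
    then show ?thesis using F(4)[OF x] g1[OF x] by (simp add: f f_inv_into_f)
  qed
  define B where "B x = jacobian F (at (to_R5 x))" for x
  define C where "C y = frame6 (\<lambda>v. frechet_derivative k (at y) (to_R5 v)) (frechet_derivative k (at y) (axis 5 1)) (- k y)" for y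
  have Cpos: "det (C y) > 0" for y unfolding C_def by (rule punctured_S5_param_det[OF k])
  have Bpos: "det (B x) > 0" if "x \<in> S3" for x unfolding B_def using F(1) that by (intro F(3)) blast
  obtain a0 where a0: "continuous_on S3 a0" "a0 ` S3 \<subseteq> SO5" "a0 S3_base = mat 1" and \<omega>0: "\<omega> = pi3_class SO5 (mat 1) a0"
    using \<omega> unfolding pi3_def by blast
  have SO5_GL: "SO5 \<subseteq> GLpos5" by (auto simp: SO5_def GLpos5_def rotation_matrix_def)
  have \<omega>a0: "freely_homotopic S3 GLpos5 a0 b" if "b \<in> \<omega>" for b
    using that homotopic_with_subset_right[OF homotopic_canon_freely SO5_GL] unfolding \<omega>0 pi3_class_def by blast
  obtain b where b: "b \<in> \<omega>" "freely_homotopic S3 GLpos5 b B"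
  proof -
    from cls obtain c where c: "c \<in> pi3_map GLpos5 (mat 1) (\<lambda>A. A) \<omega>" "freely_homotopic S3 GLpos5 c B"
      unfolding is_class_of_def B_def by blast
    then obtain b where b: "b \<in> \<omega>" "homotopic_with_canon (\<lambda>h. h S3_base = mat 1) S3 GLpos5 b c"
      unfolding pi3_map_def pi3_class_def o_def by blast
    show ?thesis by (rule that[OF b(1) homotopic_with_trans[OF homotopic_canon_freely[OF b(2)] c(2)]])
  qed
  \<comment> \<open>All representatives of \<omega> are freely homotopic in the larger group, and
    one of them to the Jacobian of the extension.\<close>
  have aB: "freely_homotopic S3 GLpos5 a B"
    using homotopic_with_trans[OF homotopic_with_symD[OF \<omega>a0[OF a]] homotopic_with_trans[OF \<omega>a0[OF b(1)] b(2)]] .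
  have a': "a ` S3 \<subseteq> SO5" "a S3_base = mat 1" "continuous_on S3 a"
  proof -
    have ha: "homotopic_with_canon (\<lambda>h. h S3_base = mat 1) S3 SO5 a0 a"
      using a unfolding \<omega>0 pi3_class_def by blast
    show "a ` S3 \<subseteq> SO5" "a S3_base = mat 1" "continuous_on S3 a"
      using homotopic_with_imp_subset2[OF ha] homotopic_with_imp_property[OF ha] homotopic_with_imp_continuous[OF ha] by blast+
  qed
  have cB: "continuous_on S3 B" using homotopic_with_imp_continuous[OF aB] by blast
  obtain p q' where pq: "continuous_on S3 p" "continuous_on S3 q'"
    "freely_homotopic S3 GL6 (\<lambda>x. C 0 ** j_incl (B x)) (\<lambda>x. frame6 ((*v) (J (g (1, x)))) (p x) (q' x))"
  proof (rule smale_frame_homotopic[OF ks kn eps F(2,1) kF C_def _ B_def cB])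
    show "det (C y) \<noteq> 0" for y using Cpos[of y] by simp
    show "det (B x) \<noteq> 0" if "x \<in> S3" for x using Bpos[OF that] by simp
  qed (assumption | rule that)+
  have "freely_homotopic S3 GL6 ((\<lambda>A. C 0 ** j_incl A) \<circ> a) ((\<lambda>A. C 0 ** j_incl A) \<circ> B)"
  proof (rule homotopic_with_compose_continuous_left[OF aB])
    show "(\<lambda>A. C 0 ** j_incl A) \<in> GLpos5 \<rightarrow> GL6"
      using j_incl_det Cpos[of 0] by (auto simp: det_mul GLpos5_def)
  qed (intro continuous_intros)
  then have 1: "freely_homotopic S3 GL6 (\<lambda>x. C 0 ** j_incl (a x)) (\<lambda>x. frame6 ((*v) (J (g (1, x)))) (p x) (q' x))"
    using homotopic_with_trans[OF _ pq(3)] by (simp add: o_def)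
  obtain r' where r': "0 < r'" "r' < \<delta>" "freely_homotopic S3 V2C3 (\<lambda>x. J (r' *\<^sub>R x)) (\<lambda>x. J (g (1, x)))"
    using jacobian_homotopic_round_sphere by blast
  have 2: "freely_homotopic S3 GL6 (\<lambda>x. tau (h x)) (\<lambda>x. frame6 ((*v) (J (g (1, x)))) (p x) (q' x))"
  proof (rule tau_homotopic_frame6[OF h(1-3) _ _ pq(1,2)])
    show hJ: "freely_homotopic S3 V2C3 (frame_of \<circ> h) (\<lambda>x. J (g (1, x)))"
      by (rule homotopic_with_trans[OF h(4)[OF r'(1,2)] r'(3)])
    show "continuous_on S3 (\<lambda>x. J (g (1, x)))"
      using homotopic_with_imp_continuous[OF hJ] by blast
    \<comment> \<open>The homotopy starts at the base point from \<open>C 0\<close>, whose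
      determinant is positive since the parametrisation preserves orientation.\<close>
    show "det (frame6 ((*v) (J (g (1, x)))) (p x) (q' x)) > 0" if "x \<in> S3" for x
      by (rule homotopic_det_pos[OF 1 S3_base_in _ that]) (simp add: a' j_incl_mat_1 Cpos)
  qed
  have hU: "h x \<in> U3" if "x \<in> S3" for x using h(2) that by auto
  have aO: "orthogonal_matrix (a x)" if "x \<in> S3" for x   proof -
    have "a x \<in> SO5" using a'(1) that by blast
    then show ?thesis by (simp add: SO5_def rotation_matrix_def)
  qed
  show ?thesis
  proof (rule rotation_group_pointed_homotopy[where C = "mat 1" and C' = "C 0"])
    show "(tau \<circ> h) S3_base = mat 1" "(j_incl \<circ> a) S3_base = mat 1"
      by (simp_all add: h a' tau_mat_1 j_incl_mat_1)
    show "(tau \<circ> h) ` S3 \<subseteq> SO6"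
      by (rule orthogonal_pointed_SO6) (use h hU in \<open>auto intro!: continuous_intros tau_U3_orthogonal simp: o_def tau_mat_1\<close>)
    show "(j_incl \<circ> a) ` S3 \<subseteq> SO6"
      by (rule orthogonal_pointed_SO6) (use a' aO in \<open>auto intro!: continuous_intros j_incl_orthogonal simp: o_def j_incl_mat_1\<close>)
    show "det (mat 1 :: real^6^6) \<noteq> 0" "det (C 0) \<noteq> 0" using Cpos[of 0] by simp_all
    show "freely_homotopic S3 GL6 (\<lambda>x. mat 1 ** (tau \<circ> h) x) (\<lambda>x. C 0 ** (j_incl \<circ> a) x)"
      using homotopic_with_trans[OF 2 homotopic_with_symD[OF 1]] by simp
  qed
qed

theorem proposition4p1:
  fixes \<Phi> :: "complex^2 \<Rightarrow> complex^3"
  assumes "holomorphic_germ \<Phi>" and "\<Phi> 0 = 0" and "singular_only_at_origin \<Phi>"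
  shows "\<forall>\<^sub>F \<delta> in at_right 0. \<forall>\<^sub>F \<epsilon> in at_right 0. \<forall>f \<omega>.
    associated_immersion \<Phi> \<delta> \<epsilon> f \<longrightarrow> is_smale_invariant_S5 \<epsilon> f \<omega> \<longrightarrow>
      pi3_map SO6 (mat 1) tau (Omega_C \<Phi>) = pi3_map SO6 (mat 1) j_incl \<omega>"
proof -
  obtain U1 where U1: "open U1" "0 \<in> U1" "\<forall>z\<in>U1. \<exists>D. (\<Phi> has_derivative D) (at z) \<and> (\<forall>c v. D (c *s v) = c *s D v)"
    using assms(1) unfolding holomorphic_germ_def by blast
  obtain U2 where U2: "open U2" "0 \<in> U2" "{z\<in>U2. rank (complex_jacobian \<Phi> z) < 2} \<subseteq> {0}"
    using assms(3) unfolding singular_only_at_origin_def by blast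
  interpret holomorphic_map \<Phi> "U1 \<inter> U2"
    by unfold_locales (use U1 U2 in auto)
  \<comment> \<open>This radius, on which \<Phi> is holomorphic and regular off the origin, bounds
    both the spheres used for the complex invariant and the ball containing the link.\<close>
  obtain \<rho> where \<rho>: "\<rho> > 0" "ball 0 \<rho> \<subseteq> U1 \<inter> U2"
    using open_U U1(2) U2(2) unfolding open_contains_ball by blast
  have V: "J z \<in> V2C3" if "z \<in> ball 0 \<rho>" "z \<noteq> 0" for z
    using U2(3) \<rho>(2) that by (intro rank_ge_2_V2C3) auto
  have J_scaled: "continuous_on ({0..1::real} \<times> S3) (\<lambda>z. J (((1 - fst z) * r + fst z * s) *\<^sub>R snd z))"
    "\<And>t x. t \<in> {0..1} \<Longrightarrow> x \<in> S3 \<Longrightarrow> J (((1 - t) * r + t * s) *\<^sub>R x) \<in> V2C3"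
    if rs: "0 < r" "r < \<rho>" "0 < s" "s < \<rho>" for r s
  proof -
    have b: "0 < (1 - t) * r + t * s" "(1 - t) * r + t * s < \<rho>" if "t \<in> {0..1}" for t
    proof -
      have "(1 - t) * r + t * s \<ge> (1 - t) * min r s + t * min r s" using that by (intro add_mono mult_left_mono) auto
      moreover have "(1 - t) * r + t * s \<le> (1 - t) * max r s + t * max r s" using that by (intro add_mono mult_left_mono) auto
      ultimately show "0 < (1 - t) * r + t * s" "(1 - t) * r + t * s < \<rho>" using rs by (auto simp: algebra_simps)
    qed
    have B: "((1 - t) * r + t * s) *\<^sub>R x \<in> ball 0 \<rho>" "((1 - t) * r + t * s) *\<^sub>R x \<noteq> 0" if "t \<in> {0..1}" "x \<in> S3" for t and x :: "complex^2"
      using b[OF that(1)] that(2) by auto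
    show "continuous_on ({0..1::real} \<times> S3) (\<lambda>z. J (((1 - fst z) * r + fst z * s) *\<^sub>R snd z))"
      by (rule continuous_on_compose2[OF continuous_on_jacobian]) (use B(1) \<rho>(2) in \<open>auto intro!: continuous_intros\<close>)
    show "J (((1 - t) * r + t * s) *\<^sub>R x) \<in> V2C3" if "t \<in> {0..1}" "x \<in> S3" for t x
      by (intro V B that)
  qed
  have J_hom: "freely_homotopic S3 V2C3 (\<lambda>x. J (r *\<^sub>R x)) (\<lambda>x. J (s *\<^sub>R x))"
    if "0 < r" "r < \<rho>" "0 < s" "s < \<rho>" for r s
    by (rule homotopic_freeI[where h = "\<lambda>t x. J (((1 - t) * r + t * s) *\<^sub>R x)"])
       (use J_scaled[OF that] in auto)
  obtain f0 where f0: "continuous_on S3 f0" "f0 ` S3 \<subseteq> U3" "f0 S3_base = mat 1" "Omega_C \<Phi> = pi3_class U3 (mat 1) f0"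
    "\<And>r. 0 < r \<Longrightarrow> r < \<rho> \<Longrightarrow> freely_homotopic S3 V2C3 (frame_of \<circ> f0) (\<lambda>x. J (r *\<^sub>R x))"
  proof (rule Omega_C_representative[OF \<rho>(1)])
    show "continuous_on S3 (\<lambda>x. J (r *\<^sub>R x))" if "0 < r" "r < \<rho>" for r
      using homotopic_with_imp_continuous[OF J_hom[OF that that]] by blast
    show "J (r *\<^sub>R x) \<in> V2C3" if "0 < r" "r < \<rho>" "x \<in> S3" for r x
      using that by (intro V) auto
    show "freely_homotopic S3 V2C3 (\<lambda>x. J (r *\<^sub>R x)) (\<lambda>x. J (s *\<^sub>R x))"
      if "0 < r" "r < \<rho>" "0 < s" "s < \<rho>" for r s
      by (rule J_hom[OF that])
  qed (rule that, assumption+)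
  have sub: "frame_of ` U3 \<subseteq> V2C3" using frame_of_V2C3 U3_det by auto
  have Omega: "continuous_on S3 h" "h ` S3 \<subseteq> U3" "h S3_base = mat 1"
    "\<And>r. 0 < r \<Longrightarrow> r < \<rho> \<Longrightarrow> freely_homotopic S3 V2C3 (frame_of \<circ> h) (\<lambda>x. J (r *\<^sub>R x))"
    if "h \<in> Omega_C \<Phi>" for h
  proof -
    have hf: "homotopic_with_canon (\<lambda>h. h S3_base = mat 1) S3 U3 f0 h"
      using that unfolding f0(4) pi3_class_def by blast
    show "continuous_on S3 h" "h ` S3 \<subseteq> U3" "h S3_base = mat 1"
      using homotopic_with_imp_continuous[OF hf] homotopic_with_imp_subset2[OF hf] homotopic_with_imp_property[OF hf] by blast+
    have "freely_homotopic S3 V2C3 (frame_of \<circ> h) (frame_of \<circ> f0)"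
      by (rule homotopic_with_compose_continuous_left[OF homotopic_with_symD[OF homotopic_canon_freely[OF hf]]])
         (use sub in \<open>auto intro!: continuous_intros\<close>)
    then show "freely_homotopic S3 V2C3 (frame_of \<circ> h) (\<lambda>x. J (r *\<^sub>R x))" if "0 < r" "r < \<rho>" for r
      using homotopic_with_trans f0(5)[OF that] by blast
  qed
  have "pi3_map SO6 (mat 1) tau (Omega_C \<Phi>) = pi3_map SO6 (mat 1) j_incl \<omega>"
    if \<delta>: "0 < \<delta>" "\<delta> < \<rho>" and \<epsilon>: "0 < \<epsilon>" and f: "associated_immersion \<Phi> \<delta> \<epsilon> f" and \<omega>: "is_smale_invariant_S5 \<epsilon> f \<omega>" for \<delta> \<epsilon> f \<omega>
  proof -
    have eq: "pi3_class SO6 (mat 1) (tau \<circ> h) = pi3_class SO6 (mat 1) (j_incl \<circ> a)" if "h \<in> Omega_C \<Phi>" "a \<in> \<omega>" for h a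
    proof (rule smale_invariant_classes_agree[OF holomorphic_map_axioms \<delta>(1) _ \<epsilon> _ f \<omega> that(2) Omega(1-3)[OF that(1)]])
      show "ball 0 \<delta> \<subseteq> U1 \<inter> U2" using \<rho>(2) \<delta>(2) by force
      show "J z \<in> V2C3" if "z \<in> ball 0 \<delta>" "z \<noteq> 0" for z
        using that \<delta>(2) by (intro V) auto
    qed (use Omega(4)[OF that(1)] \<delta>(2) in auto)
    have "\<omega> \<in> pi3 SO5 (mat 1)"
      using \<omega> unfolding is_smale_invariant_S5_def is_smale_invariant_R5_def by blast
    then obtain a0 where "continuous_on S3 a0" "a0 ` S3 \<subseteq> SO5" "a0 S3_base = mat 1" "\<omega> = pi3_class SO5 (mat 1) a0"
      unfolding pi3_def by blast
    then have "a0 \<in> \<omega>" by (auto simp: pi3_class_def)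
    moreover have "f0 \<in> Omega_C \<Phi>" unfolding f0(4) using f0(1-3) by (auto simp: pi3_class_def)
    \<comment> \<open>Both sides are unions of one common class over nonempty index sets.\<close>
    ultimately show ?thesis unfolding pi3_map_def using eq by blast
  qed
  moreover have "\<forall>\<^sub>F \<delta> in at_right 0. 0 < \<delta> \<and> \<delta> < \<rho>" using \<rho>(1) by (auto simp: eventually_at_right_field)
  moreover have "\<forall>\<^sub>F \<epsilon> in at_right 0. 0 < (\<epsilon>::real)" by (simp add: eventually_at_right_less)
  ultimately show ?thesis
    by (auto elim!: eventually_mono)
qed

end
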